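(* Let $\Gamma$ be a countably infinite discrete amenable group. For every $f\in\mathbb{C}\Gamma$ we have $$\mathrm{per}(|f|)\ge\det{}_{\mathrm{FK}}(f).$$
   Context: $\mathscr{F}(\Gamma)$ is the collection of all nonempty finite subsets of $\Gamma$. $\mathbb{C}\Gamma$ is the complex group ring (finitely supported functions $f\colon s\mapsto f_s$ on $\Gamma$), $\mathbb{R}_{\ge0}\Gamma$ is the set of its elements with nonnegative real values, and $|f|\in\mathbb{R}_{\ge0}\Gamma$ is given by $|f|_s=|f_s|$. For $\mathsf{A},F\in\mathscr{F}(\Gamma)$ and $x\in\mathsf{A}^F$ let $\varphi^{(x)}\colon F\to\Gamma$, $\varphi^{(x)}(s)=sx_s$, and let $X_{\mathsf{A},F}$ be the set of all $x\in\mathsf{A}^F$ such that $\varphi^{(x)}$ is injective and $\varphi^{(x)}(F)\supseteq\{s\in\Gamma:s\mathsf{A}^{-1}\subseteq F\}$. For $h\in\mathbb{R}_{\ge0}\Gamma$ the permanent is $\mathrm{per}(h)=\lim_F\frac1{|F|}\log\bigl(\sum_{x\in X_{\mathsf{A},F}}\prod_{s\in F}h_{x_s}\bigr)\in[-\infty,+\infty)$, where $\mathsf{A}$ is any nonempty finite subset of $\Gamma$ containing the support of $h$ (the limit exists and does not depend on $\mathsf{A}$; $\log0=-\infty$, so $\mathrm{per}(0)=-\infty$). Here $\lim_F\phi(F)=C$ means that for every neighbourhood $U$ of $C$ in $[-\infty,+\infty)$ there are $K\in\mathscr{F}(\Gamma)$ and $\delta>0$ such that $\phi(F)\in U$ for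 all $F\in\mathscr{F}(\Gamma)$ with $|FK\vartriangle F|<\delta|F|$. $\det_{\mathrm{FK}}(f)$ denotes the (logarithmic) Fuglede--Kadison determinant of the operator $\lambda^f$ on $\ell^2(\Gamma)$ extending left multiplication by $f$ on $\mathbb{C}\Gamma$: $\det_{\mathrm{FK}}(f)=\int_{[0,\infty)}\log t\,d\mu(t)\in[-\infty,+\infty)$, where $\mu$ is the spectral measure of $((\lambda^f)^*\lambda^f)^{1/2}$ with respect to the unit vector $\delta_{e}\in\ell^2(\Gamma)$ at the identity $e$ of $\Gamma$ (with $\log 0=-\infty$). *)

theory Defs
  imports "HOL-Analysis.Analysis" "HOL-Algebra.Coset"
begin

section \<open>Amenability and limits over finite subsets\<close>

definition fin_subsets :: "('a, 'm) monoid_scheme \<Rightarrow> 'a set set"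
  where "fin_subsets G = {F. finite F \<and> F \<noteq> {} \<and> F \<subseteq> carrier G}"

definition folner_sets :: "('a, 'm) monoid_scheme \<Rightarrow> 'a set \<Rightarrow> real \<Rightarrow> 'a set set"
  where "folner_sets G K \<delta> =
    {F \<in> fin_subsets G. real (card (sym_diff (F <#>\<^bsub>G\<^esub> K) F)) < \<delta> * real (card F)}"

definition amenable :: "('a, 'm) monoid_scheme \<Rightarrow> bool"
  where "amenable G \<longleftrightarrow> (\<forall>K \<in> fin_subsets G. \<forall>\<delta>>0. folner_sets G K \<delta> \<noteq> {})"

text \<open>
  Convergence along this filter is \<open>lim\<^sub>F\<close>; see \<open>tendsto_folner_filter\<close> below.
\<close>

definition folner_filter :: "('a, 'm) monoid_scheme \<Rightarrow> 'a set filter"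
  where "folner_filter G =
    (INF (K, \<delta>) \<in> fin_subsets G \<times> {0<..}. principal (folner_sets G K \<delta>))"

lemma (in group) folner_sets_mono:
  assumes K: "K' \<in> fin_subsets G" "K \<in> fin_subsets G" "K' \<subseteq> K" and le: "2 * \<delta> \<le> \<delta>'"
  shows "folner_sets G K \<delta> \<subseteq> folner_sets G K' \<delta>'"
proof
  fix F assume "F \<in> folner_sets G K \<delta>"
  hence F: "finite F" "F \<noteq> {}" "F \<subseteq> carrier G"
    and lt: "real (card (sym_diff (F <#> K) F)) < \<delta> * real (card F)"
    by (auto simp: folner_sets_def fin_subsets_def)
  have fin: "finite (F <#> K)" "finite (F <#> K')"
    using F K by (auto simp: set_mult_def fin_subsets_def)
  obtain k where k: "k \<in> K'" "k \<in> carrier G"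
    using K(1) by (auto simp: fin_subsets_def)
  have inj: "inj_on (\<lambda>s. s \<otimes> k) F"
    using F(3) k by (meson inj_onI right_cancel subsetD)
  have "(\<lambda>s. s \<otimes> k) ` F \<subseteq> F <#> K'"
    using k by (auto simp: set_mult_def)
  from card_mono[OF fin(2) this] have ge: "card F \<le> card (F <#> K')"
    by (simp add: card_image[OF inj])
  have eq1: "card (F <#> K') = card ((F <#> K') - F) + card ((F <#> K') \<inter> F)"
    using card_Int_Diff[OF fin(2), of F] by simp
  have eq2: "card F = card (F - (F <#> K')) + card ((F <#> K') \<inter> F)"
    using card_Int_Diff[OF F(1), of "F <#> K'"] by (simp add: Int_commute)
  have "card (sym_diff (F <#> K') F) \<le> card ((F <#> K') - F) + card (F - (F <#> K'))"
    by (rule card_Un_le)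
  also have "\<dots> \<le> 2 * card ((F <#> K') - F)"
    using ge eq1 eq2 by linarith
  also have "card ((F <#> K') - F) \<le> card (sym_diff (F <#> K) F)"
    using F(1) fin mono_set_mult[OF subset_refl K(3), of G F] by (intro card_mono) auto
  finally have "real (card (sym_diff (F <#> K') F)) \<le> 2 * real (card (sym_diff (F <#> K) F))"
    by simp
  also have "\<dots> < (2 * \<delta>) * real (card F)"
    using lt by simp
  also have "\<dots> \<le> \<delta>' * real (card F)"
    using le by (intro mult_right_mono) auto
  finally show "F \<in> folner_sets G K' \<delta>'"
    using F by (auto simp: folner_sets_def fin_subsets_def)
qed

lemma (in group) eventually_folner_filter:
  "eventually P (folner_filter G) \<longleftrightarrow>
    (\<exists>K \<in> fin_subsets G. \<exists>\<delta>>0. \<forall>F \<in> folner_sets G K \<delta>. P F)"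
proof -
  have "{\<one>} \<in> fin_subsets G"
    by (simp add: fin_subsets_def)
  hence ne: "fin_subsets G \<times> {0::real<..} \<noteq> {}"
    using gt_ex by fastforce
  have dir: "\<exists>p\<in>fin_subsets G \<times> {0<..}.
      (case p of (K, \<delta>) \<Rightarrow> principal (folner_sets G K \<delta>))
      \<le> inf (case a of (K, \<delta>) \<Rightarrow> principal (folner_sets G K \<delta>))
          (case b of (K, \<delta>) \<Rightarrow> principal (folner_sets G K \<delta>))"
    if ab: "a \<in> fin_subsets G \<times> {0<..}" "b \<in> fin_subsets G \<times> {0<..}" for a b
  proof -
    obtain K1 d1 K2 d2 where [simp]: "a = (K1, d1)" "b = (K2, d2)" by (cases a, cases b)
    let ?K = "K1 \<union> K2" and ?d = "min d1 d2 / 2"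
    have K: "K1 \<in> fin_subsets G" "K2 \<in> fin_subsets G" "?K \<in> fin_subsets G" and d: "?d > 0"
      using ab by (auto simp: fin_subsets_def)
    have "folner_sets G ?K ?d \<subseteq> folner_sets G K1 d1" "folner_sets G ?K ?d \<subseteq> folner_sets G K2 d2"
      using K by (intro folner_sets_mono; force)+
    thus ?thesis using K d by (intro bexI[of _ "(?K, ?d)"]) auto
  qed
  show ?thesis
    unfolding folner_filter_def
    by (subst eventually_INF_base[OF ne dir]) (auto simp: eventually_principal)
qed

lemma (in group) tendsto_folner_filter:
  fixes C :: "'c::topological_space"
  shows "(\<phi> \<longlongrightarrow> C) (folner_filter G) \<longleftrightarrow>
    (\<forall>U. open U \<longrightarrow> C \<in> U \<longrightarrow>
      (\<exists>K \<in> fin_subsets G. \<exists>\<delta>>0. \<forall>F \<in> folner_sets G K \<delta>. \<phi> F \<in> U))"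
  by (simp add: tendsto_def eventually_folner_filter)


section \<open>The permanent\<close>

text \<open>The group ring over \<open>'b\<close>, as functions that vanish off the carrier.\<close>

definition group_ring :: "('a, 'm) monoid_scheme \<Rightarrow> ('a \<Rightarrow> 'b::zero) set"
  where "group_ring G = {f. finite {s. f s \<noteq> 0} \<and> {s. f s \<noteq> 0} \<subseteq> carrier G}"

definition ereal_log :: "real \<Rightarrow> ereal"
  where "ereal_log t = (if t \<le> 0 then -\<infinity> else ereal (ln t))"

definition perm_map :: "('a, 'm) monoid_scheme \<Rightarrow> ('a \<Rightarrow> 'a) \<Rightarrow> 'a \<Rightarrow> 'a"
  where "perm_map G x s = s \<otimes>\<^bsub>G\<^esub> x s"

definition local_perms :: "('a, 'm) monoid_scheme \<Rightarrow> 'a set \<Rightarrow> 'a set \<Rightarrow> ('a \<Rightarrow> 'a) set"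
  where "local_perms G A F =
    {x \<in> F \<rightarrow>\<^sub>E A. inj_on (perm_map G x) F \<and>
      {s \<in> carrier G. s <#\<^bsub>G\<^esub> (set_inv\<^bsub>G\<^esub> A) \<subseteq> F} \<subseteq> perm_map G x ` F}"

definition local_permanent :: "('a, 'm) monoid_scheme \<Rightarrow> ('a \<Rightarrow> real) \<Rightarrow> 'a set \<Rightarrow> 'a set \<Rightarrow> real"
  where "local_permanent G h A F = (\<Sum>x \<in> local_perms G A F. \<Prod>s\<in>F. h (x s))"

text \<open>The common limit for all nonempty finite \<open>A\<close> containing the support of \<open>h\<close>.\<close>

definition permanent :: "('a, 'm) monoid_scheme \<Rightarrow> ('a \<Rightarrow> real) \<Rightarrow> ereal"
  where "permanent G h = (THE p. \<forall>A \<in> fin_subsets G. {s. h s \<noteq> 0} \<subseteq> A \<longrightarrow>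
    ((\<lambda>F. ereal_log (local_permanent G h A F) / ereal (real (card F))) \<longlongrightarrow> p) (folner_filter G))"


section \<open>Operators on the complex Hilbert space \<open>\<ell>\<^sup>2(I)\<close>\<close>

text \<open>
  Vectors are functions vanishing off \<open>I\<close>. Operators are functions on all of \<open>'a \<Rightarrow> complex\<close>,
  of which only the values on \<open>ell2 I\<close> matter. Adjoint and positive square root are
  therefore unique only up to their values off \<open>ell2 I\<close>, which is why they are picked by \<open>SOME\<close>.
\<close>

definition ell2 :: "'a set \<Rightarrow> ('a \<Rightarrow> complex) set"
  where "ell2 I = {x. (\<forall>s. s \<notin> I \<longrightarrow> x s = 0) \<and> (\<lambda>s. (cmod (x s))\<^sup>2) summable_on I}"

definition ell2_inner :: "'a set \<Rightarrow> ('a \<Rightarrow> complex) \<Rightarrow> ('a \<Rightarrow> complex) \<Rightarrow> complex"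
  where "ell2_inner I x y = (\<Sum>\<^sub>\<infinity>s\<in>I. x s * cnj (y s))"

definition ell2_norm :: "'a set \<Rightarrow> ('a \<Rightarrow> complex) \<Rightarrow> real"
  where "ell2_norm I x = sqrt (\<Sum>\<^sub>\<infinity>s\<in>I. (cmod (x s))\<^sup>2)"

definition bounded_operator :: "'a set \<Rightarrow> (('a \<Rightarrow> complex) \<Rightarrow> ('a \<Rightarrow> complex)) \<Rightarrow> bool"
  where "bounded_operator I T \<longleftrightarrow>
    T \<in> ell2 I \<rightarrow> ell2 I \<and>
    (\<forall>x\<in>ell2 I. \<forall>y\<in>ell2 I. T (\<lambda>s. x s + y s) = (\<lambda>s. T x s + T y s)) \<and>
    (\<forall>c. \<forall>x\<in>ell2 I. T (\<lambda>s. c * x s) = (\<lambda>s. c * T x s)) \<and>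
    (\<exists>C. \<forall>x\<in>ell2 I. ell2_norm I (T x) \<le> C * ell2_norm I x)"

definition positive_operator :: "'a set \<Rightarrow> (('a \<Rightarrow> complex) \<Rightarrow> ('a \<Rightarrow> complex)) \<Rightarrow> bool"
  where "positive_operator I T \<longleftrightarrow>
    bounded_operator I T \<and> (\<forall>x\<in>ell2 I. ell2_inner I (T x) x \<in> \<real>\<^sub>\<ge>\<^sub>0)"

definition adjoint_operator ::
    "'a set \<Rightarrow> (('a \<Rightarrow> complex) \<Rightarrow> ('a \<Rightarrow> complex)) \<Rightarrow> ('a \<Rightarrow> complex) \<Rightarrow> ('a \<Rightarrow> complex)"
  where "adjoint_operator I T = (SOME S. bounded_operator I S \<and>
    (\<forall>x\<in>ell2 I. \<forall>y\<in>ell2 I. ell2_inner I (T x) y = ell2_inner I x (S y)))"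

definition sqrt_operator ::
    "'a set \<Rightarrow> (('a \<Rightarrow> complex) \<Rightarrow> ('a \<Rightarrow> complex)) \<Rightarrow> ('a \<Rightarrow> complex) \<Rightarrow> ('a \<Rightarrow> complex)"
  where "sqrt_operator I T = (SOME R. positive_operator I R \<and> (\<forall>x\<in>ell2 I. R (R x) = T x))"

text \<open>
  The spectral measure of a bounded self-adjoint \<open>T\<close> with respect to \<open>v\<close>: the compactly
  supported finite Borel measure \<open>\<mu>\<close> on the line with \<open>\<langle>p(T) v, v\<rangle> = \<integral> p \<partial>\<mu>\<close> for all
  polynomials \<open>p\<close>. By linearity the monomials suffice, and by compactness of the support
  (Weierstrass) there is exactly one such measure.
\<close>

definition is_spectral_measure ::
    "'a set \<Rightarrow> (('a \<Rightarrow> complex) \<Rightarrow> ('a \<Rightarrow> complex)) \<Rightarrow> ('a \<Rightarrow> complex) \<Rightarrow> real measure \<Rightarrow> bool"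
  where "is_spectral_measure I T v \<mu> \<longleftrightarrow>
    sets \<mu> = sets borel \<and> finite_measure \<mu> \<and> (\<exists>r. AE t in \<mu>. \<bar>t\<bar> \<le> r) \<and>
    (\<forall>n::nat. ell2_inner I ((T ^^ n) v) v = of_real (\<integral>t. t ^ n \<partial>\<mu>))"

definition spectral_measure ::
    "'a set \<Rightarrow> (('a \<Rightarrow> complex) \<Rightarrow> ('a \<Rightarrow> complex)) \<Rightarrow> ('a \<Rightarrow> complex) \<Rightarrow> real measure"
  where "spectral_measure I T v = (SOME \<mu>. is_spectral_measure I T v \<mu>)"


section \<open>The Fuglede--Kadison determinant\<close>

text \<open>
  \<open>(f x)\<^sub>t = \<Sum>\<^sub>s f\<^sub>s x\<^bsub>s\<^sup>-\<^sup>1 t\<^esub>\<close>; on \<open>group_ring G\<close> this is the product of the group ring.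
\<close>

definition left_mult_operator ::
    "('a, 'm) monoid_scheme \<Rightarrow> ('a \<Rightarrow> complex) \<Rightarrow> ('a \<Rightarrow> complex) \<Rightarrow> ('a \<Rightarrow> complex)"
  where "left_mult_operator G f x t =
    (if t \<in> carrier G then \<Sum>s | f s \<noteq> 0. f s * x (inv\<^bsub>G\<^esub> s \<otimes>\<^bsub>G\<^esub> t) else 0)"

definition FK_measure :: "('a, 'm) monoid_scheme \<Rightarrow> ('a \<Rightarrow> complex) \<Rightarrow> real measure"
  where "FK_measure G f =
    (let T = left_mult_operator G f
     in spectral_measure (carrier G)
          (sqrt_operator (carrier G) (adjoint_operator (carrier G) T \<circ> T)) (indicator {\<one>\<^bsub>G\<^esub>}))"

text \<open>
  The positive part of \<open>log\<close> has a finite integral because the support is compact, so the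
  difference below is never \<open>\<infinity> - \<infinity>\<close>; \<open>e2ennreal\<close> maps negative numbers to \<open>0\<close>.
\<close>

definition FK_det :: "('a, 'm) monoid_scheme \<Rightarrow> ('a \<Rightarrow> complex) \<Rightarrow> ereal"
  where "FK_det G f =
    enn2ereal (\<integral>\<^sup>+t\<in>{0..}. e2ennreal (ereal_log t) \<partial>FK_measure G f)
    - enn2ereal (\<integral>\<^sup>+t\<in>{0..}. e2ennreal (- ereal_log t) \<partial>FK_measure G f)"

end

theory Submission
  imports Defs "HOL-Probability.Probability" "HOL-Real_Asymp.Real_Asymp" "Jordan_Normal_Form.Determinant"
begin

text \<open>
  Let \<open>I(F)\<close> be the sum of \<open>\<Prod>s\<in>F. h (x s)\<close> over all \<open>x\<close> for which \<open>s \<mapsto> s x\<^sub>s\<close> is injective on \<open>F\<close>,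
  without the covering condition. Finner's inequality gives \<open>log I\<close> the Shearer property, so over
  almost invariant sets \<open>log I(F) / |F|\<close> tends to its infimum. The infimum for the reversal of
  \<open>h\<close> is the same, because injections can be read backwards. Multiplying a sum over injections out
  of \<open>F\<close> with one over injections onto almost all of \<open>F\<close> and exchanging along alternating paths
  enforces the covering condition at a subexponential cost, so the infimum is a lower bound for
  the permanent.

  It remains to compare \<open>I(F)\<close> with the determinant. By Jensen's inequality the compression of
  \<open>T\<^sup>* T\<close> to \<open>F\<close>, where \<open>T\<close> is the operator of \<open>f\<close>, has determinant at least
  \<open>exp (2 |F| det\<^sub>F\<^sub>K f)\<close>. It is a Gram determinant, and its Cauchy--Binet expansion is at most \<open>I(F)\<^sup>2\<close>.
\<close>

section \<open>Weighted injections and Shearer's inequality\<close>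

text \<open>The obstacle is the covering condition: an injection out of \<open>F\<close> may miss
  part of the interior, and repairing it edge by edge would change its weight in an uncontrolled
  way. Exchanging edges between two matchings changes no weight, so a second family is brought in.
  It consists of injections from the interior back into \<open>F\<close>, and their weights are
  those of the reversed function. The symmetry of the infimum under reversal is therefore what makes
  the two rates in the product comparable. It enters once more at the end, because the Gram
  determinant yields weights \<open>h (t \<otimes> inv u)\<close> with the inverse on the other
  side.

  Weights are scaled to mass at most 1, so that incomplete tiles can be discarded from products.

  The permanent is given by \<open>THE\<close>, operators and measures by \<open>SOME\<close>. Hence
  the existence of the limit, of adjoint and square root, and of spectral measures has to be
  established: square roots come from a binomial series summed in each coordinate, spectral measures
  from Hausdorff's moment problem. Since the determinant may be \<open>- \<infinity>\<close>,
  eigenvalues are shifted by a positive number that tends to 0.\<close>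

text \<open>The permanent of the rectangular matrix \<open>W\<close> with rows \<open>D\<close> and
  columns \<open>B\<close>. Extensional functions make each injection count once.\<close>

definition inj_sum :: "('a \<Rightarrow> 'b \<Rightarrow> real) \<Rightarrow> 'a set \<Rightarrow> 'b set \<Rightarrow> real"
  where "inj_sum W D B = (\<Sum>\<phi> | \<phi> \<in> D \<rightarrow>\<^sub>E B \<and> inj_on \<phi> D. \<Prod>s\<in>D. W s (\<phi> s))"

lemma root_prod:
  "k > 0 \<Longrightarrow> root k (\<Prod>i\<in>I. f i) = (\<Prod>i\<in>I. root k (f i))"
  by (induction I rule: infinite_finite_induct) (auto simp: real_root_mult)

lemma sum_PiE_insert:
  assumes "a \<notin> F" "finite F" "finite B"
  shows "(\<Sum>\<phi>\<in>insert a F \<rightarrow>\<^sub>E B. g \<phi>) = (\<Sum>b\<in>B. \<Sum>\<phi>\<in>F \<rightarrow>\<^sub>E B. g (\<phi>(a := b)))"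
proof -
  have "(\<Sum>\<phi>\<in>insert a F \<rightarrow>\<^sub>E B. g \<phi>) = (\<Sum>p\<in>B \<times> (F \<rightarrow>\<^sub>E B). g (case p of (y, \<phi>) \<Rightarrow> \<phi>(a := y)))"
    unfolding PiE_insert_eq using sum.reindex[OF inj_combinator[OF assms(1), of "\<lambda>_. B"], of g]
    by (simp add: o_def)
  also have "\<dots> = (\<Sum>b\<in>B. \<Sum>\<phi>\<in>F \<rightarrow>\<^sub>E B. g (\<phi>(a := b)))"
    by (simp add: sum.cartesian_product split_def)
  finally show ?thesis .
qed

text \<open>Hoelder's inequality with \<open>k\<close> exponents all equal to \<open>k\<close>: once
  every \<open>c i\<close> is scaled to total mass 1, the inequality of arithmetic and geometric
  means bounds each product by an average, and the averages sum to 1.\<close>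

lemma sum_prod_root_le:
  fixes c :: "'i \<Rightarrow> 'b \<Rightarrow> real"
  assumes "finite B" "finite I" "card I = k" "k > 0" and nn: "\<And>i b. i \<in> I \<Longrightarrow> b \<in> B \<Longrightarrow> c i b \<ge> 0"
  shows "(\<Sum>b\<in>B. \<Prod>i\<in>I. root k (c i b)) \<le> (\<Prod>i\<in>I. root k (\<Sum>b\<in>B. c i b))"
proof (cases "\<exists>i\<in>I. (\<Sum>b\<in>B. c i b) = 0")
  case True
  then obtain i where i: "i \<in> I" "(\<Sum>b\<in>B. c i b) = 0" by auto
  hence "c i b = 0" if "b \<in> B" for b
    using sum_nonneg_eq_0_iff[OF assms(1), of "c i"] nn that by auto
  hence "(\<Prod>i\<in>I. root k (c i b)) = 0" if "b \<in> B" for b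
    using i that assms(2) by (intro prod_zero) (auto intro!: bexI[of _ i])
  hence "(\<Sum>b\<in>B. \<Prod>i\<in>I. root k (c i b)) = 0" by simp
  moreover have "(\<Prod>i\<in>I. root k (\<Sum>b\<in>B. c i b)) \<ge> 0"
    using assms nn by (intro prod_nonneg ballI) (auto intro!: sum_nonneg real_root_ge_zero)
  ultimately show ?thesis by linarith
next
  case False
  define S where "S i = (\<Sum>b\<in>B. c i b)" for i
  have S: "S i > 0" if "i \<in> I" for i
    using False that nn sum_nonneg[of B "c i"] by (fastforce simp: S_def less_le)
  have I: "I \<noteq> {}" using assms by auto
  have le: "(\<Prod>i\<in>I. root k (c i b / S i)) \<le> (\<Sum>i\<in>I. c i b / S i) / k" if "b \<in> B" for b
  proof -
    have "root k x = x powr (1 / k)" if "x \<ge> 0" for x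
      using that assms(4) by (cases "x = 0") (auto simp: root_powr_inverse)
    from this[of "\<Prod>i\<in>I. c i b / S i"] have "root k (\<Prod>i\<in>I. c i b / S i) = (\<Prod>i\<in>I. c i b / S i) powr (1 / k)"
      using nn[OF _ that] S by (simp add: less_imp_le prod_nonneg)
    thus ?thesis
      using arith_geom_mean[OF assms(2) I, of "\<lambda>i. c i b / S i"] nn[OF _ that] S assms(3,4)
      by (simp add: root_prod less_imp_le sum_divide_distrib)
  qed
  have "(\<Sum>b\<in>B. \<Prod>i\<in>I. root k (c i b)) = (\<Sum>b\<in>B. (\<Prod>i\<in>I. root k (S i)) * (\<Prod>i\<in>I. root k (c i b / S i)))"
    using S by (intro sum.cong) (auto simp: prod.distrib[symmetric] real_root_divide
        intro!: prod.cong dest!: S simp: assms(4))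
  also have "\<dots> = (\<Prod>i\<in>I. root k (S i)) * (\<Sum>b\<in>B. (\<Prod>i\<in>I. root k (c i b / S i)))"
    by (simp add: sum_distrib_left)
  also have "\<dots> \<le> (\<Prod>i\<in>I. root k (S i)) * (\<Sum>b\<in>B. (\<Sum>i\<in>I. c i b / S i) / k)"
    using S assms(4) by (intro mult_left_mono sum_mono le prod_nonneg) (auto simp: less_imp_le)
  also have "(\<Sum>b\<in>B. (\<Sum>i\<in>I. c i b / S i) / k) = (\<Sum>i\<in>I. S i / S i) / k"
  proof -
    have "(\<Sum>b\<in>B. \<Sum>i\<in>I. c i b / S i) = (\<Sum>i\<in>I. S i / S i)"
      by (subst sum.swap) (simp only: S_def sum_divide_distrib)
    thus ?thesis by (simp only: sum_divide_distrib[symmetric])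
  qed
  also have "(\<Sum>i\<in>I. S i / S i) = k"
    using S assms(3) by (simp add: less_imp_neq[THEN not_sym])
  finally show ?thesis using assms(4) by (simp add: S_def)
qed

lemma restrict_upd: "restrict (\<phi>(a := b)) E =
    (if a \<in> E then (restrict \<phi> (E - {a}))(a := b) else restrict \<phi> (E - {a}))"
  by (auto simp: restrict_def fun_eq_iff)

text \<open>Finner's inequality for the counting measure, by integrating out one coordinate at a time.\<close>

lemma sum_PiE_prod_root_le:
  fixes f :: "'i \<Rightarrow> ('a \<Rightarrow> 'b) \<Rightarrow> real"
  assumes "finite F" "finite I" "finite B" "k > 0"
    and "\<And>i. i \<in> I \<Longrightarrow> E i \<subseteq> F" "\<And>s. s \<in> F \<Longrightarrow> card {i\<in>I. s \<in> E i} = k"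
    and "\<And>i \<phi>. i \<in> I \<Longrightarrow> f i \<phi> \<ge> 0"
  shows "(\<Sum>\<phi>\<in>F \<rightarrow>\<^sub>E B. \<Prod>i\<in>I. root k (f i (restrict \<phi> (E i)))) \<le>
         (\<Prod>i\<in>I. root k (\<Sum>\<phi>\<in>E i \<rightarrow>\<^sub>E B. f i \<phi>))"
  using assms(1,5,6,7)
proof (induction F arbitrary: E f rule: finite_induct)
  case empty
  then show ?case by (intro eq_refl) (auto simp: restrict_def intro!: prod.cong)
next
  case (insert a F)
  \<comment> \<open>\<open>f' b\<close> is the family left after the coordinate \<open>a\<close> is
    frozen at \<open>b\<close>; members with \<open>a\<close> outside \<open>E i\<close> do not
    notice \<open>b\<close>.\<close>
  define f' where "f' b i \<phi> = f i (if a \<in> E i then \<phi>(a := b) else \<phi>)" for b i and \<phi> :: "'a \<Rightarrow> 'b"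
  define c where "c i b = (\<Sum>\<phi>\<in>(E i - {a}) \<rightarrow>\<^sub>E B. f' b i \<phi>)" for i b
  define J where "J = {i\<in>I. a \<in> E i}"
  have finE: "finite (E i)" if "i \<in> I" for i
    using insert.prems(1)[OF that] insert.hyps(1) finite_subset by blast
  have cJ: "(\<Sum>b\<in>B. c i b) = (\<Sum>\<phi>\<in>E i \<rightarrow>\<^sub>E B. f i \<phi>)" if "i \<in> J" for i
  proof -
    have "insert a (E i - {a}) = E i" using that by (auto simp: J_def)
    thus ?thesis
      using sum_PiE_insert[of a "E i - {a}" B "f i"] finE[of i] that assms(3)
      by (simp add: c_def f'_def J_def)
  qed
  have cnJ: "c i b = (\<Sum>\<phi>\<in>E i \<rightarrow>\<^sub>E B. f i \<phi>)" if "i \<in> I" "i \<notin> J" for i b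
    using that by (simp add: c_def f'_def J_def)
  have cnn: "c i b \<ge> 0" if "i \<in> I" for i b
    using insert.prems(3)[OF that] by (auto simp: c_def f'_def intro!: sum_nonneg)
  have Jk: "finite J" "card J = k" "J \<subseteq> I"
    using insert.prems(2)[of a] assms(2) by (auto simp: J_def)
  have "(\<Sum>\<phi>\<in>insert a F \<rightarrow>\<^sub>E B. \<Prod>i\<in>I. root k (f i (restrict \<phi> (E i)))) =
      (\<Sum>b\<in>B. \<Sum>\<phi>\<in>F \<rightarrow>\<^sub>E B. \<Prod>i\<in>I. root k (f' b i (restrict \<phi> (E i - {a}))))"
    using insert.hyps assms(3) by (subst sum_PiE_insert) (auto simp: restrict_upd f'_def if_distrib)
  also have "\<dots> \<le> (\<Sum>b\<in>B. \<Prod>i\<in>I. root k (c i b))"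
  proof (intro sum_mono)
    fix b
    \<comment> \<open>Removing \<open>a\<close> keeps the covering number \<open>k\<close> at the
      points of \<open>F\<close>, so the induction hypothesis applies to each slice.\<close>
    have "card {i \<in> I. s \<in> E i - {a}} = k" if "s \<in> F" for s
    proof -
      have "{i \<in> I. s \<in> E i - {a}} = {i \<in> I. s \<in> E i}" using that insert.hyps(2) by auto
      thus ?thesis using insert.prems(2)[of s] that by simp
    qed
    thus "(\<Sum>\<phi>\<in>F \<rightarrow>\<^sub>E B. \<Prod>i\<in>I. root k (f' b i (restrict \<phi> (E i - {a})))) \<le> (\<Prod>i\<in>I. root k (c i b))"
      unfolding c_def using insert.prems(1,3)
      by (intro insert.IH) (auto simp: f'_def)
  qed
  \<comment> \<open>Only the \<open>k\<close> members that contain \<open>a\<close> depend on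
    \<open>b\<close>; this exact number is what Hoelder's inequality with exponent \<open>k\<close>
    asks for.\<close>
  also have "\<dots> = (\<Sum>b\<in>B. (\<Prod>i\<in>I - J. root k (\<Sum>\<phi>\<in>E i \<rightarrow>\<^sub>E B. f i \<phi>)) * (\<Prod>i\<in>J. root k (c i b)))"
    by (intro sum.cong refl, subst prod.subset_diff[OF Jk(3) assms(2)])
      (auto simp: cnJ intro!: arg_cong2[of _ _ _ _ "(*)"] prod.cong)
  also have "\<dots> = (\<Prod>i\<in>I - J. root k (\<Sum>\<phi>\<in>E i \<rightarrow>\<^sub>E B. f i \<phi>)) * (\<Sum>b\<in>B. \<Prod>i\<in>J. root k (c i b))"
    by (simp add: sum_distrib_left)
  also have "\<dots> \<le> (\<Prod>i\<in>I - J. root k (\<Sum>\<phi>\<in>E i \<rightarrow>\<^sub>E B. f i \<phi>)) * (\<Prod>i\<in>J. root k (\<Sum>b\<in>B. c i b))"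
    using Jk assms(3,4) cnn insert.prems(3)
    by (intro mult_left_mono sum_prod_root_le prod_nonneg) (auto intro!: sum_nonneg real_root_ge_zero)
  also have "\<dots> = (\<Prod>i\<in>I. root k (\<Sum>\<phi>\<in>E i \<rightarrow>\<^sub>E B. f i \<phi>))"
    by (subst prod.subset_diff[OF Jk(3) assms(2)]) (simp add: cJ cong: prod.cong)
  finally show ?case .
qed

lemma inj_sum_nonneg: "(\<And>s t. s \<in> D \<Longrightarrow> t \<in> B \<Longrightarrow> W s t \<ge> 0) \<Longrightarrow> inj_sum W D B \<ge> 0"
  unfolding inj_sum_def by (intro sum_nonneg prod_nonneg) auto

lemma inj_sum_empty [simp]: "inj_sum W {} B = 1"
proof -
  have "{\<phi>. \<phi> \<in> {} \<rightarrow>\<^sub>E B \<and> inj_on \<phi> {}} = {\<lambda>_. undefined}" by auto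
  thus ?thesis by (simp add: inj_sum_def)
qed

lemma inj_sum_conv_if:
  assumes "finite D" "finite B"
  shows "inj_sum W D B = (\<Sum>\<phi>\<in>D \<rightarrow>\<^sub>E B. if inj_on \<phi> D then \<Prod>s\<in>D. W s (\<phi> s) else 0)"
  using assms unfolding inj_sum_def
  by (subst sum.inter_filter[symmetric]) (auto intro!: finite_PiE sum.cong)

text \<open>Each point lies in \<open>k\<close> of the sets, so the weight of an injection is the
  \<open>k\<close>-th root of the product of the weights of its restrictions. Restrictions stay
  injective, and the right-hand side ignores collisions between different \<open>E i\<close>, so the
  sum may be extended to all functions before Finner's inequality is applied.\<close>

lemma inj_sum_shearer:
  fixes W :: "'a \<Rightarrow> 'b \<Rightarrow> real"
  assumes fin: "finite F" "finite I" "finite B" and k: "k > 0"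
    and E: "\<And>i. i \<in> I \<Longrightarrow> E i \<subseteq> F" and card: "\<And>s. s \<in> F \<Longrightarrow> card {i\<in>I. s \<in> E i} = k"
    and nn: "\<And>s t. W s t \<ge> 0"
  shows "inj_sum W F B ^ k \<le> (\<Prod>i\<in>I. inj_sum W (E i) B)"
proof -
  define f where "f i \<phi> = (if inj_on \<phi> (E i) then \<Prod>s\<in>E i. W s (\<phi> s) else 0)" for i \<phi>
  have fnn: "f i \<phi> \<ge> 0" for i \<phi> by (auto simp: f_def nn intro!: prod_nonneg)
  have finE: "finite (E i)" if "i \<in> I" for i
    using E[OF that] fin(1) finite_subset by blast
  have f_restrict: "f i (restrict \<phi> (E i)) = f i \<phi>" for i \<phi>
  proof -
    have "inj_on (restrict \<phi> (E i)) (E i) = inj_on \<phi> (E i)" by (auto simp: inj_on_def)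
    thus ?thesis unfolding f_def by (auto intro!: prod.cong)
  qed
  have "inj_sum W F B = (\<Sum>\<phi> | \<phi> \<in> F \<rightarrow>\<^sub>E B \<and> inj_on \<phi> F. \<Prod>i\<in>I. root k (f i (restrict \<phi> (E i))))"
    unfolding inj_sum_def
  proof (intro sum.cong refl)
    fix \<phi> assume "\<phi> \<in> {\<phi>. \<phi> \<in> F \<rightarrow>\<^sub>E B \<and> inj_on \<phi> F}"
    hence inj: "inj_on \<phi> (E i)" if "i \<in> I" for i using E[OF that] by (auto intro: inj_on_subset)
    have "(\<Prod>i\<in>I. f i (restrict \<phi> (E i))) = (\<Prod>i\<in>I. \<Prod>s\<in>{s\<in>F. s \<in> E i}. W s (\<phi> s))"
      unfolding f_restrict using inj E by (intro prod.cong refl) (auto simp: f_def intro!: prod.cong)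
    also have "\<dots> = (\<Prod>s\<in>F. \<Prod>i\<in>{i\<in>I. s \<in> E i}. W s (\<phi> s))"
      by (rule prod.swap_restrict[OF fin(2,1)])
    also have "\<dots> = (\<Prod>s\<in>F. W s (\<phi> s)) ^ k"
      by (simp add: card prod_power_distrib)
    finally show "(\<Prod>s\<in>F. W s (\<phi> s)) = (\<Prod>i\<in>I. root k (f i (restrict \<phi> (E i))))"
      using k by (simp add: root_prod[symmetric] real_root_power_cancel nn prod_nonneg)
  qed
  also have "\<dots> \<le> (\<Sum>\<phi>\<in>F \<rightarrow>\<^sub>E B. \<Prod>i\<in>I. root k (f i (restrict \<phi> (E i))))"
    using fin k by (intro sum_mono2 prod_nonneg) (auto intro!: finite_PiE fnn)
  also have "\<dots> \<le> (\<Prod>i\<in>I. root k (\<Sum>\<phi>\<in>E i \<rightarrow>\<^sub>E B. f i \<phi>))"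
    using fin k E card fnn by (intro sum_PiE_prod_root_le)
  also have "\<dots> = root k (\<Prod>i\<in>I. inj_sum W (E i) B)"
    using k finE fin by (simp add: root_prod inj_sum_conv_if f_def cong: prod.cong)
  finally have "inj_sum W F B ^ k \<le> root k (\<Prod>i\<in>I. inj_sum W (E i) B) ^ k"
    by (intro power_mono inj_sum_nonneg nn)
  also have "\<dots> = (\<Prod>i\<in>I. inj_sum W (E i) B)"
    using k by (intro real_root_pow_pos2) (auto intro!: prod_nonneg inj_sum_nonneg nn)
  finally show ?thesis .
qed

text \<open>Without injectivity the sum factors into row sums.\<close>

lemma inj_sum_le_1:
  assumes "finite D" "finite B" "\<And>s t. W s t \<ge> 0" "\<And>s. s \<in> D \<Longrightarrow> (\<Sum>t\<in>B. W s t) \<le> 1"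
  shows "inj_sum W D B \<le> 1"
proof -
  have "inj_sum W D B \<le> (\<Sum>\<phi>\<in>D \<rightarrow>\<^sub>E B. \<Prod>s\<in>D. W s (\<phi> s))"
    unfolding inj_sum_def using assms by (intro sum_mono2) (auto intro!: finite_PiE prod_nonneg)
  also have "\<dots> = (\<Prod>s\<in>D. \<Sum>t\<in>B. W s t)"
    using assms by (intro prod_sum_PiE[symmetric]) auto
  also have "\<dots> \<le> 1" using assms by (intro prod_le_1) (auto intro!: sum_nonneg)
  finally show ?thesis .
qed

lemma inj_sum_target_cong:
  assumes "finite D" "finite B'" "B \<subseteq> B'" "\<And>s t. s \<in> D \<Longrightarrow> t \<in> B' - B \<Longrightarrow> W s t = 0"
  shows "inj_sum W D B = inj_sum W D B'"
  unfolding inj_sum_def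
proof (rule sum.mono_neutral_left)
  show "finite {\<phi>. \<phi> \<in> D \<rightarrow>\<^sub>E B' \<and> inj_on \<phi> D}"
    using assms by (auto intro!: finite_subset[OF _ finite_PiE[of D "\<lambda>_. B'"]])
  show "{\<phi>. \<phi> \<in> D \<rightarrow>\<^sub>E B \<and> inj_on \<phi> D} \<subseteq> {\<phi>. \<phi> \<in> D \<rightarrow>\<^sub>E B' \<and> inj_on \<phi> D}"
    using assms(3) by (auto simp: PiE_iff)
  show "\<forall>\<phi>\<in>{\<phi>. \<phi> \<in> D \<rightarrow>\<^sub>E B' \<and> inj_on \<phi> D} - {\<phi>. \<phi> \<in> D \<rightarrow>\<^sub>E B \<and> inj_on \<phi> D}. (\<Prod>s\<in>D. W s (\<phi> s)) = 0"
  proof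
    fix \<phi> assume "\<phi> \<in> {\<phi>. \<phi> \<in> D \<rightarrow>\<^sub>E B' \<and> inj_on \<phi> D} - {\<phi>. \<phi> \<in> D \<rightarrow>\<^sub>E B \<and> inj_on \<phi> D}"
    then obtain s where "s \<in> D" "\<phi> s \<in> B' - B" by (auto simp: PiE_iff)
    thus "(\<Prod>s\<in>D. W s (\<phi> s)) = 0" using assms by (intro prod_zero) auto
  qed
qed

lemma inj_sum_reindex:
  assumes g: "inj_on g D" and b: "inj_on b B" and fin: "finite D" "finite B"
  shows "inj_sum W (g ` D) (b ` B) = inj_sum (\<lambda>s t. W (g s) (b t)) D B"
proof -
  let ?T = "\<lambda>\<phi>. \<lambda>u\<in>g ` D. b (\<phi> (the_inv_into D g u))"
  let ?U = "\<lambda>\<psi>. \<lambda>s\<in>D. the_inv_into B b (\<psi> (g s))"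
  have *: "the_inv_into D g (g s) = s" if "s \<in> D" for s by (rule the_inv_into_f_f[OF g that])
  have **: "the_inv_into B b (b t) = t" if "t \<in> B" for t by (rule the_inv_into_f_f[OF b that])
  show ?thesis unfolding inj_sum_def
  proof (rule sum.reindex_bij_witness[of _ ?T ?U])
    fix \<psi> assume \<psi>: "\<psi> \<in> {\<phi>. \<phi> \<in> g ` D \<rightarrow>\<^sub>E b ` B \<and> inj_on \<phi> (g ` D)}"
    hence e: "b (the_inv_into B b (\<psi> (g s))) = \<psi> (g s)" if "s \<in> D" for s
      using that by (intro f_the_inv_into_f[OF b]) auto
    show "?T (?U \<psi>) = \<psi>"
      using \<psi> by (intro ext) (auto simp: * e PiE_iff extensional_def)
    show "?U \<psi> \<in> {\<phi>. \<phi> \<in> D \<rightarrow>\<^sub>E B \<and> inj_on \<phi> D}"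
    proof -
      have "inj_on (?U \<psi>) D"
        using \<psi> g by (intro inj_onI) (metis (mono_tags, lifting) e image_eqI inj_onD mem_Collect_eq restrict_apply')
      moreover have "the_inv_into B b (\<psi> (g s)) \<in> B" if "s \<in> D" for s
        using \<psi> that by (intro the_inv_into_into[OF b]) auto
      ultimately show ?thesis by auto
    qed
    show "(\<Prod>s\<in>D. W (g s) (b (?U \<psi> s))) = (\<Prod>s\<in>g ` D. W s (\<psi> s))"
      by (simp add: prod.reindex[OF g] e cong: prod.cong)
  next
    fix \<phi> assume \<phi>: "\<phi> \<in> {\<phi>. \<phi> \<in> D \<rightarrow>\<^sub>E B \<and> inj_on \<phi> D}"
    hence B: "\<phi> s \<in> B" if "s \<in> D" for s using that by auto
    show "?U (?T \<phi>) = \<phi>"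
      using \<phi> by (intro ext) (auto simp: * ** B PiE_iff extensional_def)
    have "inj_on (?T \<phi>) (g ` D)"
    proof (intro inj_onI)
      fix u v assume "u \<in> g ` D" "v \<in> g ` D" and e: "?T \<phi> u = ?T \<phi> v"
      then obtain s t where st: "s \<in> D" "t \<in> D" "u = g s" "v = g t" by auto
      hence "b (\<phi> s) = b (\<phi> t)" using e by (simp add: *)
      hence "\<phi> s = \<phi> t" using b B st by (auto dest: inj_onD)
      thus "u = v" using \<phi> st by (auto dest: inj_onD)
    qed
    thus "?T \<phi> \<in> {\<phi>. \<phi> \<in> g ` D \<rightarrow>\<^sub>E b ` B \<and> inj_on \<phi> (g ` D)}"
      using B by (auto simp: *)
  qed
qed

text \<open>Sorting injections by their image turns them into injections in the opposite direction.\<close>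

lemma inj_sum_le_sum_transpose:
  assumes "finite F" "finite B" "\<And>s t. W s t \<ge> 0"
  shows "inj_sum W F B \<le> (\<Sum>E | E \<subseteq> B \<and> card E = card F. inj_sum (\<lambda>t s. W s t) E F)"
proof -
  let ?X = "{\<phi>. \<phi> \<in> F \<rightarrow>\<^sub>E B \<and> inj_on \<phi> F}"
  let ?Y = "\<lambda>E. {\<psi>. \<psi> \<in> E \<rightarrow>\<^sub>E F \<and> inj_on \<psi> E}"
  have finY: "finite (?Y E)" if "E \<subseteq> B" for E
    using that assms finite_subset[OF that]
    by (intro finite_subset[OF _ finite_PiE[of E "\<lambda>_. F"]]) auto
  have "inj_sum W F B = (\<Sum>\<phi>\<in>?X. \<Prod>s\<in>F. W s (\<phi> s))" by (simp add: inj_sum_def)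
  also have "\<dots> \<le> (\<Sum>p\<in>(SIGMA E:{E. E \<subseteq> B \<and> card E = card F}. ?Y E). \<Prod>t\<in>fst p. W (snd p t) t)"
  \<comment> \<open>An injection is recovered from its image and the inverse map on it, so no two
    injections share a pair.\<close>
  proof (rule sum_le_included[where i = "\<lambda>(E, \<psi>). restrict (the_inv_into E \<psi>) F"])
    show "finite ?X" using assms by (auto intro!: finite_subset[OF _ finite_PiE[of F "\<lambda>_. B"]])
    show "finite (SIGMA E:{E. E \<subseteq> B \<and> card E = card F}. ?Y E)"
      using assms finY by (intro finite_SigmaI) auto
    show "\<forall>p\<in>(SIGMA E:{E. E \<subseteq> B \<and> card E = card F}. ?Y E). 0 \<le> (\<Prod>t\<in>fst p. W (snd p t) t)"
      using assms by (auto intro!: prod_nonneg)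
    show "\<forall>\<phi>\<in>?X. \<exists>p\<in>SIGMA E:{E. E \<subseteq> B \<and> card E = card F}. ?Y E.
        (case p of (E, \<psi>) \<Rightarrow> restrict (the_inv_into E \<psi>) F) = \<phi> \<and>
        (\<Prod>s\<in>F. W s (\<phi> s)) \<le> (\<Prod>t\<in>fst p. W (snd p t) t)"
    proof
      fix \<phi> assume \<phi>: "\<phi> \<in> ?X"
      hence inj: "inj_on \<phi> F" and sub: "\<phi> ` F \<subseteq> B" by auto
      let ?\<psi> = "restrict (the_inv_into F \<phi>) (\<phi> ` F)"
      have inv: "the_inv_into F \<phi> (\<phi> s) = s" if "s \<in> F" for s
        by (rule the_inv_into_f_f[OF inj that])
      have inj': "inj_on ?\<psi> (\<phi> ` F)" by (auto simp: inj_on_def inv)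
      have "(\<phi> ` F, ?\<psi>) \<in> (SIGMA E:{E. E \<subseteq> B \<and> card E = card F}. ?Y E)"
        using sub inj' by (auto simp: card_image[OF inj] inv)
      moreover have "restrict (the_inv_into (\<phi> ` F) ?\<psi>) F = \<phi>"
      proof
        fix s show "restrict (the_inv_into (\<phi> ` F) ?\<psi>) F s = \<phi> s"
        proof (cases "s \<in> F")
          case True
          have "the_inv_into (\<phi> ` F) ?\<psi> (?\<psi> (\<phi> s)) = \<phi> s"
            using True by (intro the_inv_into_f_f[OF inj']) auto
          thus ?thesis using True by (simp add: inv)
        qed (use \<phi> in \<open>auto simp: PiE_iff extensional_def\<close>)
      qed
      moreover have "(\<Prod>t\<in>\<phi> ` F. W (?\<psi> t) t) = (\<Prod>s\<in>F. W s (\<phi> s))"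
        by (simp add: prod.reindex[OF inj] inv cong: prod.cong)
      ultimately show "\<exists>p\<in>SIGMA E:{E. E \<subseteq> B \<and> card E = card F}. ?Y E.
        (case p of (E, \<psi>) \<Rightarrow> restrict (the_inv_into E \<psi>) F) = \<phi> \<and>
        (\<Prod>s\<in>F. W s (\<phi> s)) \<le> (\<Prod>t\<in>fst p. W (snd p t) t)"
        by (intro bexI[of _ "(\<phi> ` F, ?\<psi>)"]) auto
    qed
  qed
  also have "\<dots> = (\<Sum>E | E \<subseteq> B \<and> card E = card F. inj_sum (\<lambda>t s. W s t) E F)"
    unfolding inj_sum_def using assms finY
    by (subst sum.Sigma) (auto simp: split_def)
  finally show ?thesis .
qed

section \<open>Counting small subsets, and monotonicity in the target\<close>

lemma sum_Pow_power: "finite B \<Longrightarrow> (\<Sum>X\<in>Pow B. y ^ card X) = (y + 1 :: real) ^ card B"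
  using prod_add[of B "\<lambda>_. y" "\<lambda>_. 1"] by simp

text \<open>A Chernoff bound: under the weight \<open>y ^ card X\<close> with
  \<open>y \<le> 1\<close> a subset of size at most \<open>m\<close> weighs at least
  \<open>y ^ m\<close>, and all subsets together weigh \<open>(y + 1) ^ card B\<close>. It makes
  every later choice of an exceptional set subexponential.\<close>

lemma card_small_subsets_le:
  fixes \<epsilon> :: real
  assumes "\<epsilon> > 0"
  obtains \<eta> :: real where "\<eta> > 0" "\<And>(B :: 'a set) m n. finite B \<Longrightarrow> card B \<le> n \<Longrightarrow> real m \<le> \<eta> * n \<Longrightarrow>
    real (card {X. X \<subseteq> B \<and> card X \<le> m}) \<le> exp (\<epsilon> * n)"
proof -
  \<comment> \<open>Half of the exponent \<open>\<epsilon>\<close> pays for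
    \<open>(y + 1) ^ n\<close>, the other half for \<open>(1 / y) ^ m\<close>.\<close>
  define y where "y = min 1 (\<epsilon> / 2)"
  define l where "l = ln (1 / y)"
  have y: "y > 0" "y \<le> 1" "y \<le> \<epsilon> / 2" using assms by (auto simp: y_def)
  have l: "l \<ge> 0" using y by (simp add: l_def ln_div)
  \<comment> \<open>The summand 1 keeps the divisor positive when \<open>y = 1\<close>, where
    \<open>l\<close> is 0.\<close>
  define \<eta> where "\<eta> = (\<epsilon> / 2) / (1 + l)"
  have \<eta>: "\<eta> > 0" "\<eta> * l \<le> \<epsilon> / 2"
    using assms l by (auto simp: \<eta>_def field_simps)
  show ?thesis
  proof (rule that[OF \<eta>(1)])
    fix B :: "'a set" and m n :: nat
    assume B: "finite B" "card B \<le> n" and m: "real m \<le> \<eta> * n"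
    have "real (card {X. X \<subseteq> B \<and> card X \<le> m}) * y ^ m = (\<Sum>X | X \<subseteq> B \<and> card X \<le> m. y ^ m)"
      by simp
    also have "\<dots> \<le> (\<Sum>X | X \<subseteq> B \<and> card X \<le> m. y ^ card X)"
      using y by (intro sum_mono power_decreasing) auto
    also have "\<dots> \<le> (\<Sum>X\<in>Pow B. y ^ card X)"
      using y B by (intro sum_mono2) auto
    also have "\<dots> = (y + 1) ^ card B" using B by (simp add: sum_Pow_power)
    also have "\<dots> \<le> (y + 1) ^ n" using B y by (intro power_increasing) auto
    also have "\<dots> \<le> exp y ^ n" using y by (intro power_mono) (auto simp: add.commute)
    also have "\<dots> = exp (y * n)" by (simp add: exp_of_nat_mult[symmetric] mult.commute)
    finally have "real (card {X. X \<subseteq> B \<and> card X \<le> m}) \<le> exp (y * n) / y ^ m"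
      using y by (simp add: field_simps)
    also have "\<dots> = exp (y * n) * exp (l * m)"
    proof -
      have "exp (l * m) = (1 / y) ^ m" using y by (simp add: l_def exp_of_nat2_mult)
      thus ?thesis by (simp add: power_divide)
    qed
    also have "\<dots> = exp (y * n + l * m)" by (simp add: exp_add)
    also have "\<dots> \<le> exp (\<epsilon> * n)"
    proof -
      have "l * m \<le> l * (\<eta> * n)" using m l by (intro mult_left_mono) auto
      also have "\<dots> = (\<eta> * l) * n" by simp
      also have "\<dots> \<le> \<epsilon> / 2 * n" using \<eta> by (intro mult_right_mono) auto
      finally have "l * m \<le> \<epsilon> / 2 * n" .
      moreover have "y * n \<le> \<epsilon> / 2 * n" using y by (intro mult_right_mono) auto
      ultimately show ?thesis by (simp add: field_simps)
    qed
    finally show "real (card {X. X \<subseteq> B \<and> card X \<le> m}) \<le> exp (\<epsilon> * n)" .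
  qed
qed

lemma card_complements:
  assumes "finite B" shows "card {E. E \<subseteq> B \<and> card E = n} \<le> card {X. X \<subseteq> B \<and> card X \<le> card B - n}"
proof (rule card_inj_on_le[of "\<lambda>E. B - E"])
  show "inj_on (\<lambda>E. B - E) {E. E \<subseteq> B \<and> card E = n}" by (auto simp: inj_on_def)
  show "(\<lambda>E. B - E) ` {E. E \<subseteq> B \<and> card E = n} \<subseteq> {X. X \<subseteq> B \<and> card X \<le> card B - n}"
    using assms by (auto simp: card_Diff_subset finite_subset)
qed (use assms in auto)

lemma inj_sum_target_mono:
  assumes "finite D" "finite B'" "B \<subseteq> B'" "\<And>s t. W s t \<ge> 0"
  shows "inj_sum W D B \<le> inj_sum W D B'"
  unfolding inj_sum_def
proof (rule sum_mono2)
  show "finite {\<phi>. \<phi> \<in> D \<rightarrow>\<^sub>E B' \<and> inj_on \<phi> D}"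
    using assms by (auto intro!: finite_subset[OF _ finite_PiE[of D "\<lambda>_. B'"]])
  show "{\<phi>. \<phi> \<in> D \<rightarrow>\<^sub>E B \<and> inj_on \<phi> D} \<subseteq> {\<phi>. \<phi> \<in> D \<rightarrow>\<^sub>E B' \<and> inj_on \<phi> D}"
    using assms(3) by (auto simp: PiE_iff)
qed (use assms in \<open>auto intro!: prod_nonneg\<close>)

lemma inj_sum_cong:
  "(\<And>s t. s \<in> D \<Longrightarrow> t \<in> B \<Longrightarrow> W s t = W' s t) \<Longrightarrow> inj_sum W D B = inj_sum W' D B"
  unfolding inj_sum_def by (intro sum.cong prod.cong) auto

section \<open>Weighted injections in a group and tilings\<close>

text \<open>Writing \<open>t = s \<otimes> a\<close> turns the weight into \<open>h a\<close>, so
  this is the sum \<open>I(F)\<close> of the overview in terms of target points. The set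
  \<open>F <#> A\<close> contains every target of nonzero weight when \<open>h\<close> lives on
  \<open>A\<close>.\<close>

definition inj_perm :: "('a, 'm) monoid_scheme \<Rightarrow> 'a set \<Rightarrow> ('a \<Rightarrow> real) \<Rightarrow> 'a set \<Rightarrow> real"
  where "inj_perm G A h F = inj_sum (\<lambda>s t. h (inv\<^bsub>G\<^esub> s \<otimes>\<^bsub>G\<^esub> t)) F (F <#>\<^bsub>G\<^esub> A)"

text \<open>Cut off outside the carrier, where \<open>inv\<close> carries no information, so that
  reversing twice gives back \<open>h\<close>.\<close>

definition inv_weight :: "('a, 'm) monoid_scheme \<Rightarrow> ('a \<Rightarrow> real) \<Rightarrow> 'a \<Rightarrow> real"
  where "inv_weight G h s = (if s \<in> carrier G then h (inv\<^bsub>G\<^esub> s) else 0)"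

lemma finite_set_mult: "finite A \<Longrightarrow> finite B \<Longrightarrow> finite (A <#>\<^bsub>G\<^esub> B)"
  by (auto simp: set_mult_def)

lemma (in group) left_cancel:
  "x \<in> carrier G \<Longrightarrow> y \<in> carrier G \<Longrightarrow> z \<in> carrier G \<Longrightarrow> x \<otimes> y = x \<otimes> z \<longleftrightarrow> y = z"
  by (simp add: Units_eq)

text \<open>Union bound over \<open>K\<close>: right translation by a fixed \<open>\<kappa>\<close>
  is injective, so it leaves \<open>D\<close> at no more than \<open>card ((F <#> K) - D)\<close>
  points of \<open>F\<close>.\<close>

lemma (in group) card_le_card_tiles:
  assumes "finite F" "finite K" "finite D" "F \<subseteq> carrier G" "K \<subseteq> carrier G"
  shows "card F \<le> card {g\<in>F. \<forall>\<kappa>\<in>K. g \<otimes> \<kappa> \<in> D} + card K * card ((F <#> K) - D)"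
proof -
  let ?good = "{g\<in>F. \<forall>\<kappa>\<in>K. g \<otimes> \<kappa> \<in> D}" and ?bad = "\<lambda>\<kappa>. {g\<in>F. g \<otimes> \<kappa> \<notin> D}"
  have fin: "finite ((F <#> K) - D)" using assms by (auto simp: finite_set_mult)
  have "card F \<le> card (?good \<union> (\<Union>\<kappa>\<in>K. ?bad \<kappa>))"
    using assms by (intro card_mono) auto
  also have "\<dots> \<le> card ?good + card (\<Union>\<kappa>\<in>K. ?bad \<kappa>)" by (rule card_Un_le)
  also have "card (\<Union>\<kappa>\<in>K. ?bad \<kappa>) \<le> (\<Sum>\<kappa>\<in>K. card (?bad \<kappa>))" by (rule card_UN_le[OF assms(2)])
  also have "\<dots> \<le> (\<Sum>\<kappa>\<in>K. card ((F <#> K) - D))"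
  proof (intro sum_mono)
    fix \<kappa> assume \<kappa>: "\<kappa> \<in> K"
    have "inj_on (\<lambda>g. g \<otimes> \<kappa>) (?bad \<kappa>)"
      using \<kappa> assms by (intro inj_onI) (use right_cancel in blast)
    moreover have "(\<lambda>g. g \<otimes> \<kappa>) ` ?bad \<kappa> \<subseteq> (F <#> K) - D"
      using \<kappa> by (auto simp: set_mult_def)
    ultimately show "card (?bad \<kappa>) \<le> card ((F <#> K) - D)"
      using card_inj_on_le fin by blast
  qed
  finally show ?thesis by simp
qed

text \<open>Mass at most 1 keeps all sums over injections at most 1. Factors may then be dropped
  from products and growth rates are nonpositive; general weights are reduced to this case by
  scaling.\<close>

locale group_weight = group G for G (structure) +
  fixes A :: "'a set" and h :: "'a \<Rightarrow> real"
  assumes A: "finite A" "A \<noteq> {}" "A \<subseteq> carrier G"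
    and h_nonneg: "\<And>s. h s \<ge> 0" and h_supp: "\<And>s. s \<notin> A \<Longrightarrow> h s = 0" and h_sum: "sum h A \<le> 1"
begin

lemma dual: "group_weight G (m_inv G ` A) (inv_weight G h)"
proof -
  have inj: "inj_on (m_inv G) A" using A(3) by (meson inj_onI inv_inv subsetD inj_on_subset inv_inj)
  have "sum (inv_weight G h) (m_inv G ` A) = sum h A"
    using A(3) by (subst sum.reindex[OF inj]) (auto simp: inv_weight_def intro!: sum.cong)
  moreover have "inv_weight G h s = 0" if "s \<notin> m_inv G ` A" for s
    using that h_supp by (auto simp: inv_weight_def) (metis image_eqI inv_inv)
  ultimately show ?thesis
    using A h_nonneg h_sum by unfold_locales (auto simp: inv_weight_def)
qed

lemma inj_perm_target:
  assumes "finite F" "F \<subseteq> carrier G" "F <#> A \<subseteq> B" "finite B" "B \<subseteq> carrier G"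
  shows "inj_perm G A h F = inj_sum (\<lambda>s t. h (inv s \<otimes> t)) F B"
  unfolding inj_perm_def
proof (rule inj_sum_target_cong)
  fix s t assume st: "s \<in> F" "t \<in> B - (F <#> A)"
  hence "t = s \<otimes> (inv s \<otimes> t)" using assms by (metis DiffD1 inv_solve_left m_closed inv_closed subsetD)
  hence "inv s \<otimes> t \<notin> A" using st by (auto simp: set_mult_def)
  thus "h (inv s \<otimes> t) = 0" by (rule h_supp)
qed (use assms in auto)

lemma inj_perm_nonneg: "inj_perm G A h F \<ge> 0"
  unfolding inj_perm_def by (intro inj_sum_nonneg h_nonneg)

lemma inj_perm_le_1:
  assumes "finite F" "F \<subseteq> carrier G" shows "inj_perm G A h F \<le> 1"
  unfolding inj_perm_def
proof (rule inj_sum_le_1)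
  fix s assume "s \<in> F"
  hence s: "s \<in> carrier G" using assms by auto
  have sub: "F <#> A \<subseteq> carrier G" using assms A set_mult_closed by blast
  have fin: "finite (F <#> A)" using assms A by (simp add: finite_set_mult)
  have "inj_on (\<lambda>t. inv s \<otimes> t) (F <#> A)"
    using s sub by (intro inj_onI) (meson inv_closed left_cancel subsetD)
  hence "(\<Sum>t\<in>F <#> A. h (inv s \<otimes> t)) = sum h ((\<lambda>t. inv s \<otimes> t) ` (F <#> A))"
    by (simp add: sum.reindex)
  also have "\<dots> = sum h ((\<lambda>t. inv s \<otimes> t) ` (F <#> A) \<inter> A)"
    using fin h_supp by (intro sum.mono_neutral_right) auto
  also have "\<dots> \<le> sum h A" using A h_nonneg by (intro sum_mono2) auto
  finally show "(\<Sum>t\<in>F <#> A. h (inv s \<otimes> t)) \<le> 1" using h_sum by linarith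
qed (use assms A h_nonneg in \<open>auto intro!: finite_set_mult\<close>)

text \<open>Left translation cancels in \<open>inv s \<otimes> t\<close>, so all translates of a
  tile carry the same sum.\<close>

lemma inj_perm_translate:
  assumes "finite E" "E \<subseteq> carrier G" "g \<in> carrier G"
  shows "inj_perm G A h ((\<lambda>s. g \<otimes> s) ` E) = inj_perm G A h E"
proof -
  have sub: "E <#> A \<subseteq> carrier G" using assms A set_mult_closed by blast
  have inj: "inj_on (\<lambda>s. g \<otimes> s) X" if "X \<subseteq> carrier G" for X
    using that assms by (intro inj_onI) (meson left_cancel subsetD)
  have *: "((\<lambda>s. g \<otimes> s) ` E) <#> A = (\<lambda>s. g \<otimes> s) ` (E <#> A)"
  proof -
    have "(\<lambda>s. g \<otimes> s) ` (E <#> A) = (\<Union>s\<in>E. \<Union>a\<in>A. {g \<otimes> (s \<otimes> a)})" by (auto simp: set_mult_def)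
    also have "\<dots> = (\<Union>s\<in>E. \<Union>a\<in>A. {(g \<otimes> s) \<otimes> a})"
    proof (intro SUP_cong refl)
      fix s a assume "s \<in> E" "a \<in> A"
      thus "{g \<otimes> (s \<otimes> a)} = {(g \<otimes> s) \<otimes> a}" using assms A(3) by (subst m_assoc) auto
    qed
    also have "\<dots> = ((\<lambda>s. g \<otimes> s) ` E) <#> A" by (auto simp: set_mult_def)
    finally show ?thesis ..
  qed
  have "inj_perm G A h ((\<lambda>s. g \<otimes> s) ` E) =
      inj_sum (\<lambda>s t. h (inv (g \<otimes> s) \<otimes> (g \<otimes> t))) E (E <#> A)"
    unfolding inj_perm_def * using assms A sub
    by (intro inj_sum_reindex inj) (auto simp: finite_set_mult)
  also have "\<dots> = inj_perm G A h E"
    unfolding inj_perm_def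
  proof (intro inj_sum_cong)
    fix s t assume "s \<in> E" "t \<in> E <#> A"
    hence "s \<in> carrier G" "t \<in> carrier G" using assms sub by auto
    moreover from this have "inv g \<otimes> (g \<otimes> t) = t" using assms(3) by (simp flip: m_assoc)
    ultimately show "h (inv (g \<otimes> s) \<otimes> (g \<otimes> t)) = h (inv s \<otimes> t)"
      using assms(3) by (simp add: inv_mult_group m_assoc)
  qed
  finally show ?thesis .
qed

text \<open>Shearer's inequality for the translates of \<open>K\<close> cut down to
  \<open>D\<close>. Translates inside \<open>D\<close> contribute the sum of \<open>K\<close> by
  invariance, incomplete ones at most 1.\<close>

lemma inj_perm_power_le:
  assumes D: "finite D" "D \<subseteq> carrier G" and K: "finite K" "K \<noteq> {}" "K \<subseteq> carrier G"
    and g: "finite good" "good \<subseteq> {g\<in>carrier G. \<forall>\<kappa>\<in>K. g \<otimes> \<kappa> \<in> D}"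
  shows "inj_perm G A h D ^ card K \<le> inj_perm G A h K ^ card good"
proof -
  \<comment> \<open>These are the \<open>g\<close> whose tile meets \<open>D\<close>. A point
    \<open>s\<close> of \<open>D\<close> lies in the tiles with
    \<open>g = s \<otimes> inv \<kappa>\<close> and in no others, that is in \<open>card K\<close>
    of them.\<close>
  define I where "I = D <#> m_inv G ` K"
  define E where "E g = (\<lambda>\<kappa>. g \<otimes> \<kappa>) ` K \<inter> D" for g
  let ?B = "D <#> A"
  let ?W = "\<lambda>s t. h (inv s \<otimes> t)"
  have Ksub: "m_inv G ` K \<subseteq> carrier G" using K by auto
  have I: "finite I" "I \<subseteq> carrier G"
    using D K set_mult_closed[OF D(2) Ksub] by (auto simp: I_def finite_set_mult)
  have E: "E g \<subseteq> D" "finite (E g)" for g using D by (auto simp: E_def finite_subset)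
  have sub: "?B \<subseteq> carrier G" "finite ?B" using D A set_mult_closed by (auto simp: finite_set_mult)
  have mono: "E g <#> A \<subseteq> ?B" for g using E by (intro mono_set_mult) auto
  have card: "card {g\<in>I. s \<in> E g} = card K" if "s \<in> D" for s
  proof -
    have s: "s \<in> carrier G" using that D by auto
    have "{g\<in>I. s \<in> E g} = (\<lambda>\<kappa>. s \<otimes> inv \<kappa>) ` K"
    proof (intro equalityI subsetI)
      fix g assume "g \<in> {g\<in>I. s \<in> E g}"
      then obtain \<kappa> where \<kappa>: "\<kappa> \<in> K" "s = g \<otimes> \<kappa>" "g \<in> carrier G" using I by (auto simp: E_def)
      hence "g = s \<otimes> inv \<kappa>" using K by (metis inv_solve_right s subsetD)
      thus "g \<in> (\<lambda>\<kappa>. s \<otimes> inv \<kappa>) ` K" using \<kappa> by auto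
    next
      fix g assume "g \<in> (\<lambda>\<kappa>. s \<otimes> inv \<kappa>) ` K"
      then obtain \<kappa> where \<kappa>: "\<kappa> \<in> K" "g = s \<otimes> inv \<kappa>" by auto
      hence "g \<otimes> \<kappa> = s" using s K by (metis inv_closed inv_solve_right m_closed subsetD)
      moreover have "g \<in> I" using \<kappa> that by (auto simp: I_def set_mult_def)
      ultimately show "g \<in> {g\<in>I. s \<in> E g}" using \<kappa>(1) that by (auto simp: E_def)
    qed
    moreover have "inj_on (\<lambda>\<kappa>. s \<otimes> inv \<kappa>) K"
      using s K by (intro inj_onI) (metis inv_closed inv_inv left_cancel subsetD)
    ultimately show ?thesis by (simp add: card_image)
  qed
  have goodI: "good \<subseteq> I"
  proof
    fix x assume "x \<in> good"
    obtain \<kappa> where \<kappa>: "\<kappa> \<in> K" using K by auto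
    have x: "x \<in> carrier G" "x \<otimes> \<kappa> \<in> D" using \<open>x \<in> good\<close> g \<kappa> by auto
    moreover have "x = (x \<otimes> \<kappa>) \<otimes> inv \<kappa>"
      using x \<kappa> K by (metis D(2) inv_solve_right subsetD)
    ultimately show "x \<in> I" using \<kappa> by (auto simp: I_def set_mult_def)
  qed
  have Eg: "inj_sum ?W (E g) ?B = inj_perm G A h (E g)" for g
    using E[of g] D sub mono by (intro inj_perm_target[symmetric]) auto
  have Eg1: "inj_perm G A h (E g) \<le> 1" for g using E[of g] D by (intro inj_perm_le_1) auto
  have "inj_perm G A h D ^ card K \<le> (\<Prod>g\<in>I. inj_perm G A h (E g))"
    unfolding inj_perm_def[of G A h D] Eg[symmetric]
    using D I sub K E card h_nonneg by (intro inj_sum_shearer) (auto simp: card_gt_0_iff)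
  also have "\<dots> = (\<Prod>g\<in>I - good. inj_perm G A h (E g)) * (\<Prod>g\<in>good. inj_perm G A h (E g))"
    using goodI I by (intro prod.subset_diff) auto
  also have "\<dots> \<le> 1 * (\<Prod>g\<in>good. inj_perm G A h (E g))"
    by (intro mult_right_mono prod_le_1 prod_nonneg) (auto simp: inj_perm_nonneg Eg1)
  also have "(\<Prod>g\<in>good. inj_perm G A h (E g)) = (\<Prod>g\<in>good. inj_perm G A h K)"
  proof (intro prod.cong refl)
    fix x assume "x \<in> good"
    hence "E x = (\<lambda>\<kappa>. x \<otimes> \<kappa>) ` K" "x \<in> carrier G" using g by (auto simp: E_def)
    thus "inj_perm G A h (E x) = inj_perm G A h K" using K by (simp add: inj_perm_translate)
  qed
  finally show ?thesis by simp
qed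

text \<open>A rate achieved by a single tile \<open>K\<close> passes to every finite
  \<open>D\<close> that nearly contains \<open>F <#> K\<close>. The exponent is counted by
  \<open>F\<close> rather than \<open>D\<close>, since later \<open>D\<close> is a set of about the
  size of \<open>F\<close> with no invariance of its own.\<close>

lemma inj_perm_upper:
  fixes c :: real
  assumes K: "finite K" "K \<noteq> {}" "K \<subseteq> carrier G" and c: "inj_perm G A h K < exp (c * card K)"
  obtains \<delta> :: real where "\<delta> > 0"
    "\<And>F D. finite F \<Longrightarrow> finite D \<Longrightarrow> F \<subseteq> carrier G \<Longrightarrow> D \<subseteq> carrier G \<Longrightarrow>
      real (card ((F <#> K) - D)) \<le> \<delta> * card F \<Longrightarrow> inj_perm G A h D \<le> exp (c * card F)"
proof (cases "c \<ge> 0")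
  case True
  have "inj_perm G A h D \<le> exp (c * real (card F))" if "finite D" "D \<subseteq> carrier G" for F :: "'a set" and D
    by (rule order_trans[OF inj_perm_le_1[OF that]]) (use True in simp)
  thus ?thesis using that[of 1] by auto
next
  case False
  define k where "k = real (card K)"
  have k: "k > 0" using K by (simp add: k_def card_gt_0_iff)
  \<comment> \<open>The strict inequality leaves room for a smaller rate \<open>c'\<close>, which
    compensates for the tiles lost at the boundary.\<close>
  obtain c' :: real where c': "c' < c" "inj_perm G A h K \<le> exp (c' * k)"
  proof (cases "inj_perm G A h K = 0")
    case True thus ?thesis using that[of "c - 1"] by simp
  next
    case False
    hence pos: "inj_perm G A h K > 0" using inj_perm_nonneg[of K] by simp
    hence "exp (ln (inj_perm G A h K)) < exp (c * k)" using c by (simp add: k_def)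
    hence "ln (inj_perm G A h K) < c * k" by simp
    thus ?thesis using k pos by (intro that[of "ln (inj_perm G A h K) / k"]) (auto simp: field_simps)
  qed
  \<comment> \<open>With \<open>c' < c < 0\<close> it suffices that a fraction \<open>c / c'\<close>
    of the points of \<open>F\<close> start complete tiles; the others number at most
    \<open>k * \<delta> * card F\<close>.\<close>
  define \<delta> where "\<delta> = (1 - c / c') / k"
  have "c / c' < 1" using False c' by (simp add: divide_less_eq)
  hence \<delta>: "\<delta> > 0" using k by (simp add: \<delta>_def)
  show ?thesis
  proof (rule that[OF \<delta>])
    fix F D assume FD: "finite F" "finite D" "F \<subseteq> carrier G" "D \<subseteq> carrier G"
      and le: "real (card ((F <#> K) - D)) \<le> \<delta> * card F"
    define m where "m = card {g\<in>F. \<forall>\<kappa>\<in>K. g \<otimes> \<kappa> \<in> D}"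
    have "real (card F) \<le> real (m + card K * card ((F <#> K) - D))"
      unfolding m_def of_nat_le_iff by (rule card_le_card_tiles[OF FD(1) K(1) FD(2,3) K(3)])
    hence "real (card F) \<le> real m + k * real (card ((F <#> K) - D))" by (simp add: k_def)
    also have "\<dots> \<le> real m + k * (\<delta> * card F)" using le k by (intro add_left_mono mult_left_mono) auto
    also have "k * \<delta> = 1 - c / c'" using k by (simp add: \<delta>_def)
    hence "k * (\<delta> * card F) = card F - (c / c') * card F"
      unfolding mult.assoc[symmetric] by (simp add: left_diff_distrib)
    finally have "(c / c') * card F \<le> real m" by simp
    hence m: "c' * real m \<le> c * card F" using False c' by (simp add: field_simps)
    have "inj_perm G A h D ^ card K \<le> inj_perm G A h K ^ m"
      unfolding m_def using FD K by (intro inj_perm_power_le) auto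
    also have "\<dots> \<le> exp (c' * k) ^ m" using c' by (intro power_mono inj_perm_nonneg)
    also have "\<dots> = exp (k * (c' * m))" by (simp add: exp_of_nat_mult[symmetric] algebra_simps)
    also have "\<dots> \<le> exp (k * (c * card F))" using m k by simp
    also have "\<dots> = exp (c * card F) ^ card K" by (simp add: exp_of_nat_mult[symmetric] k_def)
    finally show "inj_perm G A h D \<le> exp (c * card F)"
      using K by (subst (asm) power_mono_iff) (auto simp: card_gt_0_iff inj_perm_nonneg)
  qed
qed

end

section \<open>Exchange along alternating paths\<close>

inductive_set orbit :: "'b set \<Rightarrow> 'b set \<Rightarrow> ('b \<Rightarrow> 'b) \<Rightarrow> 'b set" for X T \<alpha> where
  base: "t \<in> X \<Longrightarrow> t \<in> orbit X T \<alpha>"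
| step: "t \<in> orbit X T \<alpha> \<Longrightarrow> t \<in> T \<Longrightarrow> \<alpha> t \<in> orbit X T \<alpha>"

text \<open>Only values at points of \<open>T\<close> already reached enter the generation. This
  lets the maps before and after an exchange have the same orbit.\<close>

lemma orbit_cong:
  assumes "\<And>t. t \<in> orbit X T \<alpha> \<Longrightarrow> t \<in> T \<Longrightarrow> \<alpha> t = \<beta> t"
  shows "orbit X T \<alpha> = orbit X T \<beta>"
proof (intro equalityI subsetI)
  fix t assume "t \<in> orbit X T \<alpha>"
  thus "t \<in> orbit X T \<beta>"
    by induction (use assms in \<open>metis orbit.simps\<close>)+
next
  fix t assume "t \<in> orbit X T \<beta>"
  thus "t \<in> orbit X T \<alpha>"
    by induction (use assms in \<open>metis orbit.simps\<close>)+
qed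

lemma finite_injections: "finite D \<Longrightarrow> finite B \<Longrightarrow> finite {\<phi>. \<phi> \<in> D \<rightarrow>\<^sub>E B \<and> inj_on \<phi> D}"
  by (auto intro!: finite_subset[OF _ finite_PiE[of D "\<lambda>_. B"]])

text \<open>
  The alternating paths of \<open>\<phi>\<close> and \<open>\<psi>\<close> that start at a point of \<open>T\<close> missed by \<open>\<phi>\<close>
  have vertex set \<open>U\<close> on the side of \<open>B\<close>. Exchanging \<open>\<phi>\<close> and \<open>\<psi>\<close> along them makes \<open>\<phi>\<close>
  cover \<open>T\<close>. The exchange can be undone if the missed points are remembered, as \<open>U\<close> is also
  an orbit for the exchanged pair.
\<close>

locale matching_exchange =
  fixes F T B :: "'a set" and \<phi> \<psi> :: "'a \<Rightarrow> 'a"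
  assumes fin: "finite F" "finite B" "T \<subseteq> B"
    and \<phi>: "\<phi> \<in> F \<rightarrow>\<^sub>E B" "inj_on \<phi> F" and \<psi>: "\<psi> \<in> T \<rightarrow>\<^sub>E F" "inj_on \<psi> T"
begin

text \<open>A path visits a point of \<open>X\<close>, its \<open>\<psi>\<close>-image in
  \<open>F\<close>, the \<open>\<phi>\<close>-image of that, and so on, until it leaves
  \<open>T\<close>; \<open>S\<close> collects the vertices in \<open>F\<close>. On \<open>S\<close>
  the map \<open>M\<close> takes over the edges of \<open>\<psi>\<close> and \<open>M'\<close> those
  of \<open>\<phi>\<close>; off \<open>S\<close> nothing is exchanged.\<close>

definition "X = T - \<phi> ` F"
definition "U = orbit X T (\<lambda>t. \<phi> (\<psi> t))"
definition "S = \<psi> ` (U \<inter> T)"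
definition "D = \<psi> ` T"
definition "\<kappa> = the_inv_into T \<psi>"
definition "M = (\<lambda>s\<in>F. if s \<in> S then \<kappa> s else \<phi> s)"
definition "M' = (\<lambda>s\<in>D. if s \<in> S then \<phi> s else \<kappa> s)"

lemma \<kappa>: "t \<in> T \<Longrightarrow> \<kappa> (\<psi> t) = t"
  unfolding \<kappa>_def using \<psi> by (intro the_inv_into_f_f) auto

lemma SD: "S \<subseteq> D" "D \<subseteq> F" using \<psi> by (auto simp: S_def D_def)

lemma \<kappa>D: "s \<in> D \<Longrightarrow> \<kappa> s \<in> T" "s \<in> D \<Longrightarrow> \<psi> (\<kappa> s) = s"
  by (auto simp: D_def \<kappa>)

lemma \<phi>B: "s \<in> F \<Longrightarrow> \<phi> s \<in> B" and \<kappa>B: "s \<in> D \<Longrightarrow> \<kappa> s \<in> B"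
  using \<phi> fin \<kappa>D by auto

lemma \<kappa>S: "s \<in> S \<Longrightarrow> \<kappa> s \<in> U \<inter> T" by (auto simp: S_def \<kappa>)

text \<open>A point of \<open>U\<close> hit by \<open>\<phi>\<close> is no starting point, so it was
  reached from some \<open>\<psi> t\<close>, and injectivity of \<open>\<phi>\<close> identifies its
  source.\<close>

lemma \<phi>_U: "s \<in> F \<Longrightarrow> \<phi> s \<in> U \<longleftrightarrow> s \<in> S"
proof
  assume s: "s \<in> F" "\<phi> s \<in> U"
  from s(2) show "s \<in> S" unfolding U_def
  proof cases
    case base
    thus ?thesis using s by (auto simp: X_def)
  next
    case (step t)
    hence "s = \<psi> t" using \<phi> \<psi> s by (auto dest: inj_onD)
    thus ?thesis using step by (auto simp: S_def U_def)
  qed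
next
  assume s: "s \<in> F" "s \<in> S"
  thus "\<phi> s \<in> U" by (auto simp: S_def U_def intro: orbit.step)
qed

lemma \<kappa>_U: "s \<in> D \<Longrightarrow> \<kappa> s \<in> U \<longleftrightarrow> s \<in> S"
  using \<kappa>D by (auto simp: S_def \<kappa>) (metis IntI imageI)

text \<open>The values on \<open>S\<close> lie in \<open>U\<close> and the others outside it, so the
  mixed map is injective piece by piece. A point of \<open>T\<close> outside \<open>U\<close> is not
  in \<open>X\<close>, hence \<open>\<phi>\<close> covers it by an edge that is left
  unchanged.\<close>

lemma M: "M \<in> F \<rightarrow>\<^sub>E B" "inj_on M F" "T \<subseteq> M ` F"
proof -
  have MU: "M s \<in> U \<longleftrightarrow> s \<in> S" if "s \<in> F" for s
    using that \<kappa>S[of s] \<phi>_U[of s] by (simp add: M_def)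
  show "M \<in> F \<rightarrow>\<^sub>E B" unfolding M_def using \<phi>B \<kappa>B SD by (intro restrict_PiE_iff[THEN iffD2]) auto
  show "inj_on M F"
  proof (rule inj_onI)
    fix s s' assume *: "s \<in> F" "s' \<in> F" "M s = M s'"
    hence eq: "s \<in> S \<longleftrightarrow> s' \<in> S" using MU by metis
    show "s = s'"
    proof (cases "s \<in> S")
      case True
      hence "\<kappa> s = \<kappa> s'" using * eq by (simp add: M_def)
      hence "\<psi> (\<kappa> s) = \<psi> (\<kappa> s')" by simp
      moreover have "s \<in> D" "s' \<in> D" using True eq SD by auto
      ultimately show ?thesis by (simp add: \<kappa>D(2))
    next
      case False
      hence "\<phi> s = \<phi> s'" using * eq by (simp add: M_def)
      thus ?thesis using * \<phi>(2) by (auto dest: inj_onD)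
    qed
  qed
  show "T \<subseteq> M ` F"
  proof
    fix t assume t: "t \<in> T"
    show "t \<in> M ` F"
    proof (cases "t \<in> U")
      case True
      hence "M (\<psi> t) = t" "\<psi> t \<in> F" using t \<psi> by (auto simp: M_def S_def \<kappa>)
      thus ?thesis by (metis imageI)
    next
      case False
      hence "t \<in> \<phi> ` F" using t by (auto simp: U_def X_def intro: orbit.base)
      then obtain s where s: "s \<in> F" "t = \<phi> s" by auto
      hence "M s = t" using False \<phi>_U by (auto simp: M_def)
      thus ?thesis using s(1) by (metis imageI)
    qed
  qed
qed

lemma M': "M' \<in> D \<rightarrow>\<^sub>E B" "inj_on M' D"
proof -
  have MU: "M' s \<in> U \<longleftrightarrow> s \<in> S" if "s \<in> D" for s
    using that SD \<phi>_U[of s] \<kappa>_U[of s] by (auto simp: M'_def)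
  show "M' \<in> D \<rightarrow>\<^sub>E B" unfolding M'_def using \<phi>B \<kappa>B SD by (intro restrict_PiE_iff[THEN iffD2]) auto
  show "inj_on M' D"
  proof (rule inj_onI)
    fix s s' assume *: "s \<in> D" "s' \<in> D" "M' s = M' s'"
    hence F: "s \<in> F" "s' \<in> F" using SD by auto
    have eq: "s \<in> S \<longleftrightarrow> s' \<in> S" using * MU by metis
    show "s = s'"
    proof (cases "s \<in> S")
      case True
      hence "\<phi> s = \<phi> s'" using * eq by (simp add: M'_def)
      thus ?thesis using F \<phi>(2) by (auto dest: inj_onD)
    next
      case False
      hence "\<kappa> s = \<kappa> s'" using * eq by (simp add: M'_def)
      hence "\<psi> (\<kappa> s) = \<psi> (\<kappa> s')" by simp
      thus ?thesis using *(1,2) by (simp add: \<kappa>D(2))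
    qed
  qed
qed

text \<open>The exchange redistributes the edges over \<open>S\<close> between the two matchings and
  creates none, so the total product is preserved for any \<open>W\<close>.\<close>

lemma weight:
  fixes W :: "'a \<Rightarrow> 'a \<Rightarrow> real"
  shows "(\<Prod>s\<in>F. W s (\<phi> s)) * (\<Prod>t\<in>T. W (\<psi> t) t) = (\<Prod>s\<in>F. W s (M s)) * (\<Prod>s\<in>D. W s (M' s))"
proof -
  have finD: "finite D" "finite S" using finite_subset[OF SD(2) fin(1)] finite_subset[OF SD(1)] by auto
  have split: "(\<Prod>s\<in>Y. f s) = (\<Prod>s\<in>Y - S. f s) * (\<Prod>s\<in>S. f s)" if "finite Y" "S \<subseteq> Y" for Y and f :: "'a \<Rightarrow> real"
    using that by (intro prod.subset_diff) auto
  have "(\<Prod>t\<in>T. W (\<psi> t) t) = (\<Prod>s\<in>D. W s (\<kappa> s))"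
    unfolding D_def using \<psi>(2) by (subst prod.reindex) (auto simp: \<kappa> intro!: prod.cong)
  also have "\<dots> = (\<Prod>s\<in>D - S. W s (\<kappa> s)) * (\<Prod>s\<in>S. W s (\<kappa> s))" using finD SD by (intro split)
  finally have 1: "(\<Prod>t\<in>T. W (\<psi> t) t) = (\<Prod>s\<in>D - S. W s (\<kappa> s)) * (\<Prod>s\<in>S. W s (\<kappa> s))" .
  have 2: "(\<Prod>s\<in>F. W s (\<phi> s)) = (\<Prod>s\<in>F - S. W s (\<phi> s)) * (\<Prod>s\<in>S. W s (\<phi> s))"
    using fin SD by (intro split) auto
  have "(\<Prod>s\<in>F. W s (M s)) = (\<Prod>s\<in>F - S. W s (M s)) * (\<Prod>s\<in>S. W s (M s))"
    using fin SD by (intro split) auto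
  also have "(\<Prod>s\<in>F - S. W s (M s)) = (\<Prod>s\<in>F - S. W s (\<phi> s))"
    by (intro prod.cong) (auto simp: M_def)
  also have "(\<Prod>s\<in>S. W s (M s)) = (\<Prod>s\<in>S. W s (\<kappa> s))"
    using SD by (intro prod.cong) (auto simp: M_def)
  finally have 3: "(\<Prod>s\<in>F. W s (M s)) = (\<Prod>s\<in>F - S. W s (\<phi> s)) * (\<Prod>s\<in>S. W s (\<kappa> s))" .
  have "(\<Prod>s\<in>D. W s (M' s)) = (\<Prod>s\<in>D - S. W s (M' s)) * (\<Prod>s\<in>S. W s (M' s))"
    using finD SD by (intro split) auto
  also have "(\<Prod>s\<in>D - S. W s (M' s)) = (\<Prod>s\<in>D - S. W s (\<kappa> s))"
    by (intro prod.cong) (auto simp: M'_def)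
  also have "(\<Prod>s\<in>S. W s (M' s)) = (\<Prod>s\<in>S. W s (\<phi> s))"
    using SD by (intro prod.cong) (auto simp: M'_def)
  finally show ?thesis unfolding 1 2 3 by (simp add: algebra_simps)
qed

text \<open>Starting points are points of \<open>B\<close> missed by \<open>\<phi>\<close>; the
  memory needed to undo an exchange is thus small when \<open>B\<close> is only slightly larger than
  \<open>F\<close>.\<close>

lemma card_X: "card X \<le> card B - card F"
proof -
  have "card X \<le> card (B - \<phi> ` F)" unfolding X_def using fin by (intro card_mono) auto
  also have "\<dots> = card B - card F"
    using \<phi> fin by (subst card_Diff_subset) (auto simp: card_image)
  finally show ?thesis .
qed

lemma card_D: "card D = card T" unfolding D_def using \<psi> by (simp add: card_image)

text \<open>On path vertices in \<open>T\<close> the inverse of \<open>M\<close> is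
  \<open>\<psi>\<close>, and \<open>M'\<close> agrees with \<open>\<phi>\<close> on
  \<open>S\<close>. Hence the paths can be retraced from \<open>X\<close>, \<open>M\<close> and
  \<open>M'\<close> alone.\<close>

lemma U_eq: "U = orbit X T (\<lambda>t. M' (the_inv_into F M t))"
  unfolding U_def
proof (rule orbit_cong)
  fix t assume "t \<in> orbit X T (\<lambda>t. \<phi> (\<psi> t))" "t \<in> T"
  hence t: "\<psi> t \<in> S" "t \<in> T" by (auto simp: S_def U_def)
  hence "\<psi> t \<in> F" "M (\<psi> t) = t" using SD by (auto simp: M_def \<kappa>)
  hence "the_inv_into F M t = \<psi> t" using M(2) by (metis the_inv_into_f_f)
  thus "\<phi> (\<psi> t) = M' (the_inv_into F M t)" using t SD by (auto simp: M'_def)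
qed

lemma S_eq: "S = the_inv_into F M ` (U \<inter> T)"
proof -
  have "the_inv_into F M t = \<psi> t" if "t \<in> U \<inter> T" for t
  proof -
    have t: "\<psi> t \<in> S" "t \<in> T" using that by (auto simp: S_def)
    hence "\<psi> t \<in> F" "M (\<psi> t) = t" using SD by (auto simp: M_def \<kappa>)
    thus ?thesis using M(2) by (metis the_inv_into_f_f)
  qed
  thus ?thesis by (auto simp: S_def)
qed

lemma \<phi>_eq: "\<phi> = (\<lambda>s\<in>F. if s \<in> S then M' s else M s)"
  using \<phi>(1) SD by (intro ext) (auto simp: M_def M'_def PiE_iff extensional_def)

text \<open>\<open>\<kappa>\<close> is \<open>M\<close> on \<open>S\<close> and \<open>M'\<close> on
  the rest of \<open>D\<close>; inverting it gives back \<open>\<psi>\<close>.\<close>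

lemma \<psi>_eq: "\<psi> = (\<lambda>t\<in>T. THE s. s \<in> D \<and> (if s \<in> S then M s else M' s) = t)"
proof
  fix t
  have "(THE s. s \<in> D \<and> (if s \<in> S then M s else M' s) = t) = \<psi> t" if "t \<in> T"
  proof (rule the_equality)
    have D: "\<psi> t \<in> D" using that by (auto simp: D_def)
    thus "\<psi> t \<in> D \<and> (if \<psi> t \<in> S then M (\<psi> t) else M' (\<psi> t)) = t"
      using that SD by (auto simp: M_def M'_def \<kappa>)
    fix s assume "s \<in> D \<and> (if s \<in> S then M s else M' s) = t"
    hence "s \<in> D" "\<kappa> s = t" using SD by (auto simp: M_def M'_def split: if_splits)
    thus "s = \<psi> t" using \<kappa>D by auto
  qed
  thus "\<psi> t = (\<lambda>t\<in>T. THE s. s \<in> D \<and> (if s \<in> S then M s else M' s) = t) t"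
    using \<psi>(1) by (auto simp: PiE_iff extensional_def)
qed

end

text \<open>The exchange sends pairs of injections injectively and with the same weight to
  quadruples: a missed set, an injection covering \<open>T\<close>, a domain \<open>D\<close> and an
  injection on \<open>D\<close>. The right-hand side sums over all such quadruples.\<close>

lemma inj_sum_mult_le_covering:
  fixes W :: "'a \<Rightarrow> 'a \<Rightarrow> real"
  assumes fin: "finite F" "finite B" "T \<subseteq> B" and nn: "\<And>s t. W s t \<ge> 0"
  shows "inj_sum W F B * inj_sum (\<lambda>t s. W s t) T F \<le>
    real (card {X. X \<subseteq> T \<and> card X \<le> card B - card F}) *
    (\<Sum>\<phi> | \<phi> \<in> F \<rightarrow>\<^sub>E B \<and> inj_on \<phi> F \<and> T \<subseteq> \<phi> ` F. \<Prod>s\<in>F. W s (\<phi> s)) *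
    (\<Sum>D | D \<subseteq> F \<and> card D = card T. inj_sum W D B)"
proof -
  have finT: "finite T" using fin finite_subset by blast
  define P where "P = {\<phi>. \<phi> \<in> F \<rightarrow>\<^sub>E B \<and> inj_on \<phi> F} \<times> {\<psi>. \<psi> \<in> T \<rightarrow>\<^sub>E F \<and> inj_on \<psi> T}"
  define XX where "XX = {X. X \<subseteq> T \<and> card X \<le> card B - card F}"
  define ZZ where "ZZ = {\<phi>. \<phi> \<in> F \<rightarrow>\<^sub>E B \<and> inj_on \<phi> F \<and> T \<subseteq> \<phi> ` F}"
  define DD where "DD = (SIGMA D:{D. D \<subseteq> F \<and> card D = card T}. {\<phi>. \<phi> \<in> D \<rightarrow>\<^sub>E B \<and> inj_on \<phi> D})"
  define \<Phi> where "\<Phi> = (\<lambda>(\<phi>, \<psi>). (matching_exchange.X F T \<phi>, matching_exchange.M F T \<phi> \<psi>,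
     matching_exchange.D T \<psi>, matching_exchange.M' F T \<phi> \<psi>))"
  have loc: "matching_exchange F T B \<phi> \<psi>" if "(\<phi>, \<psi>) \<in> P" for \<phi> \<psi>
    using that fin by unfold_locales (auto simp: P_def)
  have finXX: "finite XX" using finT by (simp add: XX_def)
  have finZZ: "finite ZZ" unfolding ZZ_def using fin
    by (intro finite_subset[OF _ finite_injections[of F B]]) auto
  have finDD: "finite DD" unfolding DD_def using fin
    by (intro finite_SigmaI) (auto intro!: finite_injections dest: finite_subset[OF _ fin(1)])
  \<comment> \<open>Equal results have equal paths and hence equal \<open>S\<close>, after which
    both original maps are determined.\<close>
  have inj: "inj_on \<Phi> P"
  proof (rule inj_onI)
    fix p q assume pq: "p \<in> P" "q \<in> P" "\<Phi> p = \<Phi> q"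
    obtain \<phi>1 \<psi>1 \<phi>2 \<psi>2 where [simp]: "p = (\<phi>1, \<psi>1)" "q = (\<phi>2, \<psi>2)" by (cases p, cases q)
    interpret m1: matching_exchange F T B \<phi>1 \<psi>1 using loc pq by simp
    interpret m2: matching_exchange F T B \<phi>2 \<psi>2 using loc pq by simp
    have eq: "m1.X = m2.X" "m1.M = m2.M" "m1.D = m2.D" "m1.M' = m2.M'"
      using pq by (auto simp: \<Phi>_def)
    have U: "m1.U = m2.U" unfolding m1.U_eq m2.U_eq eq ..
    have S: "m1.S = m2.S" unfolding m1.S_eq m2.S_eq eq U ..
    have "\<phi>1 = \<phi>2" by (subst m1.\<phi>_eq, subst m2.\<phi>_eq) (simp only: eq S)
    moreover have "\<psi>1 = \<psi>2" by (subst m1.\<psi>_eq, subst m2.\<psi>_eq) (simp only: eq S)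
    ultimately show "p = q" by simp
  qed
  have sub: "\<Phi> ` P \<subseteq> XX \<times> ZZ \<times> DD"
  proof
    fix q assume "q \<in> \<Phi> ` P"
    then obtain \<phi> \<psi> where p: "(\<phi>, \<psi>) \<in> P" "q = \<Phi> (\<phi>, \<psi>)" by auto
    interpret m: matching_exchange F T B \<phi> \<psi> using loc p by simp
    show "q \<in> XX \<times> ZZ \<times> DD"
      using m.M m.M' m.card_X m.card_D m.SD by (auto simp: p \<Phi>_def XX_def ZZ_def DD_def m.X_def)
  qed
  define w where "w q = (case q of (X :: 'a set, M, D, M') \<Rightarrow> (\<Prod>s\<in>F. W s (M s)) * (\<Prod>s\<in>D. W s (M' s)))" for q
  have w_nonneg: "0 \<le> w q" for q
    unfolding w_def split_def by (intro mult_nonneg_nonneg prod_nonneg ballI nn)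
  have "inj_sum W F B * inj_sum (\<lambda>t s. W s t) T F =
      (\<Sum>(\<phi>, \<psi>)\<in>P. (\<Prod>s\<in>F. W s (\<phi> s)) * (\<Prod>t\<in>T. W (\<psi> t) t))"
    by (simp only: inj_sum_def P_def sum_product sum.cartesian_product' prod.case)
  also have "\<dots> = (\<Sum>p\<in>P. w (\<Phi> p))"
  proof (rule sum.cong[OF refl])
    fix p assume p: "p \<in> P"
    obtain \<phi> \<psi> where p_eq: "p = (\<phi>, \<psi>)" by (cases p)
    interpret m: matching_exchange F T B \<phi> \<psi> using loc p unfolding p_eq by blast
    show "(case p of (\<phi>, \<psi>) \<Rightarrow> (\<Prod>s\<in>F. W s (\<phi> s)) * (\<Prod>t\<in>T. W (\<psi> t) t)) = w (\<Phi> p)"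
      by (simp only: p_eq \<Phi>_def w_def split_conv) (rule m.weight)
  qed
  also have "\<dots> = (\<Sum>q\<in>\<Phi> ` P. w q)" using inj by (simp add: sum.reindex)
  also have "\<dots> \<le> (\<Sum>q\<in>XX \<times> ZZ \<times> DD. w q)"
    by (rule sum_mono2[OF _ sub w_nonneg]) (intro finite_cartesian_product finXX finZZ finDD)
  also have "\<dots> = (\<Sum>X\<in>XX. \<Sum>M\<in>ZZ. \<Sum>p\<in>DD. (\<Prod>s\<in>F. W s (M s)) * (\<Prod>s\<in>fst p. W s (snd p s)))"
    by (simp only: sum.cartesian_product' w_def split_def prod.case fst_conv snd_conv)
  also have "\<dots> = real (card XX) * ((\<Sum>\<phi>\<in>ZZ. \<Prod>s\<in>F. W s (\<phi> s)) * (\<Sum>(D, \<phi>)\<in>DD. \<Prod>s\<in>D. W s (\<phi> s)))"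
    unfolding sum_product split_def by simp
  also have "(\<Sum>(D, \<phi>)\<in>DD. \<Prod>s\<in>D. W s (\<phi> s)) = (\<Sum>D | D \<subseteq> F \<and> card D = card T. inj_sum W D B)"
    unfolding DD_def inj_sum_def
  proof (rule sum.Sigma[symmetric])
    show "\<forall>D\<in>{D. D \<subseteq> F \<and> card D = card T}. finite {\<phi>. \<phi> \<in> D \<rightarrow>\<^sub>E B \<and> inj_on \<phi> D}"
      using finite_injections finite_subset[OF _ fin(1)] fin(2) by blast
  qed (use fin in simp)
  finally show ?thesis unfolding XX_def ZZ_def mult.assoc .
qed

section \<open>Comparison with the reversed weight and with the local permanent\<close>

context group_weight
begin

text \<open>Reversing the weight transposes the matrix, as \<open>inv t \<otimes> s\<close> is the
  inverse of \<open>inv s \<otimes> t\<close>.\<close>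

lemma inj_perm_dual:
  assumes "finite E" "E \<subseteq> carrier G" "E <#> m_inv G ` A \<subseteq> B" "finite B" "B \<subseteq> carrier G"
  shows "inj_perm G (m_inv G ` A) (inv_weight G h) E = inj_sum (\<lambda>t s. h (inv s \<otimes> t)) E B"
proof -
  interpret d: group_weight G "m_inv G ` A" "inv_weight G h" by (rule dual)
  have "inj_perm G (m_inv G ` A) (inv_weight G h) E = inj_sum (\<lambda>t s. inv_weight G h (inv t \<otimes> s)) E B"
    using assms by (intro d.inj_perm_target) auto
  also have "\<dots> = inj_sum (\<lambda>t s. h (inv s \<otimes> t)) E B"
  proof (intro inj_sum_cong)
    fix t s assume "t \<in> E" "s \<in> B"
    hence "t \<in> carrier G" "s \<in> carrier G" using assms by auto
    thus "inv_weight G h (inv t \<otimes> s) = h (inv s \<otimes> t)" by (simp add: inv_weight_def inv_mult_group)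
  qed
  finally show ?thesis .
qed

lemma inv_inv_image: "m_inv G ` m_inv G ` A = A"
  using A(3) by (auto simp: image_image cong: image_cong) (metis image_eqI inv_inv subsetD)

lemma inv_weight_inv_weight: "inv_weight G (inv_weight G h) = h"
  using h_supp A(3) by (auto simp: inv_weight_def fun_eq_iff)

lemma card_le_card_mult: "finite F \<Longrightarrow> F \<subseteq> carrier G \<Longrightarrow> card F \<le> card (F <#> A)"
proof -
  assume F: "finite F" "F \<subseteq> carrier G"
  obtain a where a: "a \<in> A" using A by auto
  have "card F = card ((\<lambda>s. s \<otimes> a) ` F)"
    using a A(3) F by (intro card_image[symmetric] inj_onI) (metis right_cancel subsetD)
  also have "\<dots> \<le> card (F <#> A)"
    using a F A by (intro card_mono) (auto simp: set_mult_def)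
  finally show ?thesis .
qed

text \<open>Splitting injections by their image \<open>E\<close> and reading them backwards gives
  sums for the reversed weight; the possible \<open>E\<close> are counted by their complements in
  \<open>F <#> A\<close>.\<close>

lemma inj_perm_le_dual:
  assumes F: "finite F" "F \<subseteq> carrier G"
    and le: "\<And>E. E \<subseteq> F <#> A \<Longrightarrow> card E = card F \<Longrightarrow> inj_perm G (m_inv G ` A) (inv_weight G h) E \<le> u"
  shows "inj_perm G A h F \<le> real (card {X. X \<subseteq> F <#> A \<and> card X \<le> card (F <#> A) - card F}) * u"
proof -
  define B where "B = F <#> A"
  have B: "finite B" "B \<subseteq> carrier G"
    using F A set_mult_closed by (auto simp: finite_set_mult B_def)
  have "inj_perm G (m_inv G ` A) (inv_weight G h) E \<ge> inj_sum (\<lambda>t s. h (inv s \<otimes> t)) E F"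
    if "E \<subseteq> B" for E
  proof -
    have E: "finite E" "E \<subseteq> carrier G" using that B finite_subset by auto
    let ?B' = "F \<union> (E <#> m_inv G ` A)"
    have Ai: "m_inv G ` A \<subseteq> carrier G" using A(3) by auto
    have B': "finite ?B'" "?B' \<subseteq> carrier G"
      using E F A set_mult_closed[OF E(2) Ai] by (auto simp: finite_set_mult)
    have "inj_sum (\<lambda>t s. h (inv s \<otimes> t)) E F \<le> inj_sum (\<lambda>t s. h (inv s \<otimes> t)) E ?B'"
      using E B' h_nonneg by (intro inj_sum_target_mono) auto
    also have "\<dots> = inj_perm G (m_inv G ` A) (inv_weight G h) E"
      using E B' by (intro inj_perm_dual[symmetric]) auto
    finally show ?thesis .
  qed
  note ge = this
  have le': "inj_sum (\<lambda>t s. h (inv s \<otimes> t)) E F \<le> u" if "E \<subseteq> B" "card E = card F" for E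
    using order_trans[OF ge[OF that(1)] le[OF that[unfolded B_def]]] .
  \<comment> \<open>Some \<open>E\<close> of the required size exists, so \<open>u\<close> bounds a
    nonnegative number; its sign is needed when the count is enlarged.\<close>
  obtain E where E: "E \<subseteq> B" "card E = card F"
    unfolding B_def by (rule obtain_subset_with_card_n[OF card_le_card_mult[OF F]])
  have "0 \<le> inj_sum (\<lambda>t s. h (inv s \<otimes> t)) E F" by (intro inj_sum_nonneg h_nonneg)
  hence u: "u \<ge> 0" using le'[OF E] by linarith
  have "inj_perm G A h F \<le> (\<Sum>E | E \<subseteq> B \<and> card E = card F. inj_sum (\<lambda>t s. h (inv s \<otimes> t)) E F)"
    unfolding inj_perm_def B_def[symmetric] using F B h_nonneg by (intro inj_sum_le_sum_transpose) auto
  also have "\<dots> \<le> (\<Sum>E | E \<subseteq> B \<and> card E = card F. u)" using le' by (intro sum_mono) auto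
  also have "\<dots> = real (card {E. E \<subseteq> B \<and> card E = card F}) * u" by simp
  also have "\<dots> \<le> real (card {X. X \<subseteq> B \<and> card X \<le> card B - card F}) * u"
    using card_complements[OF B(1)] u by (intro mult_right_mono) auto
  finally show ?thesis by (simp add: B_def)
qed

lemma folner_sets_bounds:
  assumes "F \<in> folner_sets G L \<delta>" "finite L" "K \<subseteq> L"
  shows "real (card ((F <#> K) - F)) \<le> \<delta> * card F" "real (card (F <#> K)) \<le> (1 + \<delta>) * card F"
proof -
  have F: "finite F" "real (card (sym_diff (F <#> L) F)) < \<delta> * card F"
    using assms by (auto simp: folner_sets_def fin_subsets_def)
  have fin: "finite (F <#> L)" "finite (F <#> K)"
    using assms F finite_subset[of K L] by (auto simp: finite_set_mult)
  have "card ((F <#> K) - F) \<le> card (sym_diff (F <#> L) F)"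
    using fin F mono_set_mult[OF subset_refl assms(3), of G F] by (intro card_mono) auto
  thus 1: "real (card ((F <#> K) - F)) \<le> \<delta> * card F" using F by linarith
  have "card (F <#> K) \<le> card ((F <#> K) - F) + card F"
    by (rule order_trans[OF card_mono[of "((F <#> K) - F) \<union> F"] card_Un_le]) (use F fin in auto)
  hence "real (card (F <#> K)) \<le> real (card ((F <#> K) - F)) + real (card F)"
    by (simp flip: of_nat_add)
  thus "real (card (F <#> K)) \<le> (1 + \<delta>) * card F" using 1 by (simp add: algebra_simps)
qed

text \<open>The images \<open>E\<close> lie in \<open>F <#> L\<close> and have the size of
  \<open>F\<close>, so by almost invariance they miss few points of \<open>F <#> K\<close>. The
  bound from the tile \<open>K\<close> thus applies to each \<open>E\<close>, and there are
  subexponentially many.\<close>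

lemma growth_le_dual:
  fixes c \<epsilon> :: real
  assumes am: "amenable G"
    and K: "K \<in> fin_subsets G" "inj_perm G (m_inv G ` A) (inv_weight G h) K < exp (c * card K)"
    and \<epsilon>: "\<epsilon> > 0"
  obtains F where "F \<in> fin_subsets G" "inj_perm G A h F < exp ((c + \<epsilon>) * card F)"
proof -
  interpret d: group_weight G "m_inv G ` A" "inv_weight G h" by (rule dual)
  have K': "finite K" "K \<noteq> {}" "K \<subseteq> carrier G" using K(1) by (auto simp: fin_subsets_def)
  obtain \<delta> :: real where \<delta>: "\<delta> > 0"
    "\<And>F D. finite F \<Longrightarrow> finite D \<Longrightarrow> F \<subseteq> carrier G \<Longrightarrow> D \<subseteq> carrier G \<Longrightarrow>
      real (card ((F <#> K) - D)) \<le> \<delta> * card F \<Longrightarrow>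
      inj_perm G (m_inv G ` A) (inv_weight G h) D \<le> exp (c * card F)"
    using d.inj_perm_upper[OF K' K(2)] by blast
  have "\<epsilon> / 4 > 0" using \<epsilon> by simp
  then obtain \<eta> :: real where \<eta>: "\<eta> > 0" "\<And>(B :: 'a set) m n. finite B \<Longrightarrow> card B \<le> n \<Longrightarrow> real m \<le> \<eta> * n \<Longrightarrow>
    real (card {X. X \<subseteq> B \<and> card X \<le> m}) \<le> exp (\<epsilon> / 4 * n)"
    using card_small_subsets_le[where 'a = 'a] by blast
  define \<gamma> where "\<gamma> = min 1 (min \<delta> \<eta>)"
  have \<gamma>: "\<gamma> > 0" "\<gamma> \<le> 1" "\<gamma> \<le> \<delta>" "\<gamma> \<le> \<eta>" using \<delta> \<eta> by (auto simp: \<gamma>_def)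
  \<comment> \<open>Invariance under \<open>K\<close> serves the tiles, invariance under
    \<open>A\<close> keeps the number of images small.\<close>
  define L where "L = K \<union> A"
  have L: "L \<in> fin_subsets G" using K' A by (auto simp: L_def fin_subsets_def)
  obtain F where FL: "F \<in> folner_sets G L \<gamma>" using am L \<gamma> unfolding amenable_def by blast
  hence F: "finite F" "F \<noteq> {}" "F \<subseteq> carrier G" by (auto simp: folner_sets_def fin_subsets_def)
  have finL: "finite L" using L by (simp add: fin_subsets_def)
  have finFL: "finite (F <#> L)" using F finL by (simp add: finite_set_mult)
  let ?B = "F <#> A"
  have B: "finite ?B" "?B \<subseteq> F <#> L" "card F \<le> card ?B"
    using F A card_le_card_mult mono_set_mult[OF subset_refl[of F], of A L G]
    by (auto simp: finite_set_mult L_def)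
  have cB: "real (card ?B) \<le> 2 * card F" "real (card ?B - card F) \<le> \<eta> * card ?B"
  proof -
    have *: "real (card ?B) \<le> (1 + \<gamma>) * card F"
      using folner_sets_bounds(2)[OF FL finL, of A] by (simp add: L_def)
    also have "\<dots> \<le> 2 * real (card F)" using \<gamma> by (intro mult_right_mono) auto
    finally show "real (card ?B) \<le> 2 * card F" by simp
    have "real (card ?B - card F) = real (card ?B) - real (card F)" using B by simp
    also have "\<dots> \<le> \<gamma> * card F" using * by (simp add: algebra_simps)
    also have "\<dots> \<le> \<eta> * card ?B" using \<gamma> B by (intro mult_mono) auto
    finally show "real (card ?B - card F) \<le> \<eta> * card ?B" .
  qed
  have "inj_perm G A h F \<le> real (card {X. X \<subseteq> ?B \<and> card X \<le> card ?B - card F}) * exp (c * card F)"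
  proof (rule inj_perm_le_dual[OF F(1,3)])
    fix E assume E: "E \<subseteq> ?B" "card E = card F"
    have finE: "finite E" using E B finite_subset by blast
    have EL: "E \<subseteq> F <#> L" using E B by blast
    have sub: "F <#> L \<subseteq> carrier G" using F L set_mult_closed by (auto simp: fin_subsets_def)
    have "card ((F <#> K) - E) \<le> card ((F <#> L) - E)"
      using finFL by (intro card_mono) (auto simp: L_def set_mult_def)
    also have "\<dots> = card (F <#> L) - card F" using EL finE E by (simp add: card_Diff_subset)
    finally have "real (card ((F <#> K) - E)) \<le> real (card (F <#> L) - card F)" by simp
    also have "\<dots> \<le> \<gamma> * card F"
    proof -
      have "real (card (F <#> L)) \<le> (1 + \<gamma>) * card F" using folner_sets_bounds(2)[OF FL finL, of L] by simp
      moreover have "card F \<le> card (F <#> L)" using card_mono[OF finFL EL] E by simp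
      ultimately show ?thesis by (simp add: algebra_simps)
    qed
    also have "\<dots> \<le> \<delta> * card F" using \<gamma> by (intro mult_right_mono) auto
    finally show "inj_perm G (m_inv G ` A) (inv_weight G h) E \<le> exp (c * card F)"
      using F finE EL sub by (intro \<delta>(2)) auto
  qed
  \<comment> \<open>The count is exponential in \<open>card ?B\<close>, which is at most twice
    \<open>card F\<close>; hence the quarter.\<close>
  also have "\<dots> \<le> exp (\<epsilon> / 4 * card ?B) * exp (c * card F)"
    using \<eta>(2)[OF B(1) order_refl cB(2)] by (intro mult_right_mono) auto
  also have "\<dots> \<le> exp (\<epsilon> / 2 * card F) * exp (c * card F)"
    using cB(1) \<epsilon> by (intro mult_right_mono) (auto simp: field_simps)
  also have "\<dots> = exp ((c + \<epsilon> / 2) * card F)" by (simp add: exp_add[symmetric] algebra_simps)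
  also have "\<dots> < exp ((c + \<epsilon>) * card F)" using \<epsilon> F by (simp add: card_gt_0_iff)
  finally show ?thesis using that F by (auto simp: fin_subsets_def)
qed

text \<open>The substitution \<open>\<phi> s = s \<otimes> x s\<close>. Maps with some
  \<open>inv s \<otimes> \<phi> s\<close> outside \<open>A\<close> may be added because
  \<open>h\<close> vanishes there, which gives all points of \<open>F\<close> the same
  target.\<close>

lemma local_permanent_eq:
  assumes F: "finite F" "F \<subseteq> carrier G"
  defines "T \<equiv> {s \<in> carrier G. s <# (set_inv A) \<subseteq> F}"
  shows "local_permanent G h A F =
    (\<Sum>\<phi> | \<phi> \<in> F \<rightarrow>\<^sub>E F <#> A \<and> inj_on \<phi> F \<and> T \<subseteq> \<phi> ` F. \<Prod>s\<in>F. h (inv s \<otimes> \<phi> s))"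
proof -
  let ?B = "F <#> A"
  let ?Z = "{\<phi>. \<phi> \<in> F \<rightarrow>\<^sub>E ?B \<and> inj_on \<phi> F \<and> T \<subseteq> \<phi> ` F}"
  let ?Z' = "{\<phi> \<in> ?Z. \<forall>s\<in>F. inv s \<otimes> \<phi> s \<in> A}"
  let ?p = "\<lambda>x. restrict (perm_map G x) F"
  let ?q = "\<lambda>\<phi>. \<lambda>s\<in>F. inv s \<otimes> \<phi> s"
  have B: "finite ?B" "?B \<subseteq> carrier G" using F A set_mult_closed by (auto simp: finite_set_mult)
  have "local_permanent G h A F = (\<Sum>\<phi>\<in>?Z'. \<Prod>s\<in>F. h (inv s \<otimes> \<phi> s))"
    unfolding local_permanent_def
  proof (rule sum.reindex_bij_witness[of _ ?q ?p])
    fix x assume "x \<in> local_perms G A F"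
    hence x: "x \<in> F \<rightarrow>\<^sub>E A" "inj_on (perm_map G x) F" "T \<subseteq> perm_map G x ` F"
      by (auto simp: local_perms_def T_def)
    have q: "inv s \<otimes> perm_map G x s = x s" if "s \<in> F" for s
    proof -
      have "s \<in> carrier G" "x s \<in> carrier G" using x that F A(3) by auto
      thus ?thesis by (simp add: perm_map_def flip: m_assoc)
    qed
    show "?q (?p x) = x" using x(1) by (intro ext) (auto simp: q PiE_iff extensional_def)
    have "perm_map G x s \<in> ?B" if "s \<in> F" for s
      using that PiE_mem[OF x(1) that] unfolding perm_map_def set_mult_def by blast
    hence "?p x \<in> F \<rightarrow>\<^sub>E ?B" by simp
    moreover have "inj_on (?p x) F" "?p x ` F = perm_map G x ` F"
      using x(2) by (simp_all add: inj_on_def)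
    moreover have "inv s \<otimes> ?p x s \<in> A" if "s \<in> F" for s using that x(1) by (auto simp: q)
    ultimately show "?p x \<in> ?Z'" using x(3) by simp
    show "(\<Prod>s\<in>F. h (inv s \<otimes> ?p x s)) = (\<Prod>s\<in>F. h (x s))" by (simp add: q cong: prod.cong)
  next
    fix \<phi> assume "\<phi> \<in> ?Z'"
    hence \<phi>: "\<phi> \<in> F \<rightarrow>\<^sub>E ?B" "inj_on \<phi> F" "T \<subseteq> \<phi> ` F" "\<And>s. s \<in> F \<Longrightarrow> inv s \<otimes> \<phi> s \<in> A" by auto
    have p: "perm_map G (?q \<phi>) s = \<phi> s" if "s \<in> F" for s
    proof -
      have "s \<in> carrier G" "\<phi> s \<in> carrier G" using \<phi>(1) that F B by auto
      thus ?thesis using that by (simp add: perm_map_def flip: m_assoc)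
    qed
    show "?p (?q \<phi>) = \<phi>" using \<phi>(1) by (intro ext) (auto simp: p PiE_iff extensional_def)
    have "inj_on (perm_map G (?q \<phi>)) F" using \<phi>(2) by (simp add: p cong: inj_on_cong)
    moreover have "perm_map G (?q \<phi>) ` F = \<phi> ` F" by (intro image_cong) (auto simp: p)
    moreover have "?q \<phi> \<in> F \<rightarrow>\<^sub>E A" using \<phi> by auto
    ultimately show "?q \<phi> \<in> local_perms G A F"
      using \<phi>(3) by (simp add: local_perms_def T_def)
  qed
  also have "\<dots> = (\<Sum>\<phi>\<in>?Z. \<Prod>s\<in>F. h (inv s \<otimes> \<phi> s))"
  proof (rule sum.mono_neutral_left)
    show "finite ?Z" using F B
      by (intro finite_subset[OF _ finite_injections[of F ?B]]) auto
    show "\<forall>\<phi>\<in>?Z - ?Z'. (\<Prod>s\<in>F. h (inv s \<otimes> \<phi> s)) = 0"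
    proof
      fix \<phi> assume "\<phi> \<in> ?Z - ?Z'"
      then obtain s where "s \<in> F" "inv s \<otimes> \<phi> s \<notin> A" by auto
      thus "(\<Prod>s\<in>F. h (inv s \<otimes> \<phi> s)) = 0" using F h_supp by (intro prod_zero) auto
    qed
  qed auto
  finally show ?thesis .
qed

lemma local_permanent_nonneg: "local_permanent G h A F \<ge> 0"
  unfolding local_permanent_def by (intro sum_nonneg prod_nonneg h_nonneg)

lemma local_permanent_le_inj_perm:
  assumes F: "finite F" "F \<subseteq> carrier G"
  shows "local_permanent G h A F \<le> inj_perm G A h F"
  unfolding local_permanent_eq[OF F] inj_perm_def inj_sum_def
proof (rule sum_mono2)
  show "finite {\<phi>. \<phi> \<in> F \<rightarrow>\<^sub>E F <#> A \<and> inj_on \<phi> F}"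
    using F A by (intro finite_injections) (auto simp: finite_set_mult)
qed (auto intro!: prod_nonneg h_nonneg)

text \<open>A point of \<open>F\<close> whose translates by inverses of \<open>A\<close> all stay in
  \<open>F\<close> is interior, so only a boundary is lost. \<open>T\<close> need not lie in
  \<open>F\<close>; its size is controlled by the injection
  \<open>s \<mapsto> s \<otimes> inv a0\<close> into \<open>F\<close>.\<close>

lemma interior_bounds:
  assumes F: "finite F" "F \<subseteq> carrier G"
  defines "T \<equiv> {s \<in> carrier G. s <# (set_inv A) \<subseteq> F}"
  shows "finite T" "card T \<le> card F" "card F \<le> card T + card A * card ((F <#> m_inv G ` A) - F)"
proof -
  have T: "s \<in> T \<longleftrightarrow> s \<in> carrier G \<and> (\<forall>a\<in>A. s \<otimes> inv a \<in> F)" for s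
    by (auto simp: T_def l_coset_def SET_INV_def)
  obtain a0 where a0: "a0 \<in> A" "a0 \<in> carrier G" using A by auto
  have inj: "inj_on (\<lambda>s. s \<otimes> inv a0) T" using T a0 by (auto intro!: inj_onI)
  have im: "(\<lambda>s. s \<otimes> inv a0) ` T \<subseteq> F" using T a0 by auto
  show finT: "finite T" using inj im F(1) by (meson finite_imageD finite_subset)
  show "card T \<le> card F" using card_inj_on_le[OF inj im F(1)] .
  have Ai: "m_inv G ` A \<subseteq> carrier G" "finite (m_inv G ` A)" using A by auto
  have cA: "card (m_inv G ` A) \<le> card A" using A by (intro card_image_le) auto
  have "card F \<le> card {g \<in> F. \<forall>\<kappa>\<in>m_inv G ` A. g \<otimes> \<kappa> \<in> F} + card (m_inv G ` A) * card ((F <#> m_inv G ` A) - F)"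
    using F Ai by (intro card_le_card_tiles) auto
  also have "\<dots> \<le> card T + card A * card ((F <#> m_inv G ` A) - F)"
  proof (intro add_mono mult_le_mono1 cA)
    have "{g \<in> F. \<forall>\<kappa>\<in>m_inv G ` A. g \<otimes> \<kappa> \<in> F} \<subseteq> T" using F T by auto
    thus "card {g \<in> F. \<forall>\<kappa>\<in>m_inv G ` A. g \<otimes> \<kappa> \<in> F} \<le> card T" by (rule card_mono[OF finT])
  qed
  finally show "card F \<le> card T + card A * card ((F <#> m_inv G ` A) - F)" .
qed

text \<open>Injections from \<open>T\<close> of nonzero reversed weight land in \<open>F\<close>,
  since \<open>T\<close> multiplied by inverses of \<open>A\<close> stays in \<open>F\<close>. This
  makes them exchange partners for the injections out of \<open>F\<close>. The second matchings that
  remain live on subsets \<open>D\<close> of \<open>F\<close> of size \<open>card T\<close> and are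
  bounded by \<open>u\<close>.\<close>

lemma inj_perm_mult_le:
  assumes F: "finite F" "F \<subseteq> carrier G"
  defines "T \<equiv> {s \<in> carrier G. s <# (set_inv A) \<subseteq> F}"
  assumes u: "\<And>D. D \<subseteq> F \<Longrightarrow> card D = card T \<Longrightarrow> inj_perm G A h D \<le> u" "u \<ge> 0"
  shows "inj_perm G A h F * inj_perm G (m_inv G ` A) (inv_weight G h) T \<le>
    real (card {X. X \<subseteq> T \<and> card X \<le> card (F <#> A) - card F}) * local_permanent G h A F *
    (real (card {X. X \<subseteq> F \<and> card X \<le> card F - card T}) * u)"
proof -
  have T: "s \<in> T \<longleftrightarrow> s \<in> carrier G \<and> (\<forall>a\<in>A. s \<otimes> inv a \<in> F)" for s
    by (auto simp: T_def l_coset_def SET_INV_def)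
  note finT = interior_bounds(1)[OF F, folded T_def]
  obtain a0 where a0: "a0 \<in> A" "a0 \<in> carrier G" using A by auto
  let ?B = "F <#> A"
  let ?W = "\<lambda>s t. h (inv s \<otimes> t)"
  have B: "finite ?B" "?B \<subseteq> carrier G" using F A set_mult_closed by (auto simp: finite_set_mult)
  have TB: "T \<subseteq> ?B"
  proof
    fix t assume t: "t \<in> T"
    hence "t = (t \<otimes> inv a0) \<otimes> a0" using a0 T by (simp add: m_assoc)
    thus "t \<in> ?B" using t T a0 by (auto simp: set_mult_def)
  qed
  have "inj_perm G A h F * inj_perm G (m_inv G ` A) (inv_weight G h) T = inj_sum ?W F ?B * inj_sum (\<lambda>t s. ?W s t) T F"
  proof -
    have "T <#> m_inv G ` A \<subseteq> F" using T by (auto simp: set_mult_def)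
    hence "inj_perm G (m_inv G ` A) (inv_weight G h) T = inj_sum (\<lambda>t s. ?W s t) T F"
      using F finT T by (intro inj_perm_dual) auto
    thus ?thesis by (simp add: inj_perm_def)
  qed
  also have "\<dots> \<le> real (card {X. X \<subseteq> T \<and> card X \<le> card ?B - card F}) * local_permanent G h A F *
      (\<Sum>D | D \<subseteq> F \<and> card D = card T. inj_sum ?W D ?B)"
    unfolding local_permanent_eq[OF F] T_def[symmetric]
    using F B TB h_nonneg by (intro inj_sum_mult_le_covering) auto
  also have "\<dots> \<le> real (card {X. X \<subseteq> T \<and> card X \<le> card ?B - card F}) * local_permanent G h A F *
      (real (card {X. X \<subseteq> F \<and> card X \<le> card F - card T}) * u)"
  proof (intro mult_left_mono mult_nonneg_nonneg local_permanent_nonneg)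
    have "(\<Sum>D | D \<subseteq> F \<and> card D = card T. inj_sum ?W D ?B) \<le> (\<Sum>D | D \<subseteq> F \<and> card D = card T. u)"
    proof (rule sum_mono)
      fix D assume "D \<in> {D. D \<subseteq> F \<and> card D = card T}"
      hence D: "D \<subseteq> F" "card D = card T" by auto
      have "inj_sum ?W D ?B = inj_perm G A h D"
        using D F B finite_subset[OF D(1) F(1)] by (intro inj_perm_target[symmetric] mono_set_mult) auto
      thus "inj_sum ?W D ?B \<le> u" using u(1)[OF D] by simp
    qed
    also have "\<dots> = real (card {D. D \<subseteq> F \<and> card D = card T}) * u" by simp
    also have "\<dots> \<le> real (card {X. X \<subseteq> F \<and> card X \<le> card F - card T}) * u"
      using card_complements[OF F(1)] u(2) by (intro mult_right_mono) auto
    finally show "(\<Sum>D | D \<subseteq> F \<and> card D = card T. inj_sum ?W D ?B) \<le>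
      real (card {X. X \<subseteq> F \<and> card X \<le> card F - card T}) * u" .
  qed simp
  finally show "inj_perm G A h F * inj_perm G (m_inv G ` A) (inv_weight G h) T \<le>
    real (card {X. X \<subseteq> T \<and> card X \<le> card (F <#> A) - card F}) * local_permanent G h A F *
    (real (card {X. X \<subseteq> F \<and> card X \<le> card F - card T}) * u)" .
qed

end

lemma ereal_log_divide_less_iff:
  assumes "n > 0" shows "ereal_log x / ereal n < ereal c \<longleftrightarrow> x < exp (c * n)"
proof (cases "x \<le> 0")
  case True
  hence "x < exp (c * n)" using exp_gt_zero[of "c * n"] by linarith
  thus ?thesis using True assms by (simp add: ereal_log_def)
next
  case False
  hence "ereal_log x / ereal n < ereal c \<longleftrightarrow> ln x < c * n"
    using assms by (simp add: ereal_log_def field_simps)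
  also have "\<dots> \<longleftrightarrow> exp (ln x) < exp (c * n)" by simp
  finally show ?thesis using False by simp
qed

lemma less_ereal_log_divide_iff:
  assumes "n > 0" shows "ereal c < ereal_log x / ereal n \<longleftrightarrow> exp (c * n) < x"
proof (cases "x \<le> 0")
  case True
  hence "\<not> exp (c * n) < x" using exp_gt_zero[of "c * n"] by linarith
  thus ?thesis using True assms by (simp add: ereal_log_def)
next
  case False
  hence "ereal c < ereal_log x / ereal n \<longleftrightarrow> c * n < ln x"
    using assms by (simp add: ereal_log_def field_simps)
  also have "\<dots> \<longleftrightarrow> exp (c * n) < exp (ln x)" by simp
  finally show ?thesis using False by simp
qed

section \<open>The growth rate as a limit\<close>

context group_weight
begin

text \<open>An infimum, so that it bounds the sum of every single \<open>K\<close> from below;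
  convergence to it is a consequence of Shearer's inequality and the exchange. It is
  \<open>- \<infinity>\<close> as soon as one sum vanishes.\<close>

definition growth :: ereal
  where "growth = (INF K\<in>fin_subsets G. ereal_log (inj_perm G A h K) / ereal (real (card K)))"

lemma growth_less_iff:
  "growth < ereal c \<longleftrightarrow> (\<exists>K\<in>fin_subsets G. inj_perm G A h K < exp (c * card K))"
proof -
  have "growth < ereal c \<longleftrightarrow>
      (\<exists>K\<in>fin_subsets G. ereal_log (inj_perm G A h K) / ereal (real (card K)) < ereal c)"
    by (simp add: growth_def INF_less_iff)
  also have "\<dots> \<longleftrightarrow> (\<exists>K\<in>fin_subsets G. inj_perm G A h K < exp (c * card K))"
    by (intro bex_cong refl ereal_log_divide_less_iff) (auto simp: fin_subsets_def card_gt_0_iff)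
  finally show ?thesis .
qed

lemma growth_le_0: "growth \<le> 0"
proof -
  have 1: "{\<one>} \<in> fin_subsets G" by (simp add: fin_subsets_def)
  have "ereal_log (inj_perm G A h {\<one>}) / ereal 1 \<le> 0"
    using inj_perm_le_1[of "{\<one>}"] by (simp add: ereal_log_def zero_ereal_def)
  thus ?thesis unfolding growth_def by (intro INF_lower2[OF 1]) simp
qed

lemma growth_dual_le:
  assumes "amenable G"
  shows "growth \<le> group_weight.growth G (m_inv G ` A) (inv_weight G h)"
proof -
  interpret d: group_weight G "m_inv G ` A" "inv_weight G h" by (rule dual)
  show ?thesis
  proof (rule ccontr)
    assume "\<not> growth \<le> d.growth"
    hence "d.growth < growth" by simp
    then obtain c where c: "d.growth < ereal c" "ereal c < growth" using ereal_dense2 by blast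
    obtain c' where c': "ereal c < ereal c'" "ereal c' < growth" using c(2) ereal_dense2 by blast
    obtain K where K: "K \<in> fin_subsets G"
      "inj_perm G (m_inv G ` A) (inv_weight G h) K < exp (c * card K)"
      using c(1) d.growth_less_iff by blast
    obtain F where "F \<in> fin_subsets G" "inj_perm G A h F < exp ((c + (c' - c)) * card F)"
      using growth_le_dual[OF assms K, of "c' - c"] c' by auto
    hence "growth < ereal c'" unfolding growth_less_iff by auto
    thus False using c' by simp
  qed
qed

text \<open>Reversal is an involution, so the inequality for the reversed weight is the
  converse.\<close>

lemma growth_dual:
  assumes "amenable G"
  shows "group_weight.growth G (m_inv G ` A) (inv_weight G h) = growth"
proof -
  interpret d: group_weight G "m_inv G ` A" "inv_weight G h" by (rule dual)
  show ?thesis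
    using growth_dual_le[OF assms] d.growth_dual_le[OF assms]
    by (simp add: inv_inv_image inv_weight_inv_weight)
qed

lemma eventually_local_permanent_less:
  assumes "growth < ereal c"
  shows "\<forall>\<^sub>F F in folner_filter G. local_permanent G h A F < exp (c * card F)"
proof -
  obtain c' where c': "growth < ereal c'" "ereal c' < ereal c" using assms ereal_dense2 by blast
  obtain K where K: "K \<in> fin_subsets G" "inj_perm G A h K < exp (c' * card K)"
    using c'(1) growth_less_iff by blast
  have K': "finite K" "K \<noteq> {}" "K \<subseteq> carrier G" using K(1) by (auto simp: fin_subsets_def)
  obtain \<delta> :: real where \<delta>: "\<delta> > 0"
    "\<And>F D. finite F \<Longrightarrow> finite D \<Longrightarrow> F \<subseteq> carrier G \<Longrightarrow> D \<subseteq> carrier G \<Longrightarrow>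
      real (card ((F <#> K) - D)) \<le> \<delta> * card F \<Longrightarrow> inj_perm G A h D \<le> exp (c' * card F)"
    using inj_perm_upper[OF K' K(2)] by blast
  have "local_permanent G h A F < exp (c * card F)" if F: "F \<in> folner_sets G K \<delta>" for F
  proof -
    have F': "finite F" "F \<noteq> {}" "F \<subseteq> carrier G" using F by (auto simp: folner_sets_def fin_subsets_def)
    have "local_permanent G h A F \<le> inj_perm G A h F" using F' by (intro local_permanent_le_inj_perm)
    also have "\<dots> \<le> exp (c' * card F)"
      using F' folner_sets_bounds(1)[OF F K'(1) subset_refl] by (intro \<delta>(2)) auto
    also have "\<dots> < exp (c * card F)" using c' F' by (simp add: card_gt_0_iff)
    finally show ?thesis .
  qed
  thus ?thesis using K(1) \<delta>(1) by (auto simp: eventually_folner_filter)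
qed

text \<open>The product of the two sums is at least about \<open>exp (2 * r * n)\<close>, while the
  second matchings account for at most about \<open>exp (r * n)\<close> and the counts are
  subexponential; the local permanent has to supply the remaining
  \<open>exp (r * n)\<close>.\<close>

lemma eventually_local_permanent_greater:
  assumes am: "amenable G" and c: "ereal c < growth"
  shows "\<forall>\<^sub>F F in folner_filter G. exp (c * card F) < local_permanent G h A F"
proof -
  interpret d: group_weight G "m_inv G ` A" "inv_weight G h" by (rule dual)
  obtain r where r: "growth = ereal r"
    using c growth_le_0 by (cases growth) auto
  have "r \<le> 0" "c < r" using r c growth_le_0 by (auto simp: zero_ereal_def)
  \<comment> \<open>Four of the five parts are lost: one in the bound for \<open>T\<close>, one in
    \<open>u\<close>, two in the counts. The fifth makes the result strict.\<close>
  define \<epsilon> where "\<epsilon> = (r - c) / 5"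
  have \<epsilon>: "\<epsilon> > 0" "c = r - 5 * \<epsilon>" using \<open>c < r\<close> by (simp_all add: \<epsilon>_def diff_divide_distrib)
  have J_ge: "exp (r * card K) \<le> inj_perm G A h K" if "K \<in> fin_subsets G" for K
    using that growth_less_iff[of r] r by fastforce
  \<comment> \<open>The set \<open>T\<close> to which this is applied may be empty, so the empty set
    is included.\<close>
  have J'_ge: "exp ((r - \<epsilon>) * card K) \<le> inj_perm G (m_inv G ` A) (inv_weight G h) K"
    if "finite K" "K \<subseteq> carrier G" for K
  proof (cases "K = {}")
    case True
    thus ?thesis by (simp add: inj_perm_def)
  next
    case False
    hence K: "K \<in> fin_subsets G" using that by (simp add: fin_subsets_def)
    have "\<not> d.growth < ereal (r - \<epsilon>)" unfolding growth_dual[OF am] r using \<epsilon> by simp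
    thus ?thesis using K unfolding d.growth_less_iff by (meson not_le)
  qed
  have "growth < ereal (r + \<epsilon>)" using r \<epsilon> by simp
  then obtain K where K: "K \<in> fin_subsets G" "inj_perm G A h K < exp ((r + \<epsilon>) * card K)"
    using growth_less_iff by blast
  have K': "finite K" "K \<noteq> {}" "K \<subseteq> carrier G" using K(1) by (auto simp: fin_subsets_def)
  obtain \<delta> :: real where \<delta>: "\<delta> > 0"
    "\<And>F D. finite F \<Longrightarrow> finite D \<Longrightarrow> F \<subseteq> carrier G \<Longrightarrow> D \<subseteq> carrier G \<Longrightarrow>
      real (card ((F <#> K) - D)) \<le> \<delta> * card F \<Longrightarrow> inj_perm G A h D \<le> exp ((r + \<epsilon>) * card F)"
    using inj_perm_upper[OF K' K(2)] by blast
  obtain \<eta> :: real where \<eta>: "\<eta> > 0" "\<And>(B :: 'a set) m n. finite B \<Longrightarrow> card B \<le> n \<Longrightarrow> real m \<le> \<eta> * n \<Longrightarrow>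
    real (card {X. X \<subseteq> B \<and> card X \<le> m}) \<le> exp (\<epsilon> * n)"
    using card_small_subsets_le[where 'a = 'a] \<epsilon> by blast
  \<comment> \<open>Subsets \<open>D\<close> of size \<open>card T\<close> lose up to
    \<open>card A * \<gamma> * n\<close> points of \<open>F\<close> on top of the
    \<open>\<gamma> * n\<close> lost at the boundary; hence the denominator.\<close>
  define \<gamma> where "\<gamma> = min \<delta> \<eta> / (1 + card A)"
  have \<gamma>: "\<gamma> > 0" "(1 + card A) * \<gamma> \<le> \<delta>" "(1 + card A) * \<gamma> \<le> \<eta>" using \<delta> \<eta> by (auto simp: \<gamma>_def)
  define L where "L = K \<union> A \<union> m_inv G ` A"
  have L: "L \<in> fin_subsets G" using K' A by (auto simp: L_def fin_subsets_def)
  have finL: "finite L" using L by (simp add: fin_subsets_def)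
  have "exp (c * card F) < local_permanent G h A F" if FL: "F \<in> folner_sets G L \<gamma>" for F
  proof -
    have F: "finite F" "F \<noteq> {}" "F \<subseteq> carrier G" using FL by (auto simp: folner_sets_def fin_subsets_def)
    define n where "n = card F"
    have n: "n > 0" using F by (simp add: n_def card_gt_0_iff)
    define T where "T = {s \<in> carrier G. s <# (set_inv A) \<subseteq> F}"
    define u where "u = exp ((r + \<epsilon>) * n)"
    have b: "real (card ((F <#> K) - F)) \<le> \<gamma> * n" "real (card ((F <#> m_inv G ` A) - F)) \<le> \<gamma> * n"
      "real (card (F <#> A)) \<le> (1 + \<gamma>) * n"
      unfolding n_def by (rule folner_sets_bounds[OF FL finL]; auto simp: L_def)+
    note T = interior_bounds[OF F(1,3), folded T_def]
    have "0 \<le> \<gamma> * n" "0 \<le> card A * (\<gamma> * n)" using \<gamma> by auto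
    have "real n \<le> real (card T + card A * card ((F <#> m_inv G ` A) - F))"
      using T(3) unfolding of_nat_le_iff n_def .
    also have "\<dots> \<le> real (card T) + card A * (\<gamma> * n)"
      using b(2) by (simp add: mult_left_mono)
    finally have nT: "real (n - card T) \<le> card A * (\<gamma> * n)"
      using T(2) by (simp add: n_def)
    have up: "inj_perm G A h D \<le> u" if D: "D \<subseteq> F" "card D = card T" for D
      unfolding u_def n_def
    proof (rule \<delta>(2))
      have fin: "finite D" using D F finite_subset by blast
      have "card ((F <#> K) - D) \<le> card (((F <#> K) - F) \<union> (F - D))"
        using F K' fin by (intro card_mono) (auto simp: finite_set_mult)
      also have "\<dots> \<le> card ((F <#> K) - F) + card (F - D)" by (rule card_Un_le)
      also have "card (F - D) = n - card T" using D fin by (simp add: card_Diff_subset n_def)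
      finally have "real (card ((F <#> K) - D)) \<le> real (card ((F <#> K) - F)) + real (n - card T)"
        by (simp flip: of_nat_add)
      also have "\<dots> \<le> \<gamma> * n + card A * (\<gamma> * n)" using b(1) nT by linarith
      also have "\<dots> = ((1 + card A) * \<gamma>) * n" by (simp add: algebra_simps)
      also have "\<dots> \<le> \<delta> * n" using \<gamma> by (intro mult_right_mono) auto
      finally show "real (card ((F <#> K) - D)) \<le> \<delta> * card F" by (simp add: n_def)
    qed (use D F finite_subset in auto)
    let ?N1 = "real (card {X. X \<subseteq> T \<and> card X \<le> card (F <#> A) - card F})"
    let ?N2 = "real (card {X. X \<subseteq> F \<and> card X \<le> card F - card T})"
    have \<gamma>\<eta>: "\<gamma> * n \<le> \<eta> * n" "card A * (\<gamma> * n) \<le> \<eta> * n"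
    proof -
      have "((1 + card A) * \<gamma>) * n \<le> \<eta> * n" using \<gamma> by (intro mult_right_mono) auto
      thus "\<gamma> * n \<le> \<eta> * n" "card A * (\<gamma> * n) \<le> \<eta> * n"
        using \<open>0 \<le> \<gamma> * n\<close> \<open>0 \<le> card A * (\<gamma> * n)\<close> by (auto simp: algebra_simps)
    qed
    have N1: "?N1 \<le> exp (\<epsilon> * n)"
    proof (rule \<eta>(2))
      have "real (card (F <#> A) - card F) = real (card (F <#> A)) - n"
        using card_le_card_mult[OF F(1,3)] by (simp add: n_def)
      also have "\<dots> \<le> \<gamma> * n" using b(3) by (simp add: algebra_simps)
      finally show "real (card (F <#> A) - card F) \<le> \<eta> * n" using \<gamma>\<eta> by linarith
    qed (use T in \<open>auto simp: n_def\<close>)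
    have N2: "?N2 \<le> exp (\<epsilon> * n)"
    proof (rule \<eta>(2))
      show "real (card F - card T) \<le> \<eta> * n" using nT \<gamma>\<eta> by (simp add: n_def)
    qed (use F in \<open>auto simp: n_def\<close>)
    define Z where "Z = local_permanent G h A F"
    have Z: "Z \<ge> 0" by (simp add: Z_def local_permanent_nonneg)
    \<comment> \<open>The rate is nonpositive, so replacing \<open>card T\<close> by the larger
      \<open>n\<close> only lowers the exponent.\<close>
    have "(r - \<epsilon>) * n \<le> (r - \<epsilon>) * card T"
      using \<open>r \<le> 0\<close> \<epsilon> T(2) by (intro mult_left_mono_neg) (auto simp: n_def)
    hence "exp (r * n) * exp ((r - \<epsilon>) * n) \<le> exp (r * n) * exp ((r - \<epsilon>) * card T)" by simp
    also have "\<dots> \<le> inj_perm G A h F * inj_perm G (m_inv G ` A) (inv_weight G h) T"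
      using J_ge[of F] J'_ge[of T] T F inj_perm_nonneg unfolding n_def
      by (intro mult_mono) (auto simp: fin_subsets_def T_def)
    also have "\<dots> \<le> ?N1 * Z * (?N2 * u)"
      using inj_perm_mult_le[OF F(1,3), folded T_def, OF up] by (simp add: u_def Z_def)
    also have "\<dots> \<le> exp (\<epsilon> * n) * Z * (exp (\<epsilon> * n) * u)"
      using N1 N2 Z by (intro mult_mono mult_nonneg_nonneg) (auto simp: u_def)
    also have "\<dots> = exp ((r + 3 * \<epsilon>) * n) * Z"
      by (simp add: u_def exp_add[symmetric] algebra_simps)
    finally have "exp (r * n) * exp ((r - \<epsilon>) * n) \<le> exp ((r + 3 * \<epsilon>) * n) * Z" .
    also have "exp (r * n) * exp ((r - \<epsilon>) * n) = exp ((r + 3 * \<epsilon>) * n) * exp ((r - 4 * \<epsilon>) * n)"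
      by (simp add: exp_add[symmetric] algebra_simps)
    finally have "exp ((r - 4 * \<epsilon>) * n) \<le> Z" by simp
    moreover have "exp (c * n) < exp ((r - 4 * \<epsilon>) * n)" using \<epsilon> n by simp
    ultimately have "exp (c * n) < Z" by linarith
    thus ?thesis by (simp add: Z_def n_def)
  qed
  thus ?thesis using L \<gamma>(1) by (auto simp: eventually_folner_filter)
qed

lemma eventually_folner_card: "\<forall>\<^sub>F F in folner_filter G. card F > 0"
proof -
  have "\<exists>\<delta>>0. \<forall>F\<in>folner_sets G {\<one>} \<delta>. card F > 0"
    by (intro exI[of _ "1::real"]) (simp add: folner_sets_def fin_subsets_def card_gt_0_iff)
  moreover have "{\<one>} \<in> fin_subsets G" by (simp add: fin_subsets_def)
  ultimately show ?thesis unfolding eventually_folner_filter by (rule bexI)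
qed

lemma tendsto_growth:
  assumes "amenable G"
  shows "((\<lambda>F. ereal_log (local_permanent G h A F) / ereal (real (card F))) \<longlongrightarrow> growth) (folner_filter G)"
proof (rule order_tendstoI)
  fix a assume "a < growth"
  then obtain c where c: "a < ereal c" "ereal c < growth" using ereal_dense2 by blast
  show "\<forall>\<^sub>F F in folner_filter G. a < ereal_log (local_permanent G h A F) / ereal (real (card F))"
    using eventually_local_permanent_greater[OF assms c(2)] eventually_folner_card
  proof eventually_elim
    case (elim F)
    hence "ereal c < ereal_log (local_permanent G h A F) / ereal (real (card F))"
      by (subst less_ereal_log_divide_iff) auto
    thus ?case using c(1) by simp
  qed
next
  fix a assume "growth < a"
  then obtain c where c: "growth < ereal c" "ereal c < a" using ereal_dense2 by blast
  show "\<forall>\<^sub>F F in folner_filter G. ereal_log (local_permanent G h A F) / ereal (real (card F)) < a"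
    using eventually_local_permanent_less[OF c(1)] eventually_folner_card
  proof eventually_elim
    case (elim F)
    hence "ereal_log (local_permanent G h A F) / ereal (real (card F)) < ereal c"
      by (subst ereal_log_divide_less_iff) auto
    thus ?case using c(2) by simp
  qed
qed

end

section \<open>Evaluating the permanent\<close>

lemma ereal_log_power_mult:
  assumes "C > 0" "n > 0"
  shows "ereal_log (C ^ n * z) / ereal (real n) = ereal (ln C) + ereal_log z / ereal (real n)"
proof (cases "z \<le> 0")
  case True
  hence "C ^ n * z \<le> 0" using assms by (simp add: mult_nonneg_nonpos)
  thus ?thesis using True assms by (simp add: ereal_log_def)
next
  case False
  hence "C ^ n * z > 0" using assms by (intro mult_pos_pos) auto
  hence "ereal_log (C ^ n * z) = ereal (ln (C ^ n * z))"
    unfolding ereal_log_def by (intro if_not_P) linarith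
  also have "ln (C ^ n * z) = real n * ln C + ln z"
    using False assms by (subst ln_mult_pos) (auto simp: ln_realpow)
  finally show ?thesis using False assms by (simp add: ereal_log_def add_divide_distrib)
qed

lemma inj_sum_scale:
  assumes "finite D"
  shows "inj_sum (\<lambda>s t. c * W s t) D B = c ^ card D * inj_sum W D B"
  using assms by (simp add: inj_sum_def sum_distrib_left prod.distrib)

lemma (in group) folner_filter_neq_bot:
  assumes "amenable G" shows "folner_filter G \<noteq> bot"
proof -
  have "\<not> eventually (\<lambda>F. False) (folner_filter G)"
    unfolding eventually_folner_filter using assms by (auto simp: amenable_def)
  thus ?thesis by auto
qed

text \<open>Division by \<open>C\<close> normalises the weight, and the limit \<open>p\<close> is
  the growth of the normalised weight plus \<open>ln C\<close>. The hypothesis on \<open>x\<close>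
  has the weight \<open>h (t \<otimes> inv u)\<close>; inverting both arguments turns it into the
  reversed weight, whose growth is the same. As growth is an infimum, a bound at each single
  \<open>F\<close> is enough.\<close>

lemma permanent_ge:
  fixes G :: "('a, 'm) monoid_scheme" (structure) and x :: ereal
  assumes "group G" and am: "amenable G"
    and h: "\<And>s. h s \<ge> 0" "finite {s. h s \<noteq> 0}" "{s. h s \<noteq> 0} \<subseteq> carrier G"
    and x: "\<And>F. F \<in> fin_subsets G \<Longrightarrow> \<exists>B. finite B \<and> B \<subseteq> carrier G \<and>
      x \<le> ereal_log (inj_sum (\<lambda>u t. h (t \<otimes> inv u)) F B) / ereal (real (card F))"
  shows "x \<le> permanent G h"
proof -
  interpret group G by fact
  \<comment> \<open>The identity keeps \<open>S\<close> nonempty when \<open>h\<close> is 0, and the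
    1 in \<open>C\<close> keeps the divisor positive.\<close>
  define S where "S = insert \<one> {s. h s \<noteq> 0}"
  define C where "C = 1 + sum h S"
  define h' where "h' s = h s / C" for s
  have S: "finite S" "S \<noteq> {}" "S \<subseteq> carrier G" using h by (auto simp: S_def)
  have C: "C > 0" using h(1) by (auto simp: C_def add_pos_nonneg sum_nonneg)
  have gw: "group_weight G A h'" if A: "A \<in> fin_subsets G" "{s. h s \<noteq> 0} \<subseteq> A" for A
  proof unfold_locales
    have fin: "finite (A \<union> S)" using A S by (auto simp: fin_subsets_def)
    have "sum h A \<le> sum h (A \<union> S)" using fin h by (intro sum_mono2) auto
    also have "\<dots> = sum h S" using fin A by (intro sum.mono_neutral_right) (auto simp: S_def)
    finally have "sum h A \<le> C" by (simp add: C_def)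
    thus "sum h' A \<le> 1" using C by (simp add: h'_def sum_divide_distrib[symmetric])
  qed (use A h C in \<open>auto simp: fin_subsets_def h'_def\<close>)
  have S_fin: "S \<in> fin_subsets G" "{s. h s \<noteq> 0} \<subseteq> S" using S by (auto simp: fin_subsets_def S_def)
  interpret S: group_weight G S h' by (rule gw[OF S_fin])
  \<comment> \<open>Enlarging \<open>A\<close> adds only targets of weight 0, so the limit does not
    depend on \<open>A\<close>; this gives the \<open>THE\<close> in the permanent its
    meaning.\<close>
  have growth_eq: "group_weight.growth G A h' = S.growth"
    if A: "A \<in> fin_subsets G" "{s. h s \<noteq> 0} \<subseteq> A" for A
  proof -
    interpret A: group_weight G A h' by (rule gw[OF A])
    have "inj_perm G A h' K = inj_perm G S h' K" if K: "K \<in> fin_subsets G" for K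
    proof -
      have K': "finite K" "K \<subseteq> carrier G" using K by (auto simp: fin_subsets_def)
      let ?B = "K <#> (A \<union> S)"
      have "?B \<subseteq> carrier G" "finite ?B"
        using K' A.A S set_mult_closed[of K "A \<union> S"] by (auto intro!: finite_set_mult)
      moreover have "K <#> A \<subseteq> ?B" "K <#> S \<subseteq> ?B" by (auto simp: set_mult_def)
      ultimately show ?thesis
        using A.inj_perm_target[OF K', of ?B] S.inj_perm_target[OF K', of ?B] by simp
    qed
    thus ?thesis unfolding A.growth_def S.growth_def by (intro INF_cong) auto
  qed
  define p where "p = ereal (ln C) + S.growth"
  have lim: "((\<lambda>F. ereal_log (local_permanent G h A F) / ereal (real (card F))) \<longlongrightarrow> p) (folner_filter G)"
    if A: "A \<in> fin_subsets G" "{s. h s \<noteq> 0} \<subseteq> A" for A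
  proof -
    interpret A: group_weight G A h' by (rule gw[OF A])
    have "((\<lambda>F. ereal (ln C) + ereal_log (local_permanent G h' A F) / ereal (real (card F))) \<longlongrightarrow> p)
        (folner_filter G)"
      unfolding p_def growth_eq[OF A, symmetric]
      by (intro tendsto_add_ereal_general tendsto_const A.tendsto_growth am) auto
    moreover have "\<forall>\<^sub>F F in folner_filter G.
        ereal (ln C) + ereal_log (local_permanent G h' A F) / ereal (real (card F)) =
        ereal_log (local_permanent G h A F) / ereal (real (card F))"
      using A.eventually_folner_card
    proof eventually_elim
      case (elim F)
      have "local_permanent G h A F = C ^ card F * local_permanent G h' A F"
        using C by (simp add: local_permanent_def h'_def sum_distrib_left prod_dividef)
      thus ?case by (simp only: ereal_log_power_mult[OF C elim])
    qed
    ultimately show ?thesis by (rule Lim_transform_eventually)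
  qed
  have "permanent G h = p"
    unfolding permanent_def
  proof (rule the_equality)
    \<comment> \<open>The limit is unique because amenability makes the filter proper.\<close>
    fix p' assume "\<forall>A\<in>fin_subsets G. {s. h s \<noteq> 0} \<subseteq> A \<longrightarrow>
      ((\<lambda>F. ereal_log (local_permanent G h A F) / ereal (real (card F))) \<longlongrightarrow> p') (folner_filter G)"
    hence "((\<lambda>F. ereal_log (local_permanent G h S F) / ereal (real (card F))) \<longlongrightarrow> p') (folner_filter G)"
      using S_fin by blast
    thus "p' = p" using lim[OF S_fin] folner_filter_neq_bot[OF am] tendsto_unique by blast
  qed (use lim in blast)
  interpret D: group_weight G "m_inv G ` S" "inv_weight G h'" by (rule S.dual)
  have "x \<le> ereal (ln C) + ereal_log (inj_perm G (m_inv G ` S) (inv_weight G h') K) / ereal (real (card K))"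
    if K: "K \<in> fin_subsets G" for K
  proof -
    have K': "finite K" "K \<noteq> {}" "K \<subseteq> carrier G" using K by (auto simp: fin_subsets_def)
    have inj: "inj_on (m_inv G) X" if "X \<subseteq> carrier G" for X
      using that inv_inj by (rule inj_on_subset[rotated])
    have cK: "card (m_inv G ` K) = card K" using inj[OF K'(3)] by (rule card_image)
    have "m_inv G ` K \<in> fin_subsets G" using K' by (auto simp: fin_subsets_def)
    from x[OF this, unfolded cK] obtain B where B: "finite B" "B \<subseteq> carrier G"
      "x \<le> ereal_log (inj_sum (\<lambda>u t. h (t \<otimes> inv u)) (m_inv G ` K) B) / ereal (real (card K))"
      by blast
    \<comment> \<open>\<open>?B'\<close> is enlarged so as to contain all targets of nonzero
      reversed weight, as needed to recognise \<open>inj_perm\<close>.\<close>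
    let ?B = "m_inv G ` B" and ?B' = "m_inv G ` B \<union> (K <#> m_inv G ` S)"
    have B': "finite ?B'" "?B' \<subseteq> carrier G"
      using B K' D.A set_mult_closed[OF K'(3) D.A(3)] by (auto intro!: finite_set_mult)
    have "m_inv G ` ?B = (\<lambda>b. b) ` B" unfolding image_image using B(2) by (intro image_cong) auto
    hence "inj_sum (\<lambda>u t. h (t \<otimes> inv u)) (m_inv G ` K) B =
        inj_sum (\<lambda>u t. h (t \<otimes> inv u)) (m_inv G ` K) (m_inv G ` ?B)" by simp
    also have "\<dots> = inj_sum (\<lambda>s t. h (inv t \<otimes> inv (inv s))) K ?B"
    proof (rule inj_sum_reindex)
      show "inj_on (m_inv G) K" by (rule inj[OF K'(3)])
      show "inj_on (m_inv G) ?B" by (rule inj) (use B in auto)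
    qed (use B K' in auto)
    also have "\<dots> \<le> inj_sum (\<lambda>s t. h (inv t \<otimes> inv (inv s))) K ?B'"
      using K' B' h by (intro inj_sum_target_mono) auto
    also have "\<dots> = inj_sum (\<lambda>s t. C * h' (inv t \<otimes> s)) K ?B'"
      using K' C by (intro inj_sum_cong) (auto simp: h'_def)
    also have "\<dots> = C ^ card K * inj_sum (\<lambda>s t. h' (inv t \<otimes> s)) K ?B'"
      by (rule inj_sum_scale[OF K'(1)])
    also have "inj_sum (\<lambda>s t. h' (inv t \<otimes> s)) K ?B' = inj_perm G (m_inv G ` S) (inv_weight G h') K"
      using K' B' by (intro S.inj_perm_dual[symmetric]) auto
    finally have le: "inj_sum (\<lambda>u t. h (t \<otimes> inv u)) (m_inv G ` K) B
        \<le> C ^ card K * inj_perm G (m_inv G ` S) (inv_weight G h') K" .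
    have mono: "ereal_log a \<le> ereal_log b" if "a \<le> b" for a b
      using that by (auto simp: ereal_log_def)
    have "x \<le> ereal_log (C ^ card K * inj_perm G (m_inv G ` S) (inv_weight G h') K) / ereal (real (card K))"
      using K' by (intro order_trans[OF B(3)] ereal_divide_right_mono mono le) (auto simp: card_gt_0_iff)
    thus ?thesis using K' C by (simp add: ereal_log_power_mult card_gt_0_iff)
  qed
  hence "x - ereal (ln C) \<le> ereal_log (inj_perm G (m_inv G ` S) (inv_weight G h') K) / ereal (real (card K))"
    if "K \<in> fin_subsets G" for K
    using that by (simp add: ereal_minus_le add.commute)
  hence "x - ereal (ln C) \<le> D.growth" unfolding D.growth_def by (intro INF_greatest)
  hence "x \<le> p" unfolding p_def S.growth_dual[OF am] by (simp add: ereal_minus_le add.commute)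
  thus ?thesis by (simp add: \<open>permanent G h = p\<close>)
qed

section \<open>The Hilbert space of square-summable functions\<close>

lemma ell2_summable: "x \<in> ell2 I \<Longrightarrow> (\<lambda>s. (cmod (x s))\<^sup>2) summable_on I"
  by (simp add: ell2_def)

lemma ell2I_bound:
  assumes "\<And>s. s \<notin> I \<Longrightarrow> x s = 0" "g summable_on I" "\<And>s. s \<in> I \<Longrightarrow> (cmod (x s))\<^sup>2 \<le> g s"
  shows "x \<in> ell2 I"
  using assms by (auto simp: ell2_def intro: summable_on_comparison_test[of g])

lemma ell2_add:
  assumes "x \<in> ell2 I" "y \<in> ell2 I" shows "(\<lambda>s. x s + y s) \<in> ell2 I"
proof (rule ell2I_bound)
  show "(\<lambda>s. 2 * (cmod (x s))\<^sup>2 + 2 * (cmod (y s))\<^sup>2) summable_on I"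
    using assms by (intro summable_on_add summable_on_cmult_right ell2_summable)
  fix s
  have "(cmod (x s + y s))\<^sup>2 \<le> (cmod (x s) + cmod (y s))\<^sup>2"
    by (intro power_mono norm_triangle_ineq) auto
  also have "\<dots> \<le> 2 * (cmod (x s))\<^sup>2 + 2 * (cmod (y s))\<^sup>2"
    using sum_squares_bound[of "cmod (x s)" "cmod (y s)"] by (simp add: power2_sum)
  finally show "(cmod (x s + y s))\<^sup>2 \<le> 2 * (cmod (x s))\<^sup>2 + 2 * (cmod (y s))\<^sup>2" .
qed (use assms in \<open>auto simp: ell2_def\<close>)

lemma ell2_scale:
  assumes "x \<in> ell2 I" shows "(\<lambda>s. c * x s) \<in> ell2 I"
  using assms summable_on_cmult_right[OF ell2_summable[OF assms], of "(cmod c)\<^sup>2"]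
  by (auto simp: ell2_def norm_mult power_mult_distrib)

lemma ell2_diff:
  assumes "x \<in> ell2 I" "y \<in> ell2 I" shows "(\<lambda>s. x s - y s) \<in> ell2 I"
  using ell2_add[OF assms(1) ell2_scale[OF assms(2), of "-1"]] by simp

lemma ell2_zero: "(\<lambda>s. 0) \<in> ell2 I"
  by (simp add: ell2_def)

lemma ell2_sum: "(\<And>i. i \<in> J \<Longrightarrow> x i \<in> ell2 I) \<Longrightarrow> (\<lambda>s. \<Sum>i\<in>J. x i s) \<in> ell2 I"
  by (induction J rule: infinite_finite_induct) (auto intro: ell2_zero ell2_add)

lemma ell2_indicator: "t \<in> I \<Longrightarrow> (indicator {t} :: 'a \<Rightarrow> complex) \<in> ell2 I"
  by (auto simp: ell2_def indicator_def intro!: finite_nonzero_values_imp_summable_on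
      finite_subset[of _ "{t}"] split: if_splits)

lemma ell2_inner_abs_summable:
  assumes "x \<in> ell2 I" "y \<in> ell2 I"
  shows "(\<lambda>s. cmod (x s * cnj (y s))) summable_on I"
proof (rule summable_on_comparison_test)
  show "(\<lambda>s. (cmod (x s))\<^sup>2 + (cmod (y s))\<^sup>2) summable_on I"
    using assms by (intro summable_on_add ell2_summable)
  fix s
  show "cmod (x s * cnj (y s)) \<le> (cmod (x s))\<^sup>2 + (cmod (y s))\<^sup>2"
    using sum_squares_bound[of "cmod (x s)" "cmod (y s)"] mult_nonneg_nonneg[OF norm_ge_zero norm_ge_zero, of "x s" "y s"]
    unfolding norm_mult complex_mod_cnj by linarith
qed auto

lemma ell2_inner_summable:
  assumes "x \<in> ell2 I" "y \<in> ell2 I"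
  shows "(\<lambda>s. x s * cnj (y s)) summable_on I"
  using ell2_inner_abs_summable[OF assms] by (rule abs_summable_summable)

lemma ell2_inner_add_left:
  assumes "x \<in> ell2 I" "y \<in> ell2 I" "z \<in> ell2 I"
  shows "ell2_inner I (\<lambda>s. x s + y s) z = ell2_inner I x z + ell2_inner I y z"
  using assms by (simp add: ell2_inner_def distrib_right infsum_add ell2_inner_summable)

lemma ell2_inner_scale_left: "ell2_inner I (\<lambda>s. c * x s) z = c * ell2_inner I x z"
  by (simp add: ell2_inner_def mult.assoc infsum_cmult_right')

lemma ell2_inner_commute: "ell2_inner I y x = cnj (ell2_inner I x y)"
  by (simp add: ell2_inner_def mult.commute flip: infsum_cnj)

lemma ell2_inner_add_right:
  assumes "x \<in> ell2 I" "y \<in> ell2 I" "z \<in> ell2 I"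
  shows "ell2_inner I z (\<lambda>s. x s + y s) = ell2_inner I z x + ell2_inner I z y"
  unfolding ell2_inner_commute[of I z] ell2_inner_add_left[OF assms] by simp

lemma ell2_inner_scale_right: "ell2_inner I z (\<lambda>s. c * x s) = cnj c * ell2_inner I z x"
  unfolding ell2_inner_commute[of I z] ell2_inner_scale_left by simp

lemma ell2_inner_diff_left:
  assumes "x \<in> ell2 I" "y \<in> ell2 I" "z \<in> ell2 I"
  shows "ell2_inner I (\<lambda>s. x s - y s) z = ell2_inner I x z - ell2_inner I y z"
  using ell2_inner_add_left[OF assms(1) ell2_scale[OF assms(2), of "-1"] assms(3)]
  by (simp add: ell2_inner_scale_left[of I "-1", simplified])

lemma ell2_inner_zero [simp]: "ell2_inner I (\<lambda>s. 0) z = 0" "ell2_inner I z (\<lambda>s. 0) = 0"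
  by (simp_all add: ell2_inner_def)

lemma ell2_inner_sum_left:
  assumes "\<And>i. i \<in> J \<Longrightarrow> x i \<in> ell2 I" "z \<in> ell2 I"
  shows "ell2_inner I (\<lambda>s. \<Sum>i\<in>J. x i s) z = (\<Sum>i\<in>J. ell2_inner I (x i) z)"
  using assms
  by (induction J rule: infinite_finite_induct) (auto simp: ell2_inner_add_left ell2_sum)

lemma ell2_inner_self:
  assumes "x \<in> ell2 I" shows "ell2_inner I x x = of_real ((ell2_norm I x)\<^sup>2)"
proof -
  have "ell2_inner I x x = (\<Sum>\<^sub>\<infinity>s\<in>I. of_real ((cmod (x s))\<^sup>2))"
    by (simp only: ell2_inner_def complex_norm_square)
  also have "\<dots> = of_real (\<Sum>\<^sub>\<infinity>s\<in>I. (cmod (x s))\<^sup>2)"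
    by (rule infsumI[OF has_sum_of_real[OF has_sum_infsum[OF ell2_summable[OF assms]]]])
  finally show ?thesis by (simp add: ell2_norm_def infsum_nonneg)
qed

lemma ell2_norm_nonneg: "ell2_norm I x \<ge> 0"
  by (simp add: ell2_norm_def infsum_nonneg)

lemma ell2_Cauchy_Schwarz:
  assumes "x \<in> ell2 I" "y \<in> ell2 I"
  shows "cmod (ell2_inner I x y) \<le> ell2_norm I x * ell2_norm I y"
proof -
  have fin: "L2_set (\<lambda>s. cmod (z s)) F \<le> ell2_norm I z" if "z \<in> ell2 I" "finite F" "F \<subseteq> I" for z F
    unfolding L2_set_def ell2_norm_def using that
    by (intro real_sqrt_le_mono finite_sum_le_infsum ell2_summable) auto
  have "cmod (ell2_inner I x y) \<le> (\<Sum>\<^sub>\<infinity>s\<in>I. cmod (x s * cnj (y s)))"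
    unfolding ell2_inner_def by (intro norm_infsum_bound ell2_inner_abs_summable assms)
  also have "\<dots> \<le> ell2_norm I x * ell2_norm I y"
  proof (rule infsum_le_finite_sums[OF ell2_inner_abs_summable[OF assms]])
    fix F assume F: "finite F" "F \<subseteq> I"
    have "(\<Sum>s\<in>F. cmod (x s * cnj (y s))) = (\<Sum>s\<in>F. \<bar>cmod (x s)\<bar> * \<bar>cmod (y s)\<bar>)"
      by (simp add: norm_mult)
    also have "\<dots> \<le> L2_set (\<lambda>s. cmod (x s)) F * L2_set (\<lambda>s. cmod (y s)) F" by (rule L2_set_mult_ineq)
    also have "\<dots> \<le> ell2_norm I x * ell2_norm I y"
      by (intro mult_mono fin F assms ell2_norm_nonneg L2_set_nonneg)
    finally show "(\<Sum>s\<in>F. cmod (x s * cnj (y s))) \<le> ell2_norm I x * ell2_norm I y" .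
  qed
  finally show ?thesis .
qed

lemma ell2_inner_indicator:
  assumes "t \<in> I" shows "ell2_inner I x (indicator {t}) = x t"
proof -
  have "ell2_inner I x (indicator {t}) = (\<Sum>\<^sub>\<infinity>s\<in>{t}. x s * cnj (indicator {t} s))"
    unfolding ell2_inner_def using assms by (intro infsum_cong_neutral) (auto simp: indicator_def)
  thus ?thesis by simp
qed

lemma ell2_eqI:
  assumes "x \<in> ell2 I" "y \<in> ell2 I" "\<And>z. z \<in> ell2 I \<Longrightarrow> ell2_inner I x z = ell2_inner I y z"
  shows "x = y"
proof
  fix t show "x t = y t"
    using assms(1,2) assms(3)[OF ell2_indicator[of t I]]
    by (cases "t \<in> I") (auto simp: ell2_inner_indicator ell2_def)
qed

lemma ell2_norm_point: "x \<in> ell2 I \<Longrightarrow> cmod (x t) \<le> ell2_norm I x"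
proof (cases "t \<in> I")
  case True
  assume x: "x \<in> ell2 I"
  have "(\<Sum>s\<in>{t}. (cmod (x s))\<^sup>2) \<le> (\<Sum>\<^sub>\<infinity>s\<in>I. (cmod (x s))\<^sup>2)"
    using True x by (intro finite_sum_le_infsum ell2_summable) auto
  thus ?thesis unfolding ell2_norm_def by (intro real_le_rsqrt) simp
next
  case False
  assume "x \<in> ell2 I"
  thus ?thesis using False ell2_norm_nonneg[of I x] by (simp add: ell2_def)
qed

text \<open>Cauchy-Schwarz with the weights \<open>a n\<close> bounds the partial sums on each
  finite set of coordinates, and such bounds survive the pointwise limit. The series is only ever
  summed coordinate by coordinate.\<close>

lemma ell2_series:
  assumes y: "\<And>n. y n \<in> ell2 I" "\<And>n. ell2_norm I (y n) \<le> K"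
    and a: "\<And>n. a n \<ge> (0::real)" "summable a"
  shows "summable (\<lambda>n. of_real (a n) * y n s)"
    and "(\<lambda>s. \<Sum>n. of_real (a n) * y n s) \<in> ell2 I" (is ?th1)
    and "ell2_norm I (\<lambda>s. \<Sum>n. of_real (a n) * y n s) \<le> suminf a * K" (is ?th2)
proof -
  have K: "K \<ge> 0" using y(2)[of 0] ell2_norm_nonneg[of I "y 0"] by linarith
  have sm: "summable (\<lambda>n. of_real (a n) * y n s)" for s
  proof (rule summable_comparison_test')
    show "summable (\<lambda>n. a n * K)" using a(2) by (rule summable_mult2)
    show "norm (of_real (a n) * y n s) \<le> a n * K" for n
      using a(1) ell2_norm_point[OF y(1), of n s] y(2)[of n]
      by (auto simp: norm_mult intro!: mult_left_mono)
  qed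
  thus "summable (\<lambda>n. of_real (a n) * y n s)" .
  define z where "z s = (\<Sum>n. of_real (a n) * y n s)" for s
  have fin: "(\<Sum>s\<in>F. (cmod (z s))\<^sup>2) \<le> (suminf a * K)\<^sup>2" if F: "finite F" "F \<subseteq> I" for F
  proof -
    have part: "(\<Sum>s\<in>F. (cmod (\<Sum>n<N. of_real (a n) * y n s))\<^sup>2) \<le> (suminf a * K)\<^sup>2" for N
    proof -
      define L where "L = (\<Sum>n<N. a n)"
      have L: "0 \<le> L" "L \<le> suminf a" using a by (auto simp: L_def intro!: sum_nonneg sum_le_suminf)
      have "(cmod (\<Sum>n<N. of_real (a n) * y n s))\<^sup>2 \<le> L * (\<Sum>n<N. a n * (cmod (y n s))\<^sup>2)" for s
      proof -
        have "cmod (\<Sum>n<N. of_real (a n) * y n s) \<le> (\<Sum>n<N. sqrt (a n) * (sqrt (a n) * cmod (y n s)))"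
          using a by (intro sum_norm_le) (simp add: norm_mult mult.assoc[symmetric])
        hence "(cmod (\<Sum>n<N. of_real (a n) * y n s))\<^sup>2 \<le> (\<Sum>n<N. sqrt (a n) * (sqrt (a n) * cmod (y n s)))\<^sup>2"
          by (intro power_mono) auto
        also have "\<dots> \<le> (\<Sum>n<N. (sqrt (a n))\<^sup>2) * (\<Sum>n<N. (sqrt (a n) * cmod (y n s))\<^sup>2)"
          by (rule Cauchy_Schwarz_ineq_sum)
        also have "\<dots> = L * (\<Sum>n<N. a n * (cmod (y n s))\<^sup>2)"
          using a by (simp add: L_def power_mult_distrib)
        finally show ?thesis .
      qed
      hence "(\<Sum>s\<in>F. (cmod (\<Sum>n<N. of_real (a n) * y n s))\<^sup>2) \<le> (\<Sum>s\<in>F. L * (\<Sum>n<N. a n * (cmod (y n s))\<^sup>2))"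
        by (intro sum_mono)
      also have "\<dots> = L * (\<Sum>n<N. a n * (\<Sum>s\<in>F. (cmod (y n s))\<^sup>2))"
        unfolding sum_distrib_left by (rule sum.swap)
      also have "\<dots> \<le> L * (\<Sum>n<N. a n * K\<^sup>2)"
      proof (intro mult_left_mono sum_mono L a)
        fix n
        have "(\<Sum>s\<in>F. (cmod (y n s))\<^sup>2) \<le> (\<Sum>\<^sub>\<infinity>s\<in>I. (cmod (y n s))\<^sup>2)"
          using F y(1) by (intro finite_sum_le_infsum ell2_summable) auto
        also have "\<dots> = (ell2_norm I (y n))\<^sup>2" by (simp add: ell2_norm_def infsum_nonneg)
        also have "\<dots> \<le> K\<^sup>2" using y(2) ell2_norm_nonneg by (intro power_mono)
        finally show "(\<Sum>s\<in>F. (cmod (y n s))\<^sup>2) \<le> K\<^sup>2" .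
      qed
      also have "\<dots> = (L * K)\<^sup>2" by (simp add: sum_distrib_right[symmetric] L_def[symmetric] power2_eq_square)
      also have "\<dots> \<le> (suminf a * K)\<^sup>2" using L K by (intro power_mono mult_right_mono) auto
      finally show ?thesis .
    qed
    have "(\<lambda>N. \<Sum>s\<in>F. (cmod (\<Sum>n<N. of_real (a n) * y n s))\<^sup>2) \<longlonglongrightarrow> (\<Sum>s\<in>F. (cmod (z s))\<^sup>2)"
      unfolding z_def by (intro tendsto_sum tendsto_power tendsto_norm summable_LIMSEQ sm)
    thus ?thesis by (rule LIMSEQ_le_const2) (use part in auto)
  qed
  have sum_z: "(\<lambda>s. (cmod (z s))\<^sup>2) summable_on I"
    using fin by (intro nonneg_bounded_partial_sums_imp_summable_on[of _ _ "(suminf a * K)\<^sup>2"])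
      (auto intro!: eventually_finite_subsets_at_top_weakI)
  have "z s = 0" if "s \<notin> I" for s using that y(1) by (auto simp: z_def ell2_def)
  thus ?th1 using sum_z by (simp add: ell2_def z_def)
  have "(\<Sum>\<^sub>\<infinity>s\<in>I. (cmod (z s))\<^sup>2) \<le> (suminf a * K)\<^sup>2"
    using sum_z fin by (rule infsum_le_finite_sums)
  thus ?th2 unfolding ell2_norm_def z_def[symmetric]
    using K a by (intro real_le_lsqrt) (auto intro!: mult_nonneg_nonneg suminf_nonneg)
qed

section \<open>Positive square roots\<close>

text \<open>The coefficients of the power series of \<open>sqrt (1 - z)\<close>.\<close>

definition sqrt_coeff :: "nat \<Rightarrow> real"
  where "sqrt_coeff n = ((1/2) gchoose n) * (-1) ^ n"

lemma sqrt_coeff_0 [simp]: "sqrt_coeff 0 = 1"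
  by (simp add: sqrt_coeff_def)

lemma gchoose_Suc: "((a::real) gchoose Suc n) = (a gchoose n) * (a - real n) / real (Suc n)"
  by (simp add: gbinomial_prod_rev field_simps)

lemma sqrt_coeff_Suc: "sqrt_coeff (Suc n) = sqrt_coeff n * ((real n - 1/2) / real (Suc n))"
  by (simp add: sqrt_coeff_def gchoose_Suc field_simps)

lemma sqrt_coeff_nonpos: "sqrt_coeff (Suc n) \<le> 0"
proof (induction n)
  case 0
  show ?case by (simp add: sqrt_coeff_Suc)
next
  case (Suc n)
  show ?case unfolding sqrt_coeff_Suc[of "Suc n"]
    by (rule mult_nonpos_nonneg[OF Suc]) simp
qed

text \<open>The partial sums collapse to \<open>(-1) ^ m * ((-1/2) gchoose m)\<close>. As all
  coefficients after the first are nonpositive, it follows that they are absolutely summable and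
  that those after the first have total mass at most 1.\<close>

lemma sum_sqrt_coeff_nonneg: "(\<Sum>n\<le>m. sqrt_coeff n) \<ge> 0"
proof -
  have "(-1) ^ m * ((-1/2::real) gchoose m) \<ge> 0"
  proof (induction m)
    case (Suc m)
    have "(-1) ^ Suc m * ((-1/2::real) gchoose Suc m) =
        ((-1) ^ m * ((-1/2) gchoose m)) * ((1/2 + real m) / real (Suc m))"
      by (simp add: gchoose_Suc field_simps)
    also have "\<dots> \<ge> 0" by (rule mult_nonneg_nonneg[OF Suc]) simp
    finally show ?case .
  qed simp
  moreover have "(\<Sum>n\<le>m. sqrt_coeff n) = (-1) ^ m * ((-1/2::real) gchoose m)"
    using gbinomial_sum_lower_neg[of "1/2::real" m] by (simp add: sqrt_coeff_def)
  ultimately show ?thesis by simp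
qed

text \<open>Vandermonde's identity for exponents 1/2 and 1/2: the squared series is
  \<open>1 - z\<close>.\<close>

lemma sqrt_coeff_conv:
  "(\<Sum>i\<le>n. sqrt_coeff i * sqrt_coeff (n - i)) = (if n = 0 then 1 else if n = 1 then -1 else 0)"
proof -
  have "(\<Sum>i\<le>n. sqrt_coeff i * sqrt_coeff (n - i)) =
      (\<Sum>i\<le>n. (((1/2) gchoose i) * ((1/2) gchoose (n - i))) * (-1) ^ n)"
  proof (rule sum.cong[OF refl])
    fix i assume "i \<in> {..n}"
    hence "(-1::real) ^ n = (-1) ^ i * (-1) ^ (n - i)" by (simp flip: power_add)
    thus "sqrt_coeff i * sqrt_coeff (n - i) = (((1/2) gchoose i) * ((1/2) gchoose (n - i))) * (-1) ^ n"
      by (simp add: sqrt_coeff_def)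
  qed
  also have "\<dots> = ((1 :: real) gchoose n) * (-1) ^ n"
    using gbinomial_Vandermonde[of "1/2::real" "1/2" n]
    by (simp add: sum_distrib_right[symmetric] atMost_atLeast0)
  also have "(1::real) gchoose n = real (1 choose n)"
    using binomial_gbinomial[of 1 n, where 'a = real] by simp
  finally show ?thesis by (auto simp: binomial_eq_0)
qed

text \<open>The sign is chosen so that
  \<open>sqrt (1 - z) = 1 - (\<Sum>n. sqrt_tail n * z ^ Suc n)\<close>. What is subtracted has
  nonnegative coefficients of sum at most 1, which later yields positivity of the root.\<close>

definition sqrt_tail :: "nat \<Rightarrow> real"
  where "sqrt_tail n = - sqrt_coeff (Suc n)"

lemma sqrt_tail_nonneg: "sqrt_tail n \<ge> 0"
  using sqrt_coeff_nonpos[of n] by (simp add: sqrt_tail_def)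

lemma sqrt_tail_sum_le: "(\<Sum>n<m. sqrt_tail n) \<le> 1"
proof -
  have "(\<Sum>n\<le>m. sqrt_coeff n) = sqrt_coeff 0 + (\<Sum>n<m. sqrt_coeff (Suc n))"
    by (rule sum.atMost_shift)
  thus ?thesis using sum_sqrt_coeff_nonneg[of m] by (simp add: sqrt_tail_def sum_negf)
qed

lemma summable_sqrt_tail: "summable sqrt_tail" and suminf_sqrt_tail_le: "suminf sqrt_tail \<le> 1"
proof -
  show s: "summable sqrt_tail"
    using sqrt_tail_nonneg sqrt_tail_sum_le[of "Suc _", unfolded lessThan_Suc_atMost]
    by (rule bounded_imp_summable)
  show "suminf sqrt_tail \<le> 1"
    using s sqrt_tail_sum_le by (intro suminf_le_const)
qed

lemma summable_abs_sqrt_coeff: "summable (\<lambda>n. \<bar>sqrt_coeff n\<bar>)"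
proof -
  have "(\<lambda>n. \<bar>sqrt_coeff (Suc n)\<bar>) = sqrt_tail"
    using sqrt_coeff_nonpos by (auto simp: sqrt_tail_def fun_eq_iff)
  thus ?thesis using summable_sqrt_tail summable_Suc_iff[of "\<lambda>n. \<bar>sqrt_coeff n\<bar>"] by simp
qed

text \<open>The square of the binomial series of \<open>sqrt (1 - z)\<close>, with \<open>z ^ k\<close> replaced by bounded \<open>a k\<close>.\<close>

lemma sqrt_series_square:
  fixes a :: "nat \<Rightarrow> complex"
  assumes "\<And>k. cmod (a k) \<le> K"
  shows "(\<Sum>m. of_real (sqrt_coeff m) * (\<Sum>n. of_real (sqrt_coeff n) * a (n + m))) = a 0 - a 1"
proof -
  define g where "g n = (of_real (sqrt_coeff n) :: complex)" for n
  define F where "F = (\<lambda>(m, n). g m * (g n * a (n + m)))"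
  have gs: "summable (\<lambda>n. norm (g n))" using summable_abs_sqrt_coeff by (simp add: g_def)
  have suminf_infsum: "(\<Sum>n. f n) = (\<Sum>\<^sub>\<infinity>n. f n)" if "f summable_on UNIV" for f :: "nat \<Rightarrow> complex"
    using has_sum_imp_sums[OF has_sum_infsum[OF that]] by (simp add: sums_iff)
  have g_on: "(\<lambda>n. norm (g n)) summable_on UNIV"
    using gs by (subst summable_on_UNIV_nonneg_real_iff) auto
  have "(\<lambda>(m, n). norm (g m) * norm (g n)) summable_on Sigma UNIV (\<lambda>_. UNIV)"
  proof (rule summable_on_SigmaI)
    show "((\<lambda>n. case (m, n) of (m, n) \<Rightarrow> norm (g m) * norm (g n)) has_sum
        norm (g m) * (\<Sum>\<^sub>\<infinity>n. norm (g n))) UNIV" for m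
      using has_sum_cmult_right[OF has_sum_infsum[OF g_on]] by simp
    show "(\<lambda>m. norm (g m) * (\<Sum>\<^sub>\<infinity>n. norm (g n))) summable_on UNIV"
      using g_on by (rule summable_on_cmult_left)
  qed auto
  hence "(\<lambda>p. (case p of (m, n) \<Rightarrow> norm (g m) * norm (g n)) * K) summable_on Sigma UNIV (\<lambda>_. UNIV)"
    by (rule summable_on_cmult_left)
  hence "(\<lambda>p. norm (F p)) summable_on Sigma UNIV (\<lambda>_. UNIV)"
  proof (rule summable_on_comparison_test)
    fix p :: "nat \<times> nat"
    obtain m n where p: "p = (m, n)" by (cases p)
    have "norm (F p) = norm (g m) * norm (g n) * norm (a (n + m))" by (simp add: F_def p norm_mult)
    also have "\<dots> \<le> norm (g m) * norm (g n) * K" using assms by (intro mult_left_mono) auto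
    finally show "norm (F p) \<le> (case p of (m, n) \<Rightarrow> norm (g m) * norm (g n)) * K" by (simp add: p)
  qed auto
  hence F: "F summable_on Sigma UNIV (\<lambda>_. UNIV)" by (rule abs_summable_summable)
  have inner: "(\<lambda>n. g n * a (n + m)) summable_on UNIV" for m
  proof (rule abs_summable_summable, rule summable_on_comparison_test)
    show "(\<lambda>n. norm (g n) * K) summable_on UNIV" using g_on by (rule summable_on_cmult_left)
    show "norm (g n * a (n + m)) \<le> norm (g n) * K" for n
      using assms by (auto simp: norm_mult intro!: mult_left_mono)
  qed auto
  have F1: "(\<Sum>\<^sub>\<infinity>m. \<Sum>\<^sub>\<infinity>n. F (m, n)) = (\<Sum>\<^sub>\<infinity>p\<in>UNIV \<times> UNIV. F p)"
    by (rule infsum_Sigma_banach[OF F])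
  have F2: "(\<lambda>m. \<Sum>\<^sub>\<infinity>n. F (m, n)) summable_on UNIV"
    using summable_on_Sigma_banach[of "\<lambda>m n. F (m, n)" UNIV "\<lambda>_. UNIV"] F by simp
  have eq: "(\<Sum>\<^sub>\<infinity>n. F (m, n)) = g m * (\<Sum>n. g n * a (n + m))" for m
    unfolding F_def prod.case suminf_infsum[OF inner] by (rule infsum_cmult_right')
  have "(\<Sum>m. g m * (\<Sum>n. g n * a (n + m))) = (\<Sum>\<^sub>\<infinity>m. \<Sum>\<^sub>\<infinity>n. F (m, n))"
    using suminf_infsum[OF F2] by (simp only: eq)
  also have "\<dots> = (\<Sum>\<^sub>\<infinity>p\<in>UNIV \<times> UNIV. F p)" by (rule F1)
  \<comment> \<open>Regrouped along the antidiagonals \<open>m + n = k\<close>, on which the factor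
    \<open>a k\<close> is constant.\<close>
  also have "\<dots> = (\<Sum>\<^sub>\<infinity>q\<in>(SIGMA k:UNIV. {..k}). F (case q of (k, i) \<Rightarrow> (i, k - i)))"
    by (rule infsum_reindex_bij_betw[symmetric], rule bij_betw_byWitness[where f' = "\<lambda>(m, n). (m + n, m)"]) auto
  also have "\<dots> = (\<Sum>\<^sub>\<infinity>k. \<Sum>\<^sub>\<infinity>i\<in>{..k}. F (i, k - i))"
  proof -
    have "(\<lambda>q. F (case q of (k, i) \<Rightarrow> (i, k - i))) summable_on (SIGMA k:UNIV. {..k})"
      using F by (subst summable_on_reindex_bij_betw[of _ _ "UNIV \<times> UNIV"])
        (auto intro!: bij_betw_byWitness[where f' = "\<lambda>(m, n). (m + n, m)"])
    from infsum_Sigma_banach[OF this] show ?thesis by simp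
  qed
  also have "\<dots> = (\<Sum>\<^sub>\<infinity>k. a k * of_real (\<Sum>i\<le>k. sqrt_coeff i * sqrt_coeff (k - i)))"
    by (simp add: F_def g_def sum_distrib_left mult_ac)
  also have "\<dots> = (\<Sum>\<^sub>\<infinity>k\<in>{0, 1}. a k * of_real (\<Sum>i\<le>k. sqrt_coeff i * sqrt_coeff (k - i)))"
    by (rule infsum_cong_neutral) (auto simp: sqrt_coeff_conv)
  also have "\<dots> = a 0 - a 1" by (simp add: sqrt_coeff_conv del: One_nat_def)
  finally show ?thesis by (simp add: g_def)
qed

locale ell2_symmetric =
  fixes I :: "'a set" and B :: "('a \<Rightarrow> complex) \<Rightarrow> 'a \<Rightarrow> complex"
  assumes ell2: "x \<in> ell2 I \<Longrightarrow> B x \<in> ell2 I"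
    and add: "x \<in> ell2 I \<Longrightarrow> y \<in> ell2 I \<Longrightarrow> B (\<lambda>s. x s + y s) = (\<lambda>s. B x s + B y s)"
    and scale: "x \<in> ell2 I \<Longrightarrow> B (\<lambda>s. c * x s) = (\<lambda>s. c * B x s)"
    and sym: "x \<in> ell2 I \<Longrightarrow> y \<in> ell2 I \<Longrightarrow> ell2_inner I (B x) y = ell2_inner I x (B y)"
begin

lemma pow_ell2: "x \<in> ell2 I \<Longrightarrow> (B ^^ n) x \<in> ell2 I"
  by (induction n) (auto intro: ell2)

lemma pow_add: "x \<in> ell2 I \<Longrightarrow> y \<in> ell2 I \<Longrightarrow> (B ^^ n) (\<lambda>s. x s + y s) = (\<lambda>s. (B ^^ n) x s + (B ^^ n) y s)"
  by (induction n) (auto simp: add pow_ell2)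

lemma pow_scale: "x \<in> ell2 I \<Longrightarrow> (B ^^ n) (\<lambda>s. c * x s) = (\<lambda>s. c * (B ^^ n) x s)"
  by (induction n) (auto simp: scale pow_ell2)

lemma pow_sym: "x \<in> ell2 I \<Longrightarrow> y \<in> ell2 I \<Longrightarrow> ell2_inner I ((B ^^ n) x) y = ell2_inner I x ((B ^^ n) y)"
proof (induction n arbitrary: x y)
  case (Suc n)
  thus ?case by (simp add: sym pow_ell2 ell2 flip: funpow_swap1)
qed simp

end

text \<open>The relation \<open>0 \<le> B \<le> 1\<close> between quadratic forms; the norm bound is
  derived from it.\<close>

locale ell2_contraction = ell2_symmetric +
  assumes pos: "x \<in> ell2 I \<Longrightarrow> Re (ell2_inner I (B x) x) \<ge> 0"
    and le: "x \<in> ell2 I \<Longrightarrow> Re (ell2_inner I (B x) x) \<le> (ell2_norm I x)\<^sup>2"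
begin

text \<open>With \<open>C = 1 - B\<close> one has \<open>B - B\<^sup>2 = C B C + B C B\<close>, which is positive.\<close>

lemma square_le:
  assumes x: "x \<in> ell2 I"
  shows "Re (ell2_inner I (B (B x)) x) \<le> Re (ell2_inner I (B x) x)"
proof -
  let ?z = "\<lambda>s. x s - B x s"
  note [simp] = x ell2
  have Bz: "B ?z = (\<lambda>s. B x s - B (B x) s)"
    using add[OF x ell2_scale[of "B x" I "-1"]] scale[of "B x" "-1"] by simp
  have d: "ell2_inner I u ?z = ell2_inner I u x - ell2_inner I u (B x)" if "u \<in> ell2 I" for u
    using ell2_inner_add_right[of x I "\<lambda>s. -1 * B x s" u] ell2_inner_scale_right[of I u "-1" "B x"] that
      ell2_scale[of "B x" I "-1"] by simp
  have "0 \<le> Re (ell2_inner I (B ?z) ?z)" by (intro pos ell2_diff) simp_all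
  also have "ell2_inner I (B ?z) ?z = ell2_inner I (B x) x - ell2_inner I (B x) (B x)
      - (ell2_inner I (B (B x)) x - ell2_inner I (B (B x)) (B x))"
    unfolding Bz by (simp add: ell2_inner_diff_left d ell2_diff)
  also have "ell2_inner I (B x) (B x) = ell2_inner I (B (B x)) x" by (rule sym[symmetric]) simp_all
  finally have 1: "0 \<le> Re (ell2_inner I (B x) x) - 2 * Re (ell2_inner I (B (B x)) x)
      + Re (ell2_inner I (B (B x)) (B x))" by simp
  have "Re (ell2_inner I (B (B x)) (B x)) \<le> (ell2_norm I (B x))\<^sup>2" by (rule le) simp
  also have "\<dots> = Re (ell2_inner I (B x) (B x))" by (simp add: ell2_inner_self)
  also have "\<dots> = Re (ell2_inner I (B (B x)) x)" by (subst sym[of "B x" x]) simp_all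
  finally show ?thesis using 1 by linarith
qed

text \<open>The squared norm of \<open>B x\<close> is the form of \<open>B\<close> composed with
  itself, which lies below the form of \<open>B\<close> and hence below the identity.\<close>

lemma norm_le: assumes x: "x \<in> ell2 I" shows "ell2_norm I (B x) \<le> ell2_norm I x"
proof -
  have "(ell2_norm I (B x))\<^sup>2 = Re (ell2_inner I (B x) (B x))" using x by (simp add: ell2_inner_self ell2)
  also have "\<dots> = Re (ell2_inner I (B (B x)) x)" using x by (subst sym[of "B x" x]) (simp_all add: ell2)
  also have "\<dots> \<le> (ell2_norm I x)\<^sup>2" using square_le[OF x] le[OF x] by linarith
  finally show ?thesis by (rule power2_le_imp_le) (rule ell2_norm_nonneg)
qed

lemma pow_norm_le: "x \<in> ell2 I \<Longrightarrow> ell2_norm I ((B ^^ n) x) \<le> ell2_norm I x"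
  by (induction n) (auto intro: order_trans[OF norm_le] simp: pow_ell2)

end

lemma ell2_norm_diff_le:
  assumes x: "x \<in> ell2 I" and y: "y \<in> ell2 I"
  shows "ell2_norm I (\<lambda>s. x s - y s) \<le> ell2_norm I x + ell2_norm I y"
proof -
  let ?d = "\<lambda>s. x s - y s"
  have d: "?d \<in> ell2 I" by (rule ell2_diff[OF x y])
  have r: "ell2_inner I z ?d = ell2_inner I z x - ell2_inner I z y" if "z \<in> ell2 I" for z
    unfolding ell2_inner_commute[of I z ?d] ell2_inner_diff_left[OF x y that]
    by (simp add: ell2_inner_commute[symmetric])
  have "(ell2_norm I ?d)\<^sup>2 = Re (ell2_inner I ?d ?d)" by (simp add: ell2_inner_self[OF d])
  also have "ell2_inner I ?d ?d = ell2_inner I x x - ell2_inner I x y - (ell2_inner I y x - ell2_inner I y y)"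
    unfolding r[OF d] ell2_inner_diff_left[OF x y x] ell2_inner_diff_left[OF x y y] by simp
  also have "Re \<dots> \<le> (ell2_norm I x)\<^sup>2 + (ell2_norm I y)\<^sup>2 + 2 * (ell2_norm I x * ell2_norm I y)"
  proof -
    have "\<bar>Re (ell2_inner I x y)\<bar> \<le> ell2_norm I x * ell2_norm I y"
      using abs_Re_le_cmod ell2_Cauchy_Schwarz[OF x y] by (rule order_trans)
    moreover have "\<bar>Re (ell2_inner I y x)\<bar> \<le> ell2_norm I y * ell2_norm I x"
      using abs_Re_le_cmod ell2_Cauchy_Schwarz[OF y x] by (rule order_trans)
    ultimately show ?thesis using x y by (simp add: ell2_inner_self mult.commute)
  qed
  also have "\<dots> = (ell2_norm I x + ell2_norm I y)\<^sup>2" by (simp add: power2_sum)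
  finally show ?thesis by (rule power2_le_imp_le) (simp add: ell2_norm_nonneg)
qed

lemma ell2_norm_scale: "x \<in> ell2 I \<Longrightarrow> ell2_norm I (\<lambda>s. c * x s) = cmod c * ell2_norm I x"
proof -
  assume x: "x \<in> ell2 I"
  have "(\<Sum>\<^sub>\<infinity>s\<in>I. (cmod (c * x s))\<^sup>2) = (cmod c)\<^sup>2 * (\<Sum>\<^sub>\<infinity>s\<in>I. (cmod (x s))\<^sup>2)"
    by (simp add: norm_mult power_mult_distrib infsum_cmult_right')
  thus ?thesis by (simp add: ell2_norm_def real_sqrt_mult)
qed

text \<open>Compatibility with infinite sums in each coordinate takes the place of norm continuity.
  It holds for convolution by finitely supported functions, where each coordinate of the result
  involves finitely many coordinates.\<close>

locale ell2_local_contraction = ell2_contraction +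
  assumes series: "(\<And>s. summable (\<lambda>n. y n s)) \<Longrightarrow> (\<And>n. y n \<in> ell2 I) \<Longrightarrow>
    B (\<lambda>s. \<Sum>n. y n s) = (\<lambda>s. \<Sum>n. B (y n) s)"
begin

text \<open>\<open>sqrt (1 - B)\<close> by the binomial series, summed in each coordinate.\<close>

definition R :: "('a \<Rightarrow> complex) \<Rightarrow> 'a \<Rightarrow> complex"
  where "R x s = (\<Sum>n. of_real (sqrt_coeff n) * (B ^^ n) x s)"

text \<open>\<open>tail 0\<close> is \<open>1 - R\<close>; larger \<open>m\<close> isolate its
  remainders.\<close>

definition tail :: "nat \<Rightarrow> ('a \<Rightarrow> complex) \<Rightarrow> 'a \<Rightarrow> complex"
  where "tail m x s = (\<Sum>n. of_real (sqrt_tail (n + m)) * (B ^^ (Suc (n + m))) x s)"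

lemma pow_point_le: "x \<in> ell2 I \<Longrightarrow> cmod ((B ^^ n) x s) \<le> ell2_norm I x"
  using ell2_norm_point[OF pow_ell2] pow_norm_le by (rule order_trans)

lemma summable_R: "x \<in> ell2 I \<Longrightarrow> summable (\<lambda>n. of_real (sqrt_coeff n) * (B ^^ (n + m)) x s)"
proof (rule summable_comparison_test')
  assume x: "x \<in> ell2 I"
  show "summable (\<lambda>n. \<bar>sqrt_coeff n\<bar> * ell2_norm I x)"
    using summable_abs_sqrt_coeff by (rule summable_mult2)
  show "norm (of_real (sqrt_coeff n) * (B ^^ (n + m)) x s) \<le> \<bar>sqrt_coeff n\<bar> * ell2_norm I x" for n
    using pow_point_le[OF x] by (simp add: norm_mult mult_left_mono)
qed

lemma tail:
  assumes x: "x \<in> ell2 I"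
  shows "tail m x \<in> ell2 I" "ell2_norm I (tail m x) \<le> (\<Sum>n. sqrt_tail (n + m)) * ell2_norm I x"
    "summable (\<lambda>n. of_real (sqrt_tail n) * (B ^^ (Suc n)) x s)"
proof -
  have s: "summable (\<lambda>n. sqrt_tail (n + m))" for m
    using summable_sqrt_tail by (rule summable_ignore_initial_segment)
  note * = ell2_series[of "\<lambda>n. (B ^^ (Suc (n + m))) x" I "ell2_norm I x" "\<lambda>n. sqrt_tail (n + m)" for m,
      OF pow_ell2[OF x] pow_norm_le[OF x] sqrt_tail_nonneg s]
  show "tail m x \<in> ell2 I" "ell2_norm I (tail m x) \<le> (\<Sum>n. sqrt_tail (n + m)) * ell2_norm I x"
    unfolding tail_def using *(2,3)[of m] by simp_all
  show "summable (\<lambda>n. of_real (sqrt_tail n) * (B ^^ (Suc n)) x s)" using *(1)[of 0] by simp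
qed

lemma R_eq: "x \<in> ell2 I \<Longrightarrow> R x = (\<lambda>s. x s - tail 0 x s)"
proof
  fix s assume x: "x \<in> ell2 I"
  have "R x s = x s + (\<Sum>n. of_real (sqrt_coeff (Suc n)) * (B ^^ Suc n) x s)"
    unfolding R_def using summable_R[OF x, of 0 s] by (subst suminf_split_head) auto
  also have "(\<Sum>n. of_real (sqrt_coeff (Suc n)) * (B ^^ Suc n) x s) = - tail 0 x s"
  proof -
    have s: "summable (\<lambda>n. of_real (sqrt_coeff (Suc n)) * (B ^^ Suc n) x s)"
      using summable_R[OF x, of 0 s] by (subst summable_Suc_iff) simp
    have "tail 0 x s = (\<Sum>n. - (of_real (sqrt_coeff (Suc n)) * (B ^^ Suc n) x s))"
      by (simp add: tail_def sqrt_tail_def del: funpow.simps)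
    thus ?thesis by (simp only: suminf_minus[OF s] minus_minus)
  qed
  finally show "R x s = x s - tail 0 x s" by simp
qed

lemma R_ell2: "x \<in> ell2 I \<Longrightarrow> R x \<in> ell2 I"
  by (simp add: R_eq ell2_diff tail)

text \<open>The assumption \<open>series\<close> lets \<open>B\<close> pass through the sum; this
  turns \<open>R (R x)\<close> into a double series in the powers of \<open>B\<close>.\<close>

lemma pow_R:
  assumes x: "x \<in> ell2 I"
  shows "(B ^^ m) (R x) = (\<lambda>s. \<Sum>n. of_real (sqrt_coeff n) * (B ^^ (n + m)) x s)"
proof (induction m)
  case 0
  show ?case by (simp add: R_def fun_eq_iff)
next
  case (Suc m)
  have "(B ^^ Suc m) (R x) = B (\<lambda>s. \<Sum>n. of_real (sqrt_coeff n) * (B ^^ (n + m)) x s)"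
    by (simp add: Suc)
  also have "\<dots> = (\<lambda>s. \<Sum>n. B (\<lambda>s. of_real (sqrt_coeff n) * (B ^^ (n + m)) x s) s)"
    by (rule series[OF summable_R[OF x] ell2_scale[OF pow_ell2[OF x]]])
  also have "\<dots> = (\<lambda>s. \<Sum>n. of_real (sqrt_coeff n) * (B ^^ (n + Suc m)) x s)"
    by (simp add: scale[OF pow_ell2[OF x]])
  finally show ?case .
qed

lemma R_R:
  assumes x: "x \<in> ell2 I" shows "R (R x) = (\<lambda>s. x s - B x s)"
proof
  fix s
  have "R (R x) s = (\<Sum>m. of_real (sqrt_coeff m) * (\<Sum>n. of_real (sqrt_coeff n) * (B ^^ (n + m)) x s))"
    by (simp only: R_def[of "R x"] pow_R[OF x])
  also have "\<dots> = (B ^^ 0) x s - (B ^^ 1) x s"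
    by (rule sqrt_series_square[OF pow_point_le[OF x]])
  finally show "R (R x) s = x s - B x s" by simp
qed

lemma R_bounded: "bounded_operator I R"
  unfolding bounded_operator_def
proof (intro conjI ballI allI exI)
  show "R \<in> ell2 I \<rightarrow> ell2 I" using R_ell2 by auto
next
  fix x y assume xy: "x \<in> ell2 I" "y \<in> ell2 I"
  show "R (\<lambda>s. x s + y s) = (\<lambda>s. R x s + R y s)"
    unfolding R_def pow_add[OF xy] distrib_left
    using suminf_add[OF summable_R[OF xy(1), of 0] summable_R[OF xy(2), of 0]] by simp
next
  fix c x assume x: "x \<in> ell2 I"
  show "R (\<lambda>s. c * x s) = (\<lambda>s. c * R x s)"
    unfolding R_def pow_scale[OF x] using suminf_mult[OF summable_R[OF x, of 0], of c]
    by (simp add: mult.left_commute)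
next
  fix x assume x: "x \<in> ell2 I"
  have "ell2_norm I (R x) \<le> ell2_norm I x + ell2_norm I (tail 0 x)"
    unfolding R_eq[OF x] by (intro ell2_norm_diff_le x tail)
  also have "ell2_norm I (tail 0 x) \<le> 1 * ell2_norm I x"
    using tail(2)[OF x, of 0] suminf_sqrt_tail_le
    by (intro order_trans[OF tail(2)[OF x, of 0]] mult_right_mono) (simp_all add: ell2_norm_nonneg)
  finally show "ell2_norm I (R x) \<le> 2 * ell2_norm I x" by simp
qed

lemma pow_inner_real: "x \<in> ell2 I \<Longrightarrow> Im (ell2_inner I ((B ^^ n) x) x) = 0"
proof -
  assume x: "x \<in> ell2 I"
  have "cnj (ell2_inner I ((B ^^ n) x) x) = ell2_inner I ((B ^^ n) x) x"
    using pow_sym[OF x x, of n] ell2_inner_commute[of I x "(B ^^ n) x"] by simp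
  thus ?thesis by (simp add: complex_eq_iff)
qed

text \<open>Finitely many terms contribute real numbers by symmetry, and the norm of the remainder
  is bounded by a tail of a convergent series. In this way the inner product is never interchanged
  with an infinite sum.\<close>

lemma tail_inner_real:
  assumes x: "x \<in> ell2 I" shows "Im (ell2_inner I (tail 0 x) x) = 0"
proof -
  have split: "tail 0 x = (\<lambda>s. (\<Sum>n<m. of_real (sqrt_tail n) * (B ^^ Suc n) x s) + tail m x s)" for m
    using suminf_split_initial_segment[OF tail(3)[OF x], of _ m] by (auto simp: tail_def fun_eq_iff)
  have bound: "\<bar>Im (ell2_inner I (tail 0 x) x)\<bar> \<le> (\<Sum>n. sqrt_tail (n + m)) * ell2_norm I x * ell2_norm I x" for m
  proof -
    let ?y = "\<lambda>s. \<Sum>n<m. of_real (sqrt_tail n) * (B ^^ Suc n) x s"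
    have "ell2_inner I (tail 0 x) x = ell2_inner I ?y x + ell2_inner I (tail m x) x"
      unfolding split[of m] by (intro ell2_inner_add_left ell2_sum ell2_scale pow_ell2 tail x)
    also have "ell2_inner I ?y x = (\<Sum>n<m. of_real (sqrt_tail n) * ell2_inner I ((B ^^ Suc n) x) x)"
      by (subst ell2_inner_sum_left) (auto intro!: ell2_scale pow_ell2 x simp: ell2_inner_scale_left simp del: funpow.simps)
    finally have "Im (ell2_inner I (tail 0 x) x) = Im (ell2_inner I (tail m x) x)"
      using pow_inner_real[OF x] by (simp del: funpow.simps)
    also have "\<bar>\<dots>\<bar> \<le> ell2_norm I (tail m x) * ell2_norm I x"
      using abs_Im_le_cmod ell2_Cauchy_Schwarz[OF tail(1)[OF x] x] by (rule order_trans)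
    also have "\<dots> \<le> (\<Sum>n. sqrt_tail (n + m)) * ell2_norm I x * ell2_norm I x"
      by (intro mult_right_mono tail x ell2_norm_nonneg)
    finally show ?thesis .
  qed
  have "(\<lambda>m. (\<Sum>n. sqrt_tail (n + m)) * ell2_norm I x * ell2_norm I x) \<longlonglongrightarrow> 0 * ell2_norm I x * ell2_norm I x"
    by (intro tendsto_mult tendsto_const suminf_exist_split2 summable_sqrt_tail)
  hence "\<bar>Im (ell2_inner I (tail 0 x) x)\<bar> \<le> 0 * ell2_norm I x * ell2_norm I x"
    by (rule LIMSEQ_le_const) (use bound in auto)
  thus ?thesis by simp
qed

text \<open>The norm of \<open>tail 0 x\<close> is at most that of \<open>x\<close>, because its
  coefficients sum to at most 1; subtracting it cannot make the form negative.\<close>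

lemma R_positive: "positive_operator I R"
  unfolding positive_operator_def
proof (intro conjI ballI R_bounded)
  fix x assume x: "x \<in> ell2 I"
  have eq: "ell2_inner I (R x) x = of_real ((ell2_norm I x)\<^sup>2) - ell2_inner I (tail 0 x) x"
    unfolding R_eq[OF x] by (simp add: ell2_inner_diff_left x tail ell2_inner_self)
  have "Re (ell2_inner I (tail 0 x) x) \<le> ell2_norm I (tail 0 x) * ell2_norm I x"
    using complex_Re_le_cmod ell2_Cauchy_Schwarz[OF tail(1)[OF x] x] by (rule order_trans)
  also have "\<dots> \<le> (1 * ell2_norm I x) * ell2_norm I x"
    using suminf_sqrt_tail_le
    by (intro mult_right_mono order_trans[OF tail(2)[OF x, of 0]] mult_right_mono) (simp_all add: ell2_norm_nonneg)
  finally have "Re (ell2_inner I (R x) x) \<ge> 0" by (simp add: eq power2_eq_square)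
  moreover have "Im (ell2_inner I (R x) x) = 0" by (simp add: eq tail_inner_real[OF x])
  ultimately show "ell2_inner I (R x) x \<in> \<real>\<^sub>\<ge>\<^sub>0" by (simp add: complex_nonneg_Reals_iff)
qed

end

text \<open>The operator \<open>B = 1 - P / c\<close> lies between 0 and 1, and the root of
  \<open>1 - B\<close> is multiplied by \<open>sqrt c\<close>.\<close>

lemma positive_operator_sqrt_exists:
  assumes P: "ell2_symmetric I P" and c: "c > 0"
    and pos: "\<And>x. x \<in> ell2 I \<Longrightarrow> 0 \<le> Re (ell2_inner I (P x) x)"
    and le: "\<And>x. x \<in> ell2 I \<Longrightarrow> Re (ell2_inner I (P x) x) \<le> c * (ell2_norm I x)\<^sup>2"
    and series: "\<And>y. (\<And>s. summable (\<lambda>n. y n s)) \<Longrightarrow>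
      P (\<lambda>s. \<Sum>n. y n s) = (\<lambda>s. \<Sum>n. P (y n) s) \<and> (\<forall>s. summable (\<lambda>n. P (y n) s))"
  shows "\<exists>R. positive_operator I R \<and> (\<forall>x\<in>ell2 I. R (R x) = P x)"
proof -
  interpret P: ell2_symmetric I P by fact
  define B where "B x = (\<lambda>s. x s - of_real (1 / c) * P x s)" for x
  have inner: "ell2_inner I (B x) y = ell2_inner I x y - of_real (1 / c) * ell2_inner I (P x) y"
    if "x \<in> ell2 I" "y \<in> ell2 I" for x y
    using that unfolding B_def
    by (simp only: ell2_inner_diff_left ell2_scale P.ell2 ell2_inner_scale_left)
  interpret B: ell2_local_contraction I B
  proof unfold_locales
    fix x assume x: "x \<in> ell2 I"
    show "B x \<in> ell2 I" unfolding B_def by (intro ell2_diff ell2_scale P.ell2 x)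
    show "B (\<lambda>s. a * x s) = (\<lambda>s. a * B x s)" for a
      unfolding B_def P.scale[OF x] by (simp add: algebra_simps)
    have "Re (ell2_inner I (B x) x) = (ell2_norm I x)\<^sup>2 - Re (ell2_inner I (P x) x) / c"
      unfolding inner[OF x x] by (simp add: ell2_inner_self x)
    moreover have "0 \<le> Re (ell2_inner I (P x) x) / c" using pos[OF x] c by simp
    moreover have "Re (ell2_inner I (P x) x) / c \<le> (ell2_norm I x)\<^sup>2"
      using le[OF x] c by (simp add: divide_le_eq mult.commute)
    ultimately show "0 \<le> Re (ell2_inner I (B x) x)" "Re (ell2_inner I (B x) x) \<le> (ell2_norm I x)\<^sup>2"
      by linarith+
    fix y assume y: "y \<in> ell2 I"
    show "B (\<lambda>s. x s + y s) = (\<lambda>s. B x s + B y s)"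
      unfolding B_def P.add[OF x y] by (simp add: algebra_simps)
    show "ell2_inner I (B x) y = ell2_inner I x (B y)"
      unfolding ell2_inner_commute[of I x "B y"] inner[OF x y] inner[OF y x] P.sym[OF x y]
      by (simp add: ell2_inner_commute[symmetric])
  next
    fix y :: "nat \<Rightarrow> 'a \<Rightarrow> complex"
    assume s: "\<And>s. summable (\<lambda>n. y n s)"
    show "B (\<lambda>s. \<Sum>n. y n s) = (\<lambda>s. \<Sum>n. B (y n) s)"
    proof
      fix t
      have P: "P (\<lambda>s. \<Sum>n. y n s) = (\<lambda>s. \<Sum>n. P (y n) s)" "summable (\<lambda>n. P (y n) t)"
        using series[of y] s by auto
      show "B (\<lambda>s. \<Sum>n. y n s) t = (\<Sum>n. B (y n) t)"
        unfolding B_def P(1) suminf_mult[OF P(2), symmetric]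
        by (rule suminf_diff[OF s summable_mult[OF P(2)]])
    qed
  qed
  define R where "R x = (\<lambda>s. of_real (sqrt c) * B.R x s)" for x
  have bR: "bounded_operator I B.R" by (rule B.R_bounded)
  have "bounded_operator I R"
    unfolding bounded_operator_def
  proof (intro conjI ballI allI)
    show "R \<in> ell2 I \<rightarrow> ell2 I"
    proof
      fix x assume x: "x \<in> ell2 I"
      show "R x \<in> ell2 I" unfolding R_def by (rule ell2_scale[OF B.R_ell2[OF x]])
    qed
  next
    fix x y assume xy: "x \<in> ell2 I" "y \<in> ell2 I"
    have "B.R (\<lambda>s. x s + y s) = (\<lambda>s. B.R x s + B.R y s)" using bR xy by (auto simp: bounded_operator_def)
    thus "R (\<lambda>s. x s + y s) = (\<lambda>s. R x s + R y s)" by (simp add: R_def algebra_simps)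
  next
    fix a x assume x: "x \<in> ell2 I"
    have "B.R (\<lambda>s. a * x s) = (\<lambda>s. a * B.R x s)" using bR x by (auto simp: bounded_operator_def)
    thus "R (\<lambda>s. a * x s) = (\<lambda>s. a * R x s)" by (simp add: R_def algebra_simps)
  next
    obtain C where C: "\<forall>x\<in>ell2 I. ell2_norm I (B.R x) \<le> C * ell2_norm I x"
      using bR unfolding bounded_operator_def by blast
    have "ell2_norm I (R x) \<le> (sqrt c * C) * ell2_norm I x" if "x \<in> ell2 I" for x
      using C that c by (simp add: R_def ell2_norm_scale B.R_ell2 mult.assoc)
    thus "\<exists>C. \<forall>x\<in>ell2 I. ell2_norm I (R x) \<le> C * ell2_norm I x" by blast
  qed
  moreover have "ell2_inner I (R x) x \<in> \<real>\<^sub>\<ge>\<^sub>0" if x: "x \<in> ell2 I" for x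
  proof -
    have "ell2_inner I (B.R x) x \<in> \<real>\<^sub>\<ge>\<^sub>0" using B.R_positive x by (auto simp: positive_operator_def)
    thus ?thesis using c by (auto simp: R_def ell2_inner_scale_left complex_nonneg_Reals_iff)
  qed
  moreover have "R (R x) = P x" if x: "x \<in> ell2 I" for x
  proof
    fix s
    have "B.R (R x) = (\<lambda>s. of_real (sqrt c) * B.R (B.R x) s)"
      using bR B.R_ell2[OF x] unfolding R_def by (auto simp: bounded_operator_def)
    hence "R (R x) s = of_real (sqrt c) * (of_real (sqrt c) * (x s - B x s))"
      by (simp add: R_def[of "R x"] B.R_R[OF x])
    also have "\<dots> = of_real (sqrt c * sqrt c) * (of_real (1 / c) * P x s)"
      by (simp only: B_def of_real_mult mult.assoc) simp
    also have "\<dots> = P x s" using c by simp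
    finally show "R (R x) s = P x s" .
  qed
  ultimately show ?thesis by (auto simp: positive_operator_def)
qed

section \<open>Left multiplication operators, their adjoints and square roots\<close>

lemma ell2_norm_add_le:
  assumes x: "x \<in> ell2 I" and y: "y \<in> ell2 I"
  shows "ell2_norm I (\<lambda>s. x s + y s) \<le> ell2_norm I x + ell2_norm I y"
  using ell2_norm_diff_le[OF x ell2_scale[OF y, of "-1"]] ell2_norm_scale[OF y, of "-1"] by simp

lemma ell2_norm_sum_le:
  assumes "\<And>i. i \<in> J \<Longrightarrow> x i \<in> ell2 I"
  shows "ell2_norm I (\<lambda>s. \<Sum>i\<in>J. x i s) \<le> (\<Sum>i\<in>J. ell2_norm I (x i))"
  using assms
proof (induction J rule: infinite_finite_induct)
  case (insert i J)
  have "ell2_norm I (\<lambda>s. x i s + (\<Sum>i\<in>J. x i s)) \<le> ell2_norm I (x i) + ell2_norm I (\<lambda>s. \<Sum>i\<in>J. x i s)"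
    using insert.prems by (intro ell2_norm_add_le ell2_sum) auto
  also have "ell2_norm I (\<lambda>s. \<Sum>i\<in>J. x i s) \<le> (\<Sum>i\<in>J. ell2_norm I (x i))"
    using insert.prems by (intro insert.IH) auto
  finally show ?case using insert.hyps by simp
qed (simp_all add: ell2_norm_def)

lemma left_mult_operator_suminf:
  assumes "\<And>s. summable (\<lambda>n. y n s)"
  shows "left_mult_operator G f (\<lambda>s. \<Sum>n. y n s) = (\<lambda>s. \<Sum>n. left_mult_operator G f (y n) s)"
    and "summable (\<lambda>n. left_mult_operator G f (y n) s)"
proof -
  show "summable (\<lambda>n. left_mult_operator G f (y n) s)"
    by (cases "s \<in> carrier G") (simp_all add: left_mult_operator_def summable_sum summable_mult assms)
  show "left_mult_operator G f (\<lambda>s. \<Sum>n. y n s) = (\<lambda>s. \<Sum>n. left_mult_operator G f (y n) s)"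
  proof
    fix t
    have "(\<Sum>n. \<Sum>s | f s \<noteq> 0. f s * y n (inv\<^bsub>G\<^esub> s \<otimes>\<^bsub>G\<^esub> t)) =
        (\<Sum>s | f s \<noteq> 0. f s * (\<Sum>n. y n (inv\<^bsub>G\<^esub> s \<otimes>\<^bsub>G\<^esub> t)))"
      by (subst suminf_sum) (auto intro!: summable_mult assms sum.cong suminf_mult)
    thus "left_mult_operator G f (\<lambda>s. \<Sum>n. y n s) t = (\<Sum>n. left_mult_operator G f (y n) t)"
      by (simp add: left_mult_operator_def)
  qed
qed

text \<open>The involution of the group ring; left multiplication by it is the adjoint.\<close>

definition group_ring_star :: "('a, 'm) monoid_scheme \<Rightarrow> ('a \<Rightarrow> complex) \<Rightarrow> 'a \<Rightarrow> complex"
  where "group_ring_star G f s = (if s \<in> carrier G then cnj (f (inv\<^bsub>G\<^esub> s)) else 0)"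

context group
begin

definition left_shift :: "'a \<Rightarrow> ('a \<Rightarrow> complex) \<Rightarrow> 'a \<Rightarrow> complex"
  where "left_shift s x t = (if t \<in> carrier G then x (inv s \<otimes> t) else 0)"

text \<open>Right translations commute with left multiplications and carry the unit vector at
  \<open>\<one>\<close> to every other one, so such operators have constant diagonal.\<close>

definition right_shift :: "'a \<Rightarrow> ('a \<Rightarrow> complex) \<Rightarrow> 'a \<Rightarrow> complex"
  where "right_shift g x t = (if t \<in> carrier G then x (t \<otimes> g) else 0)"

lemma bij_left: "s \<in> carrier G \<Longrightarrow> bij_betw (\<lambda>t. s \<otimes> t) (carrier G) (carrier G)"
  by (intro bij_betw_byWitness[where f' = "\<lambda>t. inv s \<otimes> t"]) (auto simp flip: m_assoc)

lemma bij_right: "s \<in> carrier G \<Longrightarrow> bij_betw (\<lambda>t. t \<otimes> s) (carrier G) (carrier G)"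
  by (intro bij_betw_byWitness[where f' = "\<lambda>t. t \<otimes> inv s"]) (auto simp: m_assoc)

lemma left_shift_ell2:
  assumes s: "s \<in> carrier G" and x: "x \<in> ell2 (carrier G)"
  shows "left_shift s x \<in> ell2 (carrier G)" "ell2_norm (carrier G) (left_shift s x) = ell2_norm (carrier G) x"
proof -
  have b: "bij_betw (\<lambda>t. inv s \<otimes> t) (carrier G) (carrier G)" using s by (intro bij_left) auto
  have "(\<lambda>t. (cmod (x (inv s \<otimes> t)))\<^sup>2) summable_on carrier G"
    using summable_on_reindex_bij_betw[OF b, of "\<lambda>t. (cmod (x t))\<^sup>2"] ell2_summable[OF x] by simp
  hence "(\<lambda>t. (cmod (left_shift s x t))\<^sup>2) summable_on carrier G"
    by (rule summable_on_cong[THEN iffD1, rotated]) (simp add: left_shift_def)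
  thus "left_shift s x \<in> ell2 (carrier G)" by (simp add: ell2_def left_shift_def)
  have "(\<Sum>\<^sub>\<infinity>t\<in>carrier G. (cmod (left_shift s x t))\<^sup>2) = (\<Sum>\<^sub>\<infinity>t\<in>carrier G. (cmod (x (inv s \<otimes> t)))\<^sup>2)"
    by (rule infsum_cong) (simp add: left_shift_def)
  also have "\<dots> = (\<Sum>\<^sub>\<infinity>t\<in>carrier G. (cmod (x t))\<^sup>2)"
    by (rule infsum_reindex_bij_betw[OF b])
  finally show "ell2_norm (carrier G) (left_shift s x) = ell2_norm (carrier G) x" by (simp add: ell2_norm_def)
qed

lemma left_shift_inner:
  assumes s: "s \<in> carrier G"
  shows "ell2_inner (carrier G) (left_shift s x) y = ell2_inner (carrier G) x (left_shift (inv s) y)"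
proof -
  have "ell2_inner (carrier G) x (left_shift (inv s) y) = (\<Sum>\<^sub>\<infinity>t\<in>carrier G. x (inv s \<otimes> (s \<otimes> t)) * cnj (y (s \<otimes> t)))"
    unfolding ell2_inner_def using s by (intro infsum_cong) (simp add: left_shift_def flip: m_assoc)
  also have "\<dots> = (\<Sum>\<^sub>\<infinity>t\<in>carrier G. x (inv s \<otimes> t) * cnj (y t))"
    by (rule infsum_reindex_bij_betw[OF bij_left[OF s]])
  also have "\<dots> = ell2_inner (carrier G) (left_shift s x) y"
    unfolding ell2_inner_def by (intro infsum_cong) (simp add: left_shift_def)
  finally show ?thesis ..
qed

lemma right_shift_inner:
  assumes g: "g \<in> carrier G"
  shows "ell2_inner (carrier G) (right_shift g x) (right_shift g y) = ell2_inner (carrier G) x y"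
proof -
  have "ell2_inner (carrier G) (right_shift g x) (right_shift g y) = (\<Sum>\<^sub>\<infinity>t\<in>carrier G. x (t \<otimes> g) * cnj (y (t \<otimes> g)))"
    unfolding ell2_inner_def by (intro infsum_cong) (simp add: right_shift_def)
  also have "\<dots> = ell2_inner (carrier G) x y"
    unfolding ell2_inner_def by (rule infsum_reindex_bij_betw[OF bij_right[OF g]])
  finally show ?thesis .
qed

lemma right_shift_indicator:
  assumes u: "u \<in> carrier G"
  shows "right_shift (inv u) (indicator {\<one>}) = indicator {u}"
proof
  fix t
  have "t \<otimes> inv u = \<one> \<longleftrightarrow> t = u" if "t \<in> carrier G"
    using that u by (metis inv_closed inv_equality inv_inv r_inv)
  thus "right_shift (inv u) (indicator {\<one>}) t = indicator {u} t"
    using u by (auto simp: right_shift_def indicator_def)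
qed

end

locale group_ring_element = group G for G (structure) +
  fixes f :: "'a \<Rightarrow> complex"
  assumes f: "f \<in> group_ring G"
begin

abbreviation I where "I \<equiv> carrier G"
abbreviation T where "T \<equiv> left_mult_operator G f"

lemma supp: "finite {s. f s \<noteq> 0}" "{s. f s \<noteq> 0} \<subseteq> carrier G"
  using f by (auto simp: group_ring_def)

lemma T_eq: "T x = (\<lambda>t. \<Sum>s | f s \<noteq> 0. f s * left_shift s x t)"
  by (auto simp: left_mult_operator_def left_shift_def fun_eq_iff)

lemma T_ell2:
  assumes x: "x \<in> ell2 I" shows "T x \<in> ell2 I"
  unfolding T_eq using supp x by (intro ell2_sum ell2_scale left_shift_ell2) auto

lemma T_norm_le:
  assumes x: "x \<in> ell2 I" shows "ell2_norm I (T x) \<le> (\<Sum>s | f s \<noteq> 0. cmod (f s)) * ell2_norm I x"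
proof -
  have s: "left_shift s x \<in> ell2 I" "ell2_norm I (left_shift s x) = ell2_norm I x" if "f s \<noteq> 0" for s
    using that supp left_shift_ell2[OF _ x, of s] by auto
  have "ell2_norm I (T x) \<le> (\<Sum>s | f s \<noteq> 0. ell2_norm I (\<lambda>t. f s * left_shift s x t))"
    unfolding T_eq by (rule ell2_norm_sum_le) (auto intro: ell2_scale s)
  also have "\<dots> = (\<Sum>s | f s \<noteq> 0. cmod (f s) * ell2_norm I x)"
    by (intro sum.cong refl) (simp add: ell2_norm_scale s)
  finally show ?thesis by (simp add: sum_distrib_right)
qed

lemma T_add: "T (\<lambda>s. x s + y s) = (\<lambda>s. T x s + T y s)"
  by (auto simp: left_mult_operator_def distrib_left sum.distrib fun_eq_iff)

lemma T_scale: "T (\<lambda>s. c * x s) = (\<lambda>s. c * T x s)"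
  by (auto simp: left_mult_operator_def sum_distrib_left mult_ac fun_eq_iff)

lemma T_bounded: "bounded_operator I T"
  unfolding bounded_operator_def using T_ell2 T_norm_le by (auto simp: T_add T_scale)

lemma T_right_shift:
  assumes g: "g \<in> carrier G" shows "T (right_shift g x) = right_shift g (T x)"
proof
  fix t
  show "T (right_shift g x) t = right_shift g (T x) t"
  proof (cases "t \<in> carrier G")
    case True
    have "(\<Sum>s | f s \<noteq> 0. f s * right_shift g x (inv s \<otimes> t)) = (\<Sum>s | f s \<noteq> 0. f s * x (inv s \<otimes> (t \<otimes> g)))"
    proof (intro sum.cong refl)
      fix s assume "s \<in> {s. f s \<noteq> 0}"
      hence "s \<in> carrier G" using supp by auto
      thus "f s * right_shift g x (inv s \<otimes> t) = f s * x (inv s \<otimes> (t \<otimes> g))"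
        using True g by (simp add: right_shift_def m_assoc)
    qed
    thus ?thesis using True g by (simp add: left_mult_operator_def right_shift_def)
  qed (simp add: left_mult_operator_def right_shift_def)
qed

lemma T_indicator:
  assumes "u \<in> carrier G" "t \<in> carrier G"
  shows "T (indicator {u}) t = f (t \<otimes> inv u)"
proof -
  have eq: "inv s \<otimes> t = u \<longleftrightarrow> s = t \<otimes> inv u" if "s \<in> carrier G" for s
    using that assms by (metis inv_solve_left inv_solve_right m_closed inv_closed inv_inv)
  have "T (indicator {u}) t = (\<Sum>s | f s \<noteq> 0. if s = t \<otimes> inv u then f s else 0)"
    unfolding left_mult_operator_def if_P[OF assms(2)]
  proof (intro sum.cong refl)
    fix s assume "s \<in> {s. f s \<noteq> 0}"
    hence "s \<in> carrier G" using supp by auto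
    thus "f s * indicator {u} (inv s \<otimes> t) = (if s = t \<otimes> inv u then f s else 0)"
      using eq by (simp add: indicator_def)
  qed
  also have "\<dots> = f (t \<otimes> inv u)" using supp by (simp add: sum.delta')
  finally show ?thesis .
qed

lemma star: "group_ring_star G f \<in> group_ring G"
  "{s. group_ring_star G f s \<noteq> 0} = m_inv G ` {s. f s \<noteq> 0}"
proof -
  show *: "{s. group_ring_star G f s \<noteq> 0} = m_inv G ` {s. f s \<noteq> 0}"
  proof (intro equalityI subsetI)
    fix s assume "s \<in> {s. group_ring_star G f s \<noteq> 0}"
    hence "s \<in> carrier G" "f (inv s) \<noteq> 0" by (auto simp: group_ring_star_def split: if_splits)
    thus "s \<in> m_inv G ` {s. f s \<noteq> 0}" by (intro image_eqI[of _ _ "inv s"]) auto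
  next
    fix s assume "s \<in> m_inv G ` {s. f s \<noteq> 0}"
    then obtain u where "s = inv u" "f u \<noteq> 0" "u \<in> carrier G" using supp by auto
    thus "s \<in> {s. group_ring_star G f s \<noteq> 0}" by (simp add: group_ring_star_def)
  qed
  show "group_ring_star G f \<in> group_ring G"
    using supp by (auto simp: group_ring_def *)
qed

lemma star_adjoint:
  assumes x: "x \<in> ell2 I" and y: "y \<in> ell2 I"
  shows "ell2_inner I (T x) y = ell2_inner I x (left_mult_operator G (group_ring_star G f) y)"
proof -
  interpret s: group_ring_element G "group_ring_star G f" by unfold_locales (rule star)
  have inj: "inj_on (m_inv G) {s. f s \<noteq> 0}" using supp inv_inj by (meson inj_on_subset)
  have "ell2_inner I (T x) y = (\<Sum>s | f s \<noteq> 0. f s * ell2_inner I (left_shift s x) y)"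
    unfolding T_eq using supp x y
    by (subst ell2_inner_sum_left) (auto intro!: ell2_scale left_shift_ell2 simp: ell2_inner_scale_left)
  also have "\<dots> = (\<Sum>s | f s \<noteq> 0. f s * cnj (ell2_inner I (left_shift (inv s) y) x))"
  proof (intro sum.cong refl)
    fix s assume "s \<in> {s. f s \<noteq> 0}"
    hence "s \<in> carrier G" using supp by auto
    thus "f s * ell2_inner I (left_shift s x) y = f s * cnj (ell2_inner I (left_shift (inv s) y) x)"
      by (simp only: left_shift_inner ell2_inner_commute[of I x "left_shift (inv s) y"])
  qed
  also have "\<dots> = cnj (\<Sum>s | f s \<noteq> 0. group_ring_star G f (inv s) * ell2_inner I (left_shift (inv s) y) x)"
    using supp by (auto simp: group_ring_star_def intro!: sum.cong)
  also have "(\<Sum>s | f s \<noteq> 0. group_ring_star G f (inv s) * ell2_inner I (left_shift (inv s) y) x) =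
      (\<Sum>s | group_ring_star G f s \<noteq> 0. group_ring_star G f s * ell2_inner I (left_shift s y) x)"
    unfolding star(2) by (subst sum.reindex[OF inj]) simp
  also have "\<dots> = ell2_inner I (left_mult_operator G (group_ring_star G f) y) x"
    unfolding s.T_eq using s.supp x y
    by (subst ell2_inner_sum_left) (auto intro!: ell2_scale left_shift_ell2 simp: ell2_inner_scale_left)
  also have "cnj \<dots> = ell2_inner I x (left_mult_operator G (group_ring_star G f) y)"
    by (rule ell2_inner_commute[symmetric])
  finally show ?thesis .
qed

text \<open>The concrete form of \<open>adjoint_operator I T \<circ> T\<close>, free of choice and
  defined on all functions; the two agree on \<open>ell2 I\<close>.\<close>

definition P :: "('a \<Rightarrow> complex) \<Rightarrow> 'a \<Rightarrow> complex"
  where "P x = left_mult_operator G (group_ring_star G f) (T x)"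

lemma star_element: "group_ring_element G (group_ring_star G f)"
  by unfold_locales (rule star)

lemmas star_T_ell2 = group_ring_element.T_ell2[OF star_element]
  and star_T_add = group_ring_element.T_add[OF star_element]
  and star_T_scale = group_ring_element.T_scale[OF star_element]
  and star_T_bounded = group_ring_element.T_bounded[OF star_element]
  and star_T_right_shift = group_ring_element.T_right_shift[OF star_element]

lemma P_inner: "x \<in> ell2 I \<Longrightarrow> y \<in> ell2 I \<Longrightarrow> ell2_inner I (P x) y = ell2_inner I (T x) (T y)"
  unfolding P_def
  by (subst ell2_inner_commute, subst star_adjoint[symmetric])
    (simp_all add: T_ell2 ell2_inner_commute[symmetric])

text \<open>The choice is constrained on \<open>ell2 I\<close> alone, and there the inner products
  with all vectors determine it.\<close>

lemma adjoint_operator_eq: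
  assumes y: "y \<in> ell2 I"
  shows "adjoint_operator I T y = left_mult_operator G (group_ring_star G f) y"
proof -
  define Q where "Q S \<longleftrightarrow> bounded_operator I S \<and>
    (\<forall>x\<in>ell2 I. \<forall>y\<in>ell2 I. ell2_inner I (T x) y = ell2_inner I x (S y))" for S
  have eq: "adjoint_operator I T = (SOME S. Q S)" by (simp add: adjoint_operator_def Q_def)
  have "Q (left_mult_operator G (group_ring_star G f))"
    unfolding Q_def using star_T_bounded star_adjoint by blast
  hence Q: "Q (adjoint_operator I T)" unfolding eq by (rule someI[of Q])
  have A: "adjoint_operator I T y \<in> ell2 I" using Q y by (auto simp: Q_def bounded_operator_def)
  show ?thesis
  proof (rule ell2_eqI[OF A star_T_ell2[OF y]])
    fix z assume z: "z \<in> ell2 I"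
    have "ell2_inner I z (adjoint_operator I T y) = ell2_inner I z (left_mult_operator G (group_ring_star G f) y)"
      using Q z y unfolding Q_def star_adjoint[OF z y, symmetric] by simp
    thus "ell2_inner I (adjoint_operator I T y) z = ell2_inner I (left_mult_operator G (group_ring_star G f) y) z"
      unfolding ell2_inner_commute[where x = z] by simp
  qed
qed

lemma P_symmetric: "ell2_symmetric I P"
proof
  fix x assume x: "x \<in> ell2 I"
  show "P x \<in> ell2 I" unfolding P_def by (intro star_T_ell2 T_ell2 x)
  show "P (\<lambda>s. c * x s) = (\<lambda>s. c * P x s)" for c by (simp add: P_def T_scale star_T_scale)
  fix y assume y: "y \<in> ell2 I"
  show "P (\<lambda>s. x s + y s) = (\<lambda>s. P x s + P y s)" by (simp add: P_def T_add star_T_add)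
  show "ell2_inner I (P x) y = ell2_inner I x (P y)"
    unfolding P_inner[OF x y] ell2_inner_commute[of I x "P y"] P_inner[OF y x]
    by (simp add: ell2_inner_commute[symmetric])
qed

sublocale P: ell2_symmetric I P by (rule P_symmetric)

text \<open>The 1 keeps the bound positive when \<open>f\<close> is 0.\<close>

definition P_bound :: real where "P_bound = (\<Sum>s | f s \<noteq> 0. cmod (f s))\<^sup>2 + 1"

lemma P_bound_pos: "P_bound > 0" by (simp add: P_bound_def add_nonneg_pos)

lemma P_pos: "x \<in> ell2 I \<Longrightarrow> 0 \<le> Re (ell2_inner I (P x) x)"
  by (simp add: P_inner ell2_inner_self T_ell2)

lemma P_le: "x \<in> ell2 I \<Longrightarrow> Re (ell2_inner I (P x) x) \<le> P_bound * (ell2_norm I x)\<^sup>2"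
proof -
  assume x: "x \<in> ell2 I"
  have "Re (ell2_inner I (P x) x) = (ell2_norm I (T x))\<^sup>2" using x by (simp add: P_inner ell2_inner_self T_ell2)
  also have "\<dots> \<le> ((\<Sum>s | f s \<noteq> 0. cmod (f s)) * ell2_norm I x)\<^sup>2"
    by (intro power_mono T_norm_le x ell2_norm_nonneg)
  also have "\<dots> \<le> P_bound * (ell2_norm I x)\<^sup>2"
    by (simp add: P_bound_def power_mult_distrib distrib_right)
  finally show ?thesis .
qed

definition R :: "('a \<Rightarrow> complex) \<Rightarrow> 'a \<Rightarrow> complex"
  where "R = sqrt_operator I (adjoint_operator I T \<circ> T)"

text \<open>A root of \<open>P\<close> exists by the binomial series, so the operator picked by
  \<open>SOME\<close> meets its specification, which is all that is drawn from it later.\<close>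

lemma R: "positive_operator I R" "x \<in> ell2 I \<Longrightarrow> R (R x) = P x"
proof -
  have "\<exists>R. positive_operator I R \<and> (\<forall>x\<in>ell2 I. R (R x) = P x)"
  proof (rule positive_operator_sqrt_exists[OF P_symmetric P_bound_pos P_pos P_le])
    fix y :: "nat \<Rightarrow> 'a \<Rightarrow> complex" assume y: "\<And>s. summable (\<lambda>n. y n s)"
    note 1 = left_mult_operator_suminf[OF y]
    note 2 = left_mult_operator_suminf[OF 1(2)]
    show "P (\<lambda>s. \<Sum>n. y n s) = (\<lambda>s. \<Sum>n. P (y n) s) \<and> (\<forall>s. summable (\<lambda>n. P (y n) s))"
      unfolding P_def 1(1) using 2 by auto
  qed auto
  moreover have "(adjoint_operator I T \<circ> T) x = P x" if "x \<in> ell2 I" for x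
    using that by (simp add: adjoint_operator_eq T_ell2 P_def)
  ultimately have "\<exists>R. positive_operator I R \<and> (\<forall>x\<in>ell2 I. R (R x) = (adjoint_operator I T \<circ> T) x)"
    by simp
  from someI_ex[OF this] have *: "positive_operator I R \<and> (\<forall>x\<in>ell2 I. R (R x) = (adjoint_operator I T \<circ> T) x)"
    unfolding R_def sqrt_operator_def .
  thus "positive_operator I R" by blast
  show "R (R x) = P x" if "x \<in> ell2 I"
    using * that by (simp add: adjoint_operator_eq T_ell2 P_def)
qed

lemma P_right_shift: "g \<in> carrier G \<Longrightarrow> P (right_shift g x) = right_shift g (P x)"
  by (simp add: P_def T_right_shift star_T_right_shift)

text \<open>Constancy of the diagonal: the trace of a power of \<open>P\<close> over the points of
  \<open>F\<close> becomes \<open>card F\<close> times its value at the identity.\<close>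

lemma P_pow_indicator:
  assumes u: "u \<in> carrier G"
  shows "ell2_inner I ((P ^^ n) (indicator {u})) (indicator {u}) =
    ell2_inner I ((P ^^ n) (indicator {\<one>})) (indicator {\<one>})"
proof -
  have *: "(P ^^ n) (right_shift (inv u) x) = right_shift (inv u) ((P ^^ n) x)" for x
    using u by (induction n) (auto simp: P_right_shift)
  show ?thesis
    unfolding right_shift_indicator[OF u, symmetric] * using u by (intro right_shift_inner) simp
qed

end

section \<open>The Hausdorff moment problem and spectral measures\<close>

text \<open>The model for \<open>d k l\<close> is the integral of
  \<open>t ^ k * (1 - t) ^ l\<close>, for which the recursion says \<open>t + (1 - t) = 1\<close>;
  the formula expands the \<open>n\<close>-th power of this.\<close>

lemma moment_array_sum:
  fixes d :: "nat \<Rightarrow> nat \<Rightarrow> real"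
  assumes rec: "\<And>k l. d k l = d (Suc k) l + d k (Suc l)"
  shows "(\<Sum>i\<le>n. real (n choose i) * d (a + i) (b + (n - i))) = d a b"
proof (induction n arbitrary: a b)
  case (Suc n)
  let ?t = "\<lambda>i. d (a + i) (b + (Suc n - i))"
  have "(\<Sum>i\<le>Suc n. real (Suc n choose i) * ?t i) =
      ?t 0 + (\<Sum>i\<le>n. (real (n choose i) + real (n choose Suc i)) * ?t (Suc i))"
    by (subst sum.atMost_Suc_shift) simp
  also have "\<dots> = (\<Sum>i\<le>n. real (n choose i) * ?t (Suc i)) + (?t 0 + (\<Sum>i\<le>n. real (n choose Suc i) * ?t (Suc i)))"
    by (simp add: distrib_right sum.distrib)
  also have "(\<Sum>i\<le>n. real (n choose i) * ?t (Suc i)) = d (Suc a) b"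
    using Suc[of "Suc a" b] by simp
  also have "?t 0 + (\<Sum>i\<le>n. real (n choose Suc i) * ?t (Suc i)) = (\<Sum>i\<le>Suc n. real (n choose i) * ?t i)"
    by (subst sum.atMost_Suc_shift) simp
  also have "\<dots> = (\<Sum>i\<le>n. real (n choose i) * d (a + i) (Suc b + (n - i)))"
    by (auto simp: Suc_diff_le intro!: sum.cong)
  also have "\<dots> = d a (Suc b)" by (rule Suc)
  finally show ?case using rec[of a b] by simp
qed simp

lemma prod_falling_quotient:
  assumes "j \<le> N"
  shows "(\<Prod>i<j. (real k - real i) / (real N - real i)) = real (k choose j) / real (N choose j)"
proof -
  have e: "real (m choose j) = (\<Prod>i<j. real m - real i) / fact j" for m
    using binomial_gbinomial[of m j, where 'a = real] gbinomial_prod_rev[of "real m" j]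
    by (simp add: atLeast0LessThan)
  show ?thesis by (simp add: e prod_dividef)
qed

text \<open>Atoms at \<open>k / N\<close> with Bernstein weights reproduce factorial moments
  exactly; ordinary powers differ from these by an error that vanishes with growing
  \<open>N\<close>.\<close>

lemma bernstein_factorial_moment:
  fixes d :: "nat \<Rightarrow> nat \<Rightarrow> real"
  assumes rec: "\<And>k l. d k l = d (Suc k) l + d k (Suc l)" and j: "j \<le> N"
  shows "(\<Sum>k\<le>N. real (N choose k) * d k (N - k) * (\<Prod>i<j. (real k - real i) / (real N - real i))) = d j 0"
proof -
  have pos: "real (N choose j) > 0" using j by simp
  have "(\<Sum>k\<le>N. real (N choose k) * d k (N - k) * (\<Prod>i<j. (real k - real i) / (real N - real i))) =
      (\<Sum>k\<in>{j..N}. real (N choose k) * d k (N - k) * (real (k choose j) / real (N choose j)))"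
    unfolding prod_falling_quotient[OF j]
    by (rule sum.mono_neutral_right) (auto simp: binomial_eq_0)
  also have "\<dots> = (\<Sum>k\<in>{j..N}. real ((N - j) choose (k - j)) * d k (N - k))"
  proof (intro sum.cong refl)
    fix k assume k: "k \<in> {j..N}"
    have "real (N choose k) * real (k choose j) = real (N choose j) * real ((N - j) choose (k - j))"
      using choose_mult[of j k N] k by (simp flip: of_nat_mult)
    thus "real (N choose k) * d k (N - k) * (real (k choose j) / real (N choose j)) =
        real ((N - j) choose (k - j)) * d k (N - k)"
      using pos by (simp add: field_simps)
  qed
  also have "\<dots> = (\<Sum>i\<le>N - j. real ((N - j) choose i) * d (j + i) (0 + ((N - j) - i)))"
    by (rule sum.reindex_bij_witness[of _ "\<lambda>i. i + j" "\<lambda>k. k - j"]) (use j in auto)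
  also have "\<dots> = d j 0" by (rule moment_array_sum[of d, OF rec])
  finally show ?thesis .
qed

text \<open>All factors of both products have absolute value at most 1, so the products differ by at
  most the sum of the differences of the factors.\<close>

lemma power_falling_close:
  fixes N k j :: nat
  assumes "k \<le> N" "2 * j < N"
  shows "\<bar>(real k / real N) ^ j - (\<Prod>i<j. (real k - real i) / (real N - real i))\<bar> \<le> real j * (real j / (real N - real j))"
proof -
  have "\<bar>(\<Prod>i<j. real k / real N) - (\<Prod>i<j. (real k - real i) / (real N - real i))\<bar> \<le>
      (\<Sum>i<j. \<bar>real k / real N - (real k - real i) / (real N - real i)\<bar>)"
  proof (rule norm_prod_diff[where 'a = real, unfolded real_norm_def])
    fix i assume "i \<in> {..<j}"
    hence i: "2 * real i < real N" using assms by simp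
    have "\<bar>real k - real i\<bar> \<le> real N - real i" using i assms by (simp add: abs_le_iff)
    thus "\<bar>(real k - real i) / (real N - real i)\<bar> \<le> 1" using i by (simp add: abs_divide)
    show "\<bar>real k / real N\<bar> \<le> 1" using assms by simp
  qed
  also have "\<dots> \<le> (\<Sum>i<j. real j / (real N - real j))"
  proof (intro sum_mono)
    fix i assume "i \<in> {..<j}"
    hence i: "real i \<le> real j" "real i < real N" "real j < real N" "real N > 0" using assms by auto
    have "real k / real N - (real k - real i) / (real N - real i) = real i * (real N - real k) / (real N * (real N - real i))"
      using i by (simp add: field_simps)
    also have "\<dots> = (real i / (real N - real i)) * ((real N - real k) / real N)" by simp
    finally have eq: "real k / real N - (real k - real i) / (real N - real i) =
        (real i / (real N - real i)) * ((real N - real k) / real N)" .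
    have "(real N - real k) / real N \<le> 1" "0 \<le> (real N - real k) / real N" using assms i by auto
    moreover have "0 \<le> real i / (real N - real i)" using i by simp
    ultimately have "\<bar>real k / real N - (real k - real i) / (real N - real i)\<bar> \<le> real i / (real N - real i)"
      unfolding eq by (simp only: abs_of_nonneg mult_nonneg_nonneg mult_left_le)
    also have "\<dots> \<le> real j / (real N - real j)"
      using i by (simp add: frac_le)
    finally show "\<bar>real k / real N - (real k - real i) / (real N - real i)\<bar> \<le> real j / (real N - real j)" .
  qed
  finally show ?thesis by simp
qed

text \<open>The Bernstein measures live on grids in \<open>[0, 1]\<close>, so a subsequence has a
  weak limit; their moments converge to \<open>d n 0\<close>.\<close>

lemma hausdorff_moment:
  fixes d :: "nat \<Rightarrow> nat \<Rightarrow> real"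
  assumes nn: "\<And>k l. d k l \<ge> 0" and rec: "\<And>k l. d k l = d (Suc k) l + d k (Suc l)" and d0: "d 0 0 = 1"
  obtains M where "real_distribution M" "AE t in M. 0 \<le> t \<and> t \<le> 1" "\<And>n. (\<integral>t. t ^ n \<partial>M) = d n 0"
proof -
  define w where "w N k = real (N choose k) * d k (N - k)" for N k
  define \<mu> where "\<mu> N = distr (point_measure {..N} (\<lambda>k. ennreal (w N k))) borel (\<lambda>k. real k / real N)" for N
  have w: "w N k \<ge> 0" for N k by (simp add: w_def nn)
  have w_sum: "(\<Sum>k\<le>N. w N k) = 1" for N
    using moment_array_sum[of d N 0 0, OF rec] d0 by (simp add: w_def)
  have int_\<mu>: "(\<integral>t. g t \<partial>\<mu> N) = (\<Sum>k\<le>N. w N k * g (real k / real N))"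
    if "g \<in> borel_measurable borel" for g :: "real \<Rightarrow> real" and N
    unfolding \<mu>_def using w that
    by (subst integral_distr) (auto simp: lebesgue_integral_point_measure_finite)
  have rd: "real_distribution (\<mu> N)" for N
  proof -
    have "emeasure (point_measure {..N} (\<lambda>k. ennreal (w N k))) {..N} = (\<Sum>k\<le>N. ennreal (w N k))"
      by (rule emeasure_point_measure_finite) auto
    also have "\<dots> = 1" using w w_sum by (simp add: sum_ennreal)
    finally have "prob_space (point_measure {..N} (\<lambda>k. ennreal (w N k)))"
      by (intro prob_spaceI) (simp add: space_point_measure)
    hence "prob_space (\<mu> N)" unfolding \<mu>_def by (rule prob_space.prob_space_distr) simp
    thus ?thesis by (simp add: real_distribution_def real_distribution_axioms_def \<mu>_def)
  qed
  \<comment> \<open>Tightness is stated with intervals open on the left, so the left end lies below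
    the atom at 0.\<close>
  have supp: "measure (\<mu> N) {-1<..1} = 1" for N
  proof -
    have "measure (\<mu> N) {-1<..1} = (\<integral>t. indicator {-1<..1} t \<partial>\<mu> N)"
      using real_distribution.events_eq_borel[OF rd] by (simp add: \<mu>_def)
    also have "\<dots> = (\<Sum>k\<le>N. w N k * indicator {-1<..1} (real k / real N))" by (rule int_\<mu>) simp
    also have "\<dots> = (\<Sum>k\<le>N. w N k)"
    proof (intro sum.cong refl)
      fix k assume "k \<in> {..N}"
      hence "real k / real N \<le> 1" by (cases "N = 0") auto
      moreover have "0 \<le> real k / real N" by simp
      ultimately have "real k / real N \<in> {-1<..1}" unfolding greaterThanAtMost_iff by linarith
      thus "w N k * indicator {-1<..1} (real k / real N) = w N k" by simp
    qed
    finally show ?thesis by (simp add: w_sum)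
  qed
  have "tight \<mu>"
    unfolding tight_def
  proof (intro conjI allI impI rd)
    fix \<epsilon> :: real assume "\<epsilon> > 0"
    thus "\<exists>a b. a < b \<and> (\<forall>n. measure (\<mu> n) {a<..b} > 1 - \<epsilon>)"
      by (intro exI[of _ "-1::real"] exI[of _ "1::real"]) (simp add: supp)
  qed
  from tight_imp_convergent_subsubsequence[OF this strict_mono_id] obtain r M where r: "strict_mono (r :: nat \<Rightarrow> nat)" and M: "real_distribution M"
    and wc: "weak_conv_m (\<mu> \<circ> id \<circ> r) M"
    by blast
  interpret M: real_distribution M by (rule M)
  have conv: "(\<lambda>n. \<integral>t. g t \<partial>\<mu> (r n)) \<longlonglongrightarrow> (\<integral>t. g t \<partial>M)"
    if "continuous_on UNIV g" "\<And>x. \<bar>g x\<bar> \<le> 1" for g :: "real \<Rightarrow> real"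
    using weak_conv_imp_integral_bdd_continuous_conv[of "\<mu> \<circ> id \<circ> r" M g 1] rd M wc that
    by (auto simp: continuous_on_eq_continuous_at)
  \<comment> \<open>Weak convergence tests bounded continuous functions only, so powers are taken of
    the point of \<open>[0, 1]\<close> nearest to \<open>t\<close>; on the atoms nothing
    changes.\<close>
  define cl where "cl t = max 0 (min 1 t)" for t :: real
  have cl: "continuous_on UNIV cl" "0 \<le> cl t" "cl t \<le> 1" for t
    unfolding cl_def by (auto intro!: continuous_intros)
  have [measurable]: "cl \<in> borel_measurable borel" using cl(1) by (rule borel_measurable_continuous_onI)
  have cl_frac: "cl (real k / real N) = real k / real N" if "k \<le> N" for k N
    using that by (cases "N = 0") (auto simp: cl_def)
  have mom: "(\<integral>t. cl t ^ j \<partial>M) = d j 0" for j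
  proof -
    have lim: "(\<lambda>n. \<integral>t. cl t ^ j \<partial>\<mu> (r n)) \<longlonglongrightarrow> (\<integral>t. cl t ^ j \<partial>M)"
      using cl by (intro conv continuous_intros) (auto simp: power_abs power_le_one)
    have "(\<lambda>N. \<integral>t. cl t ^ j \<partial>\<mu> N) \<longlonglongrightarrow> d j 0"
    proof (rule Lim_null[THEN iffD2], rule Lim_null_comparison)
      show "(\<lambda>N. real j * (real j / (real N - real j))) \<longlonglongrightarrow> 0" by real_asymp
      show "\<forall>\<^sub>F N in sequentially. norm ((\<integral>t. cl t ^ j \<partial>\<mu> N) - d j 0) \<le> real j * (real j / (real N - real j))"
      proof (rule eventually_sequentiallyI)
        fix N assume "2 * j + 1 \<le> N"
        hence N: "2 * j < N" by simp
        have "(\<integral>t. cl t ^ j \<partial>\<mu> N) = (\<Sum>k\<le>N. w N k * (real k / real N) ^ j)"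
          by (subst int_\<mu>) (auto simp: cl_frac)
        moreover have "d j 0 = (\<Sum>k\<le>N. w N k * (\<Prod>i<j. (real k - real i) / (real N - real i)))"
          unfolding w_def using N by (intro bernstein_factorial_moment[symmetric] rec) simp
        ultimately have "(\<integral>t. cl t ^ j \<partial>\<mu> N) - d j 0 =
            (\<Sum>k\<le>N. w N k * ((real k / real N) ^ j - (\<Prod>i<j. (real k - real i) / (real N - real i))))"
          by (simp add: sum_subtractf right_diff_distrib)
        also have "\<bar>\<dots>\<bar> \<le> (\<Sum>k\<le>N. w N k * (real j * (real j / (real N - real j))))"
        proof (rule order_trans[OF sum_abs], rule sum_mono)
          fix k assume "k \<in> {..N}"
          thus "\<bar>w N k * ((real k / real N) ^ j - (\<Prod>i<j. (real k - real i) / (real N - real i)))\<bar>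
              \<le> w N k * (real j * (real j / (real N - real j)))"
            unfolding abs_mult abs_of_nonneg[OF w] using N by (intro mult_left_mono power_falling_close w) auto
        qed
        also have "\<dots> = real j * (real j / (real N - real j))"
          by (simp only: sum_distrib_right[symmetric] w_sum mult_1)
        finally show "norm ((\<integral>t. cl t ^ j \<partial>\<mu> N) - d j 0) \<le> real j * (real j / (real N - real j))" by simp
      qed
    qed
    from LIMSEQ_subseq_LIMSEQ[OF this r] have "(\<lambda>n. \<integral>t. cl t ^ j \<partial>\<mu> (r n)) \<longlonglongrightarrow> d j 0"
      by (simp add: o_def)
    thus ?thesis using lim LIMSEQ_unique by blast
  qed
  have ae: "AE t in M. cl t = t"
  proof -
    \<comment> \<open>It vanishes exactly on \<open>[0, 1]\<close>, so integral 0 under the limit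
      measure means that the complement is null.\<close>
    define g where "g t = min 1 \<bar>t - cl t\<bar>" for t
    have g: "continuous_on UNIV g" "0 \<le> g t" "g t \<le> 1" for t
      unfolding g_def using cl by (auto intro!: continuous_intros)
    have [measurable]: "g \<in> borel_measurable borel" using g(1) by (rule borel_measurable_continuous_onI)
    have "(\<lambda>n. \<integral>t. g t \<partial>\<mu> (r n)) \<longlonglongrightarrow> (\<integral>t. g t \<partial>M)"
      using g by (intro conv) auto
    moreover have "(\<integral>t. g t \<partial>\<mu> N) = 0" for N
      by (subst int_\<mu>) (auto simp: g_def cl_frac)
    ultimately have "(\<integral>t. g t \<partial>M) = 0" by (simp add: LIMSEQ_const_iff)
    moreover have "integrable M g"
      using g by (intro M.integrable_const_bound[where B = 1]) auto
    ultimately have "AE t in M. g t = 0"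
      using g by (subst (asm) integral_nonneg_eq_0_iff_AE) auto
    thus ?thesis by eventually_elim (auto simp: g_def min_def split: if_splits)
  qed
  show ?thesis
  proof (rule that[OF M])
    show "AE t in M. 0 \<le> t \<and> t \<le> 1" using ae by eventually_elim (metis cl(2,3))
    show "(\<integral>t. t ^ n \<partial>M) = d n 0" for n
      unfolding mom[symmetric] by (rule integral_cong_AE) (use ae in auto)
  qed
qed

context ell2_symmetric
begin

lemma pow_diff:
  assumes "x \<in> ell2 I" "y \<in> ell2 I"
  shows "(B ^^ n) (\<lambda>s. x s - y s) = (\<lambda>s. (B ^^ n) x s - (B ^^ n) y s)"
  using pow_add[OF assms(1) ell2_scale[OF assms(2), of "-1"], of n] pow_scale[OF assms(2), of n "-1"] by simp

lemma diff: "x \<in> ell2 I \<Longrightarrow> y \<in> ell2 I \<Longrightarrow> B (\<lambda>s. x s - y s) = (\<lambda>s. B x s - B y s)"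
  using pow_diff[of x y 1] by simp

end

context ell2_contraction
begin

definition C :: "('a \<Rightarrow> complex) \<Rightarrow> 'a \<Rightarrow> complex" where "C x = (\<lambda>s. x s - B x s)"

lemma C_ell2: "x \<in> ell2 I \<Longrightarrow> C x \<in> ell2 I"
  unfolding C_def by (intro ell2_diff ell2)

lemma C_inner: "x \<in> ell2 I \<Longrightarrow> y \<in> ell2 I \<Longrightarrow> ell2_inner I (C x) y = ell2_inner I x y - ell2_inner I (B x) y"
  unfolding C_def by (rule ell2_inner_diff_left) (auto intro: ell2)

lemma C_sym: "x \<in> ell2 I \<Longrightarrow> y \<in> ell2 I \<Longrightarrow> ell2_inner I (C x) y = ell2_inner I x (C y)"
  unfolding ell2_inner_commute[of I x "C y"]
  by (simp add: C_inner) (simp add: ell2_inner_commute[symmetric] sym)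

lemma C_pow_ell2: "x \<in> ell2 I \<Longrightarrow> (C ^^ n) x \<in> ell2 I"
  by (induction n) (auto intro: C_ell2)

lemma BC: "x \<in> ell2 I \<Longrightarrow> B (C x) = C (B x)"
  unfolding C_def by (simp add: diff ell2)

lemma C_pow_B: "x \<in> ell2 I \<Longrightarrow> (C ^^ l) (B x) = B ((C ^^ l) x)"
  by (induction l) (auto simp: BC C_pow_ell2)

lemma B_pow_C: "x \<in> ell2 I \<Longrightarrow> (B ^^ k) (C x) = C ((B ^^ k) x)"
  by (induction k) (auto simp: BC pow_ell2)

text \<open>Two equal factors are split between the arguments of the inner product, which replaces
  \<open>v\<close> by \<open>B v\<close> or \<open>C v\<close>. There remain exponents 0 and 1,
  where the product of \<open>B\<close> and \<open>C\<close> is covered by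
  \<open>square_le\<close>.\<close>

lemma mixed_pos: "v \<in> ell2 I \<Longrightarrow> Re (ell2_inner I ((B ^^ k) ((C ^^ l) v)) v) \<ge> 0"
proof (induction "k + l" arbitrary: k l v rule: less_induct)
  case less
  note v = less.prems
  have small: ?case if "k < 2" "l < 2"
  proof -
    have "Re (ell2_inner I v v) \<ge> 0" using v by (simp add: ell2_inner_self)
    moreover have "Re (ell2_inner I (C v) v) \<ge> 0" using le[OF v] v by (simp add: C_inner ell2_inner_self)
    moreover have "Re (ell2_inner I (B (C v)) v) \<ge> 0"
      using square_le[OF v] v by (simp add: BC C_inner ell2)
    moreover have "k = 0 \<or> k = 1" "l = 0 \<or> l = 1" using that by auto
    ultimately show ?thesis using pos[OF v] by auto
  qed
  consider k' where "k = Suc (Suc k')" | l' where "l = Suc (Suc l')" | "k < 2" "l < 2"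
    by (metis add_2_eq_Suc less_eqE not_less)
  thus ?case
  proof cases
    case (1 k')
    have "(B ^^ k) ((C ^^ l) v) = B ((B ^^ k') (B ((C ^^ l) v)))" by (simp add: 1 funpow_swap1)
    hence "ell2_inner I ((B ^^ k) ((C ^^ l) v)) v = ell2_inner I ((B ^^ k') ((C ^^ l) (B v))) (B v)"
      using v by (simp add: sym C_pow_B pow_ell2 C_pow_ell2 ell2)
    thus ?thesis using less.hyps[of k' l "B v"] v by (simp add: 1 ell2)
  next
    case (2 l')
    have "(C ^^ l) v = C ((C ^^ l') (C v))" by (simp add: 2 funpow_swap1)
    hence "(B ^^ k) ((C ^^ l) v) = C ((B ^^ k) ((C ^^ l') (C v)))"
      using v by (simp add: B_pow_C C_pow_ell2 C_ell2)
    hence "ell2_inner I ((B ^^ k) ((C ^^ l) v)) v = ell2_inner I ((B ^^ k) ((C ^^ l') (C v))) (C v)"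
      using v by (simp add: C_sym pow_ell2 C_pow_ell2 C_ell2)
    thus ?thesis using less.hyps[of k l' "C v"] v by (simp add: 2 C_ell2)
  qed (rule small)
qed

text \<open>As \<open>B + C = 1\<close>, the numbers \<open>d k l\<close> satisfy the recursion of
  the moment problem, and \<open>mixed_pos\<close> is their positivity.\<close>

lemma contraction_spectral_measure:
  assumes v: "v \<in> ell2 I" "ell2_norm I v = 1"
  obtains M where "real_distribution M" "AE t in M. 0 \<le> t \<and> t \<le> 1"
    "\<And>n. ell2_inner I ((B ^^ n) v) v = of_real (\<integral>t. t ^ n \<partial>M)"
proof -
  define d where "d k l = Re (ell2_inner I ((B ^^ k) ((C ^^ l) v)) v)" for k l
  have rec: "d k l = d (Suc k) l + d k (Suc l)" for k l
  proof -
    let ?y = "(C ^^ l) v"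
    have "(B ^^ k) ((C ^^ Suc l) v) = (B ^^ k) (\<lambda>s. ?y s - B ?y s)" by (simp add: C_def)
    also have "\<dots> = (\<lambda>s. (B ^^ k) ?y s - (B ^^ k) (B ?y) s)"
      using v by (intro pow_diff ell2 C_pow_ell2)
    also have "(B ^^ k) (B ?y) = (B ^^ Suc k) ?y" by (simp add: funpow_swap1)
    finally have "ell2_inner I ((B ^^ k) ((C ^^ Suc l) v)) v =
        ell2_inner I ((B ^^ k) ?y) v - ell2_inner I ((B ^^ Suc k) ?y) v"
      using v by (simp only: ell2_inner_diff_left pow_ell2 C_pow_ell2)
    thus ?thesis by (simp add: d_def)
  qed
  have d0: "d 0 0 = 1" using v by (simp add: d_def ell2_inner_self)
  have nn: "d k l \<ge> 0" for k l unfolding d_def by (rule mixed_pos[OF v(1)])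
  obtain M where M: "real_distribution M" "AE t in M. 0 \<le> t \<and> t \<le> 1" "\<And>n. (\<integral>t. t ^ n \<partial>M) = d n 0"
    using hausdorff_moment[of d, OF nn rec d0] by blast
  have "ell2_inner I ((B ^^ n) v) v = of_real (\<integral>t. t ^ n \<partial>M)" for n
  proof -
    have "cnj (ell2_inner I ((B ^^ n) v) v) = ell2_inner I ((B ^^ n) v) v"
      using pow_sym[OF v(1) v(1), of n] ell2_inner_commute[of I v "(B ^^ n) v"] by simp
    thus ?thesis by (simp add: M(3) d_def complex_eq_iff)
  qed
  thus ?thesis using M that by blast
qed

end

text \<open>The measure of the contraction \<open>B / c\<close>, transported by
  \<open>t \<mapsto> c * t\<close>.\<close>

lemma (in ell2_symmetric) positive_spectral_measure:
  assumes c: "c > 0" and pos: "\<And>x. x \<in> ell2 I \<Longrightarrow> 0 \<le> Re (ell2_inner I (B x) x)"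
    and le: "\<And>x. x \<in> ell2 I \<Longrightarrow> Re (ell2_inner I (B x) x) \<le> c * (ell2_norm I x)\<^sup>2"
    and v: "v \<in> ell2 I" "ell2_norm I v = 1"
  obtains M where "real_distribution M" "AE t in M. 0 \<le> t \<and> t \<le> c"
    "\<And>n. ell2_inner I ((B ^^ n) v) v = of_real (\<integral>t. t ^ n \<partial>M)"
proof -
  define B' where "B' x = (\<lambda>s. of_real (1 / c) * B x s)" for x
  interpret B': ell2_contraction I B'
  proof
    fix x assume x: "x \<in> ell2 I"
    show "B' x \<in> ell2 I" unfolding B'_def by (intro ell2_scale ell2 x)
    show "B' (\<lambda>s. a * x s) = (\<lambda>s. a * B' x s)" for a
      unfolding B'_def scale[OF x] by (simp add: mult.left_commute)
    have "Re (ell2_inner I (B' x) x) = Re (ell2_inner I (B x) x) / c"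
      unfolding B'_def ell2_inner_scale_left by simp
    thus "0 \<le> Re (ell2_inner I (B' x) x)" "Re (ell2_inner I (B' x) x) \<le> (ell2_norm I x)\<^sup>2"
      using pos[OF x] le[OF x] c by (simp_all add: divide_le_eq mult.commute)
    fix y assume y: "y \<in> ell2 I"
    show "B' (\<lambda>s. x s + y s) = (\<lambda>s. B' x s + B' y s)"
      unfolding B'_def add[OF x y] by (simp add: distrib_left)
    show "ell2_inner I (B' x) y = ell2_inner I x (B' y)"
      unfolding B'_def ell2_inner_scale_left ell2_inner_scale_right sym[OF x y] by simp
  qed
  obtain M where M: "real_distribution M" "AE t in M. 0 \<le> t \<and> t \<le> 1"
    "\<And>n. ell2_inner I ((B' ^^ n) v) v = of_real (\<integral>t. t ^ n \<partial>M)"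
    using B'.contraction_spectral_measure[OF v] by blast
  interpret M: real_distribution M by (rule M(1))
  have pow: "(B ^^ n) v = (\<lambda>s. of_real (c ^ n) * (B' ^^ n) v s)" for n
  proof (induction n)
    case (Suc n)
    have "(B ^^ Suc n) v = B (\<lambda>s. of_real (c ^ n) * (B' ^^ n) v s)" using Suc by simp
    also have "\<dots> = (\<lambda>s. of_real (c ^ n) * B ((B' ^^ n) v) s)" by (rule scale[OF B'.pow_ell2[OF v(1)]])
    also have "\<dots> = (\<lambda>s. of_real (c ^ Suc n) * (B' ^^ Suc n) v s)"
      using c by (simp add: B'_def fun_eq_iff)
    finally show ?case .
  qed simp
  show ?thesis
  proof (rule that[of "distr M borel (\<lambda>t. c * t)"])
    show "real_distribution (distr M borel (\<lambda>t. c * t))"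
      by (simp add: real_distribution_def real_distribution_axioms_def M.prob_space_distr)
    show "AE t in distr M borel (\<lambda>t. c * t). 0 \<le> t \<and> t \<le> c"
      using M(2) c by (subst AE_distr_iff) auto
    show "ell2_inner I ((B ^^ n) v) v = of_real (\<integral>t. t ^ n \<partial>distr M borel (\<lambda>t. c * t))" for n
      unfolding pow ell2_inner_scale_left M(3)
      by (subst integral_distr) (auto simp: power_mult_distrib)
  qed
qed

text \<open>Polarisation: that the form is real at \<open>x + y\<close> settles the imaginary parts,
  at \<open>x + \<i> * y\<close> the real parts.\<close>

lemma positive_operator_symmetric:
  assumes R: "positive_operator I R" shows "ell2_symmetric I R"
proof
  have b: "R x \<in> ell2 I" "R (\<lambda>s. c * x s) = (\<lambda>s. c * R x s)" if "x \<in> ell2 I" for x c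
    using R that by (auto simp: positive_operator_def bounded_operator_def)
  have a: "R (\<lambda>s. x s + y s) = (\<lambda>s. R x s + R y s)" if "x \<in> ell2 I" "y \<in> ell2 I" for x y
    using R that by (auto simp: positive_operator_def bounded_operator_def)
  have real: "Im (ell2_inner I (R x) x) = 0" if "x \<in> ell2 I" for x
    using R that by (auto simp: positive_operator_def complex_nonneg_Reals_iff)
  fix x assume x: "x \<in> ell2 I"
  show "R x \<in> ell2 I" "R (\<lambda>s. c * x s) = (\<lambda>s. c * R x s)" for c using b x by auto
  fix y assume y: "y \<in> ell2 I"
  show "R (\<lambda>s. x s + y s) = (\<lambda>s. R x s + R y s)" using a x y by auto
  have pol: "Im (ell2_inner I (R x) y + ell2_inner I (R y) x) = 0" if y: "y \<in> ell2 I" for y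
  proof -
    let ?z = "\<lambda>s. x s + y s"
    have "ell2_inner I (R ?z) ?z = ell2_inner I (R x) x + ell2_inner I (R x) y + (ell2_inner I (R y) x + ell2_inner I (R y) y)"
      unfolding a[OF x y] using x y
      by (simp add: ell2_inner_add_left ell2_inner_add_right ell2_add b)
    thus ?thesis using real[OF x] real[OF y] real[OF ell2_add[OF x y]] by simp
  qed
  have "Im (ell2_inner I (R x) (\<lambda>s. \<i> * y s) + ell2_inner I (R (\<lambda>s. \<i> * y s)) x) = 0"
    by (rule pol[OF ell2_scale[OF y]])
  hence "Re (ell2_inner I (R x) y) = Re (ell2_inner I (R y) x)"
    unfolding b(2)[OF y] ell2_inner_scale_left ell2_inner_scale_right by simp
  moreover have "Im (ell2_inner I (R x) y) = - Im (ell2_inner I (R y) x)" using pol[OF y] by simp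
  ultimately show "ell2_inner I (R x) y = ell2_inner I x (R y)"
    unfolding ell2_inner_commute[of I x "R y"] by (simp add: complex_eq_iff)
qed

text \<open>By Weierstrass' theorem a linear relation between moments extends to all continuous functions.\<close>

lemma moment_relation_continuous:
  fixes M :: "'i \<Rightarrow> real measure" and a :: "'i \<Rightarrow> real" and g :: "real \<Rightarrow> real"
  assumes J: "finite J" and sets: "\<And>j. j \<in> J \<Longrightarrow> sets (M j) = sets borel"
    and fin: "\<And>j. j \<in> J \<Longrightarrow> finite_measure (M j)"
    and supp: "\<And>j. j \<in> J \<Longrightarrow> AE t in M j. \<bar>t\<bar> \<le> r"
    and mom: "\<And>n. (\<Sum>j\<in>J. a j * (\<integral>t. t ^ n \<partial>M j)) = 0"
    and g: "continuous_on UNIV g"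
  shows "(\<Sum>j\<in>J. a j * (\<integral>t. g t \<partial>M j)) = 0"
proof -
  have int: "integrable (M j) q" if j: "j \<in> J" and q: "continuous_on UNIV q" for j and q :: "real \<Rightarrow> real"
  proof -
    interpret finite_measure "M j" by (rule fin[OF j])
    have "bounded (q ` {-r..r})"
      by (rule compact_imp_bounded[OF compact_continuous_image[OF continuous_on_subset[OF q subset_UNIV] compact_Icc]])
    then obtain K where "\<forall>x\<in>q ` {-r..r}. norm x \<le> K" unfolding bounded_iff by blast
    hence K: "\<bar>q t\<bar> \<le> K" if "t \<in> {-r..r}" for t using that by auto
    show ?thesis
    proof (rule integrable_const_bound[where B = K])
      show "AE t in M j. norm (q t) \<le> K" using supp[OF j] by eventually_elim (auto intro!: K)
      show "q \<in> borel_measurable (M j)"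
        unfolding measurable_cong_sets[OF sets[OF j] refl] using q by (rule borel_measurable_continuous_onI)
    qed
  qed
  \<comment> \<open>\<open>L\<close> bounds the total variation of the signed combination of the
    measures.\<close>
  define L where "L = (\<Sum>j\<in>J. \<bar>a j\<bar> * measure (M j) (space (M j)))"
  have L: "L \<ge> 0" unfolding L_def by (intro sum_nonneg) auto
  have bound: "\<bar>\<Sum>j\<in>J. a j * (\<integral>t. g t \<partial>M j)\<bar> \<le> L * e" if e: "e > 0" for e
  proof -
    obtain p where p: "polynomial_function p" "\<And>t. t \<in> {-r..r} \<Longrightarrow> norm (g t - p t) < e"
      using Stone_Weierstrass_polynomial_function[OF compact_Icc continuous_on_subset[OF g] e, of "-r" r] by auto
    from p(1) have "real_polynomial_function p" by (simp only: real_polynomial_function_eq)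
    then obtain b n where pb: "p = (\<lambda>t. \<Sum>i\<le>n. b i * t ^ i)"
      unfolding real_polynomial_function_iff_sum by blast
    have pc: "continuous_on UNIV p" unfolding pb by (intro continuous_intros)
    have "(\<Sum>j\<in>J. a j * (\<integral>t. p t \<partial>M j)) = (\<Sum>j\<in>J. \<Sum>i\<le>n. b i * (a j * (\<integral>t. t ^ i \<partial>M j)))"
    proof (intro sum.cong refl)
      fix j assume j: "j \<in> J"
      have "(\<integral>t. p t \<partial>M j) = (\<Sum>i\<le>n. b i * (\<integral>t. t ^ i \<partial>M j))"
        unfolding pb using j by (subst Bochner_Integration.integral_sum) (auto intro!: int continuous_intros)
      thus "a j * (\<integral>t. p t \<partial>M j) = (\<Sum>i\<le>n. b i * (a j * (\<integral>t. t ^ i \<partial>M j)))"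
        by (simp add: sum_distrib_left mult_ac)
    qed
    also have "\<dots> = (\<Sum>i\<le>n. b i * (\<Sum>j\<in>J. a j * (\<integral>t. t ^ i \<partial>M j)))"
      by (subst sum.swap) (simp add: sum_distrib_left)
    also have "\<dots> = 0" by (simp add: mom)
    finally have p0: "(\<Sum>j\<in>J. a j * (\<integral>t. p t \<partial>M j)) = 0" .
    have "(\<Sum>j\<in>J. a j * (\<integral>t. g t \<partial>M j)) = (\<Sum>j\<in>J. a j * (\<integral>t. g t - p t \<partial>M j))"
    proof -
      have "(\<integral>t. g t - p t \<partial>M j) = (\<integral>t. g t \<partial>M j) - (\<integral>t. p t \<partial>M j)" if "j \<in> J" for j
        using that by (intro Bochner_Integration.integral_diff int g pc)
      thus ?thesis using p0 by (simp add: right_diff_distrib sum_subtractf)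
    qed
    also have "\<bar>\<dots>\<bar> \<le> (\<Sum>j\<in>J. \<bar>a j\<bar> * (measure (M j) (space (M j)) * e))"
    proof (rule order_trans[OF sum_abs], rule sum_mono)
      fix j assume j: "j \<in> J"
      interpret finite_measure "M j" by (rule fin[OF j])
      have i: "integrable (M j) (\<lambda>t. g t - p t)"
        using j by (intro Bochner_Integration.integrable_diff int g pc)
      have "\<bar>\<integral>t. g t - p t \<partial>M j\<bar> \<le> (\<integral>t. \<bar>g t - p t\<bar> \<partial>M j)" by (rule integral_abs_bound)
      also have "\<dots> \<le> (\<integral>t. e \<partial>M j)"
      proof (rule integral_mono_AE)
        show "integrable (M j) (\<lambda>t. \<bar>g t - p t\<bar>)" using i by simp
        have close: "\<bar>g t - p t\<bar> \<le> e" if "\<bar>t\<bar> \<le> r" for t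
        proof -
          have "t \<in> {-r..r}" using that by auto
          thus ?thesis using p(2)[of t] by simp
        qed
        show "AE t in M j. \<bar>g t - p t\<bar> \<le> e"
          using supp[OF j] by eventually_elim (rule close)
      qed simp
      also have "\<dots> = measure (M j) (space (M j)) * e" by simp
      finally show "\<bar>a j * (\<integral>t. g t - p t \<partial>M j)\<bar> \<le> \<bar>a j\<bar> * (measure (M j) (space (M j)) * e)"
        by (simp add: abs_mult mult_left_mono)
    qed
    also have "\<dots> = L * e" by (simp add: L_def sum_distrib_right mult.assoc)
    finally show ?thesis .
  qed
  have "\<bar>\<Sum>j\<in>J. a j * (\<integral>t. g t \<partial>M j)\<bar> \<le> 0 + e" if "e > 0" for e
    using bound[of "e / (L + 1)"] that L
    by (intro order_trans[OF bound[of "e / (L + 1)"]]) (auto simp: field_simps)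
  hence "\<bar>\<Sum>j\<in>J. a j * (\<integral>t. g t \<partial>M j)\<bar> \<le> 0" by (rule field_le_epsilon)
  thus ?thesis by simp
qed

section \<open>Gram determinants and eigenbases\<close>

abbreviation mdet :: "complex Matrix.mat \<Rightarrow> complex" where "mdet \<equiv> Determinant.det"

text \<open>Multilinear expansion gives a sum over all functions into \<open>B\<close>; those that
  are not injective have two equal rows. For an injective \<open>\<phi>\<close> the remaining minor
  is bounded by its permanent, whose terms belong to the distinct injections
  \<open>\<phi> \<circ> inv p\<close>, hence by the full sum.\<close>

lemma gram_det_le:
  fixes a :: "nat \<Rightarrow> 'b \<Rightarrow> complex"
  assumes B: "finite B"
  shows "cmod (mdet (Matrix.mat N N (\<lambda>(i, j). \<Sum>t\<in>B. a j t * cnj (a i t)))) \<le>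
    (inj_sum (\<lambda>i t. cmod (a i t)) {0..<N} B)\<^sup>2"
proof -
  let ?N = "{0..<N}"
  let ?perms = "{p. p permutes ?N}"
  let ?D = "\<lambda>\<phi>. mdet (Matrix.mat N N (\<lambda>(i, j). a j (\<phi> i)))"
  define J where "J = inj_sum (\<lambda>i t. cmod (a i t)) ?N B"
  have J: "J \<ge> 0" unfolding J_def by (rule inj_sum_nonneg) simp
  have Deq: "?D \<phi> = (\<Sum>p\<in>?perms. signof p * (\<Prod>i=0..<N. a (p i) (\<phi> i)))" for \<phi>
  proof -
    have "?D \<phi> = (\<Sum>p\<in>?perms. signof p * (\<Prod>i=0..<N. Matrix.mat N N (\<lambda>(i, j). a j (\<phi> i)) $$ (i, p i)))"
      by (rule det_def') simp
    also have "\<dots> = (\<Sum>p\<in>?perms. signof p * (\<Prod>i=0..<N. a (p i) (\<phi> i)))"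
      by (intro sum.cong refl arg_cong2[of _ _ _ _ "(*)"] prod.cong)
        (auto dest: permutes_in_image[of _ _ _, THEN iffD2])
    finally show ?thesis .
  qed
  have "mdet (Matrix.mat N N (\<lambda>(i, j). \<Sum>t\<in>B. a j t * cnj (a i t))) =
      (\<Sum>p\<in>?perms. signof p * (\<Prod>i=0..<N. Matrix.mat N N (\<lambda>(i, j). \<Sum>t\<in>B. a j t * cnj (a i t)) $$ (i, p i)))"
    by (rule det_def') simp
  also have "\<dots> = (\<Sum>p\<in>?perms. signof p * (\<Prod>i=0..<N. \<Sum>t\<in>B. a (p i) t * cnj (a i t)))"
    by (intro sum.cong refl arg_cong2[of _ _ _ _ "(*)"] prod.cong)
      (auto dest: permutes_in_image[of _ _ _, THEN iffD2])
  also have "\<dots> = (\<Sum>p\<in>?perms. signof p * (\<Sum>\<phi>\<in>?N \<rightarrow>\<^sub>E B. \<Prod>i\<in>?N. a (p i) (\<phi> i) * cnj (a i (\<phi> i))))"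
    using B by (subst prod_sum_PiE) auto
  also have "\<dots> = (\<Sum>p\<in>?perms. \<Sum>\<phi>\<in>?N \<rightarrow>\<^sub>E B. (\<Prod>i\<in>?N. cnj (a i (\<phi> i))) * (signof p * (\<Prod>i\<in>?N. a (p i) (\<phi> i))))"
    by (simp add: sum_distrib_left prod.distrib mult_ac)
  also have "\<dots> = (\<Sum>\<phi>\<in>?N \<rightarrow>\<^sub>E B. (\<Prod>i\<in>?N. cnj (a i (\<phi> i))) * ?D \<phi>)"
    unfolding Deq sum_distrib_left by (rule sum.swap)
  also have "\<dots> = (\<Sum>\<phi> | \<phi> \<in> ?N \<rightarrow>\<^sub>E B \<and> inj_on \<phi> ?N. (\<Prod>i\<in>?N. cnj (a i (\<phi> i))) * ?D \<phi>)"
  proof (rule sum.mono_neutral_right)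
    show "\<forall>\<phi>\<in>(?N \<rightarrow>\<^sub>E B) - {\<phi>. \<phi> \<in> ?N \<rightarrow>\<^sub>E B \<and> inj_on \<phi> ?N}. (\<Prod>i\<in>?N. cnj (a i (\<phi> i))) * ?D \<phi> = 0"
    proof
      fix \<phi> assume "\<phi> \<in> (?N \<rightarrow>\<^sub>E B) - {\<phi>. \<phi> \<in> ?N \<rightarrow>\<^sub>E B \<and> inj_on \<phi> ?N}"
      then obtain i j where ij: "i < N" "j < N" "i \<noteq> j" "\<phi> i = \<phi> j" by (auto simp: inj_on_def)
      have "?D \<phi> = 0"
        by (rule det_identical_rows[of _ N i j]) (use ij in \<open>auto intro!: eq_vecI\<close>)
      thus "(\<Prod>i\<in>?N. cnj (a i (\<phi> i))) * ?D \<phi> = 0" by simp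
    qed
  qed (use B in \<open>auto intro!: finite_PiE\<close>)
  finally have "cmod (mdet (Matrix.mat N N (\<lambda>(i, j). \<Sum>t\<in>B. a j t * cnj (a i t)))) \<le>
      (\<Sum>\<phi> | \<phi> \<in> ?N \<rightarrow>\<^sub>E B \<and> inj_on \<phi> ?N. cmod ((\<Prod>i\<in>?N. cnj (a i (\<phi> i))) * ?D \<phi>))"
    by (simp only: norm_sum)
  also have "\<dots> \<le> (\<Sum>\<phi> | \<phi> \<in> ?N \<rightarrow>\<^sub>E B \<and> inj_on \<phi> ?N. (\<Prod>i\<in>?N. cmod (a i (\<phi> i))) * J)"
  proof (rule sum_mono)
    fix \<phi> assume "\<phi> \<in> {\<phi>. \<phi> \<in> ?N \<rightarrow>\<^sub>E B \<and> inj_on \<phi> ?N}"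
    hence \<phi>: "\<phi> \<in> ?N \<rightarrow>\<^sub>E B" "inj_on \<phi> ?N" by auto
    have "cmod (?D \<phi>) \<le> (\<Sum>p\<in>?perms. cmod (signof p * (\<Prod>i=0..<N. a (p i) (\<phi> i))))"
      unfolding Deq by (rule norm_sum)
    also have "\<dots> = (\<Sum>p\<in>?perms. \<Prod>i\<in>?N. cmod (a (p i) (\<phi> i)))"
      by (intro sum.cong refl) (simp add: norm_mult prod_norm[symmetric] sign_def)
    also have "\<dots> \<le> J"
      unfolding J_def inj_sum_def
    \<comment> \<open>\<open>p\<close> is recovered from \<open>\<phi> \<circ> inv p\<close> because
      \<open>\<phi>\<close> is injective; the witness spells this out as a permutation of all of
      \<open>nat\<close>.\<close>
    proof (rule sum_le_included[where i = "\<lambda>\<psi>. inv_into UNIV (\<lambda>j. if j \<in> ?N then the_inv_into ?N \<phi> (\<psi> j) else j)"])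
      show "finite {\<phi>. \<phi> \<in> ?N \<rightarrow>\<^sub>E B \<and> inj_on \<phi> ?N}"
        using B by (auto intro!: finite_subset[OF _ finite_PiE[of ?N "\<lambda>_. B"]])
      show "\<forall>p\<in>?perms. \<exists>\<psi>\<in>{\<phi>. \<phi> \<in> ?N \<rightarrow>\<^sub>E B \<and> inj_on \<phi> ?N}.
          inv_into UNIV (\<lambda>j. if j \<in> ?N then the_inv_into ?N \<phi> (\<psi> j) else j) = p \<and>
          (\<Prod>i\<in>?N. cmod (a (p i) (\<phi> i))) \<le> (\<Prod>s\<in>?N. cmod (a s (\<psi> s)))"
      proof
        fix p assume "p \<in> ?perms"
        hence p: "p permutes ?N" by simp
        define q where "q = inv_into UNIV p"
        have q: "q permutes ?N" unfolding q_def by (rule permutes_inv[OF p])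
        have qp: "q (p i) = i" "p (q i) = i" for i
          using permutes_inverses[OF p] by (auto simp: q_def)
        have qN: "q i \<in> ?N \<longleftrightarrow> i \<in> ?N" for i using permutes_in_image[OF q] .
        let ?\<psi> = "\<lambda>j\<in>?N. \<phi> (q j)"
        have "inj_on ?\<psi> ?N"
        proof (rule inj_onI)
          fix i j assume ij: "i \<in> ?N" "j \<in> ?N" "?\<psi> i = ?\<psi> j"
          hence "\<phi> (q i) = \<phi> (q j)" by simp
          hence "q i = q j" using \<phi>(2) qN ij by (meson inj_onD)
          thus "i = j" using qp(2) by metis
        qed
        moreover have "?\<psi> \<in> ?N \<rightarrow>\<^sub>E B" using \<phi>(1) qN by (auto simp del: atLeastLessThan_iff)
        moreover have "(\<lambda>j. if j \<in> ?N then the_inv_into ?N \<phi> (?\<psi> j) else j) = q"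
        proof
          fix j show "(if j \<in> ?N then the_inv_into ?N \<phi> (?\<psi> j) else j) = q j"
            using the_inv_into_f_f[OF \<phi>(2), of "q j"] qN[of j] permutes_not_in[OF q, of j] by simp
        qed
        hence "inv_into UNIV (\<lambda>j. if j \<in> ?N then the_inv_into ?N \<phi> (?\<psi> j) else j) = p"
          using permutes_inv_inv[OF p] by (simp add: q_def)
        moreover have "(\<Prod>i\<in>?N. cmod (a (p i) (\<phi> i))) = (\<Prod>s\<in>?N. cmod (a s (?\<psi> s)))"
          by (rule prod.reindex_bij_witness[of _ q p]) (use qp permutes_in_image[OF p] qN in auto)
        ultimately show "\<exists>\<psi>\<in>{\<phi>. \<phi> \<in> ?N \<rightarrow>\<^sub>E B \<and> inj_on \<phi> ?N}.
          inv_into UNIV (\<lambda>j. if j \<in> ?N then the_inv_into ?N \<phi> (\<psi> j) else j) = p \<and>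
          (\<Prod>i\<in>?N. cmod (a (p i) (\<phi> i))) \<le> (\<Prod>s\<in>?N. cmod (a s (\<psi> s)))"
          by (intro bexI[of _ ?\<psi>]) simp_all
      qed
    qed (auto intro!: prod_nonneg finite_permutations)
    finally have "cmod (?D \<phi>) \<le> J" .
    thus "cmod ((\<Prod>i\<in>?N. cnj (a i (\<phi> i))) * ?D \<phi>) \<le> (\<Prod>i\<in>?N. cmod (a i (\<phi> i))) * J"
      by (simp add: norm_mult prod_norm[symmetric] mult_left_mono prod_nonneg)
  qed
  also have "\<dots> = J * J" by (simp add: J_def inj_sum_def sum_distrib_right)
  finally show ?thesis by (simp add: J_def power2_eq_square)
qed

text \<open>Zero rows complete the system to a square one, whose determinant vanishes because every
  permutation meets such a row.\<close>

lemma homogeneous_system_solution: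
  fixes c :: "nat \<Rightarrow> nat \<Rightarrow> complex"
  assumes "k < N"
  obtains x where "\<exists>m<N. x m \<noteq> 0" "\<And>i. i < k \<Longrightarrow> (\<Sum>m<N. c i m * x m) = 0"
proof -
  define A where "A = Matrix.mat N N (\<lambda>(i, m). if i < k then c i m else 0)"
  have A: "A \<in> carrier_mat N N" by (simp add: A_def)
  have "mdet A = (\<Sum>p | p permutes {0..<N}. signof p * (\<Prod>i=0..<N. A $$ (i, p i)))" by (rule det_def'[OF A])
  also have "\<dots> = 0"
  proof (rule sum.neutral, rule ballI)
    fix p assume "p \<in> {p. p permutes {0..<N}}"
    hence "p k < N" using assms permutes_in_image[of p "{0..<N}" k] by simp
    hence "A $$ (k, p k) = 0" using assms by (simp add: A_def)
    hence "(\<Prod>i=0..<N. A $$ (i, p i)) = 0" using assms by (intro prod_zero) auto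
    thus "signof p * (\<Prod>i=0..<N. A $$ (i, p i)) = 0" by simp
  qed
  finally obtain v where v: "v \<in> carrier_vec N" "v \<noteq> 0\<^sub>v N" "A *\<^sub>v v = 0\<^sub>v N"
    using det_0_iff_vec_prod_zero_field[OF A] by auto
  show ?thesis
  proof (rule that[of "\<lambda>m. vec_index v m"])
    show "\<exists>m<N. vec_index v m \<noteq> 0"
    proof (rule ccontr)
      assume "\<not> (\<exists>m<N. vec_index v m \<noteq> 0)"
      hence "v = 0\<^sub>v N" using v(1) by (intro eq_vecI) auto
      thus False using v(2) by simp
    qed
    fix i assume i: "i < k"
    have "0 = vec_index (A *\<^sub>v v) i" using v(3) i assms by simp
    also have "\<dots> = (\<Sum>m=0..<N. A $$ (i, m) * vec_index v m)"
      using i assms A v(1) by (simp add: scalar_prod_def)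
    also have "\<dots> = (\<Sum>m<N. c i m * vec_index v m)"
      unfolding atLeast0LessThan using i assms by (intro sum.cong) (auto simp: A_def)
    finally show "(\<Sum>m<N. c i m * vec_index v m) = 0" by simp
  qed
qed

lemma ell2_finite_iff: "finite I \<Longrightarrow> x \<in> ell2 I \<longleftrightarrow> (\<forall>s. s \<notin> I \<longrightarrow> x s = 0)"
  by (simp add: ell2_def)

lemma ell2_inner_finite: "finite I \<Longrightarrow> ell2_inner I x y = (\<Sum>s\<in>I. x s * cnj (y s))"
  by (simp add: ell2_inner_def)

context ell2_symmetric
begin

text \<open>The form of \<open>B\<close> is maximised on the unit sphere \<open>Sp\<close> of the
  orthogonal complement \<open>V\<close> of the given eigenvectors. As \<open>V\<close> is
  invariant, the residual \<open>w\<close> lies in \<open>V\<close>, and varying the maximiser in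
  its direction forces \<open>w\<close> to be 0.\<close>

lemma eigenvector_in_orthogonal_complement:
  fixes u :: "nat \<Rightarrow> 'a \<Rightarrow> complex" and ev :: "nat \<Rightarrow> real"
  assumes fin: "finite I" and k: "k < card I"
    and u: "\<And>i. i < k \<Longrightarrow> u i \<in> ell2 I" "\<And>i. i < k \<Longrightarrow> B (u i) = (\<lambda>s. of_real (ev i) * u i s)"
  obtains x l where "x \<in> ell2 I" "ell2_inner I x x = 1" "\<And>i. i < k \<Longrightarrow> ell2_inner I x (u i) = 0"
    "B x = (\<lambda>s. of_real (l :: real) * x s)"
proof -
  define V where "V = {x. x \<in> ell2 I \<and> (\<forall>i<k. ell2_inner I x (u i) = 0)}"
  define Sp where "Sp = {x \<in> V. ell2_inner I x x = 1}"
  have V_add: "(\<lambda>s. x s + c * y s) \<in> V" if "x \<in> V" "y \<in> V" for x y c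
    using that u(1) by (auto simp: V_def ell2_add ell2_scale ell2_inner_add_left ell2_inner_scale_left)
  have V_scale: "(\<lambda>s. c * y s) \<in> V" if "y \<in> V" for y c
    using that by (auto simp: V_def ell2_scale ell2_inner_scale_left)
  have V_B: "B x \<in> V" if "x \<in> V" for x
    using that u by (auto simp: V_def ell2 sym ell2_inner_scale_right)
  have V_ell2: "x \<in> ell2 I" if "x \<in> V" for x using that by (simp add: V_def)
  have norm0: "ell2_inner I x x = 0 \<Longrightarrow> x = (\<lambda>s. 0)" if "x \<in> ell2 I" for x
  proof -
    assume "ell2_inner I x x = 0"
    hence "ell2_norm I x = 0" using that by (simp add: ell2_inner_self)
    thus "x = (\<lambda>s. 0)" using ell2_norm_point[OF that] by (auto simp: fun_eq_iff)
  qed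
  have normalize: "\<exists>c::real. c > 0 \<and> (\<lambda>s. of_real c * y s) \<in> Sp \<and> of_real (1 / c\<^sup>2) = ell2_inner I y y"
    if y: "y \<in> V" "y \<noteq> (\<lambda>s. 0)" for y
  proof -
    have yI: "y \<in> ell2 I" using y by (rule_tac V_ell2)
    have pos: "ell2_norm I y > 0"
      using norm0[OF yI] y(2) ell2_norm_nonneg[of I y] by (auto simp: ell2_inner_self[OF yI] less_le)
    define c where "c = 1 / ell2_norm I y"
    have "ell2_inner I (\<lambda>s. of_real c * y s) (\<lambda>s. of_real c * y s) = of_real (c * c * (ell2_norm I y)\<^sup>2)"
      by (simp add: ell2_inner_scale_left ell2_inner_scale_right ell2_inner_self[OF yI])
    also have "c * c * (ell2_norm I y)\<^sup>2 = 1" using pos by (simp add: c_def power2_eq_square)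
    finally have "(\<lambda>s. of_real c * y s) \<in> Sp" using V_scale[OF y(1)] by (simp add: Sp_def)
    moreover have "of_real (1 / c\<^sup>2) = ell2_inner I y y"
      using pos by (simp add: c_def ell2_inner_self[OF yI] power2_eq_square)
    ultimately show ?thesis using pos by (intro exI[of _ c]) (auto simp: c_def)
  qed
  have "\<exists>y\<in>V. y \<noteq> (\<lambda>s. 0)"
  proof -
    obtain e where e: "bij_betw e {..<card I} I"
      using ex_bij_betw_nat_finite[OF fin] by (auto simp: atLeast0LessThan)
    obtain x where x: "\<exists>m<card I. x m \<noteq> 0"
      "\<And>i. i < k \<Longrightarrow> (\<Sum>m<card I. cnj (u i (e m)) * x m) = 0"
      using homogeneous_system_solution[OF k, of "\<lambda>i m. cnj (u i (e m))"] by blast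
    define y where "y s = (if s \<in> I then x (the_inv_into {..<card I} e s) else 0)" for s
    have ye: "y (e m) = x m" "e m \<in> I" if "m < card I" for m
      using that e by (auto simp: y_def bij_betw_def the_inv_into_f_f)
    have "ell2_inner I y (u i) = 0" if "i < k" for i
    proof -
      have "ell2_inner I y (u i) = (\<Sum>m<card I. y (e m) * cnj (u i (e m)))"
        unfolding ell2_inner_finite[OF fin] by (rule sum.reindex_bij_betw[OF e, symmetric])
      also have "\<dots> = 0" using x(2)[OF that] by (simp add: ye mult.commute)
      finally show ?thesis .
    qed
    moreover have "y \<in> ell2 I" by (simp add: ell2_finite_iff[OF fin] y_def)
    moreover obtain m where "m < card I" "x m \<noteq> 0" using x(1) by auto
    hence "y (e m) \<noteq> 0" by (simp add: ye)
    hence "y \<noteq> (\<lambda>s. 0)" by auto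
    ultimately show ?thesis by (auto simp: V_def)
  qed
  hence ne: "Sp \<noteq> {}" using normalize by blast
  have Sp_sum: "x \<in> Sp \<longleftrightarrow> (\<forall>s. s \<notin> I \<longrightarrow> x s = 0) \<and> (\<forall>i<k. (\<Sum>s\<in>I. x s * cnj (u i s)) = 0) \<and>
      (\<Sum>s\<in>I. x s * cnj (x s)) = 1" for x
    by (auto simp: Sp_def V_def ell2_finite_iff[OF fin] ell2_inner_finite[OF fin])
  \<comment> \<open>Functions carry the product topology. Coordinates off \<open>I\<close> are
    pinned to 0 and the others bounded by 1, so \<open>Sp\<close> is a closed subset of a compact
    product.\<close>
  have "compact Sp"
  proof -
    let ?K = "PiE UNIV (\<lambda>s. if s \<in> I then cball 0 1 else {0 :: complex})"
    let ?C = "(\<Inter>i\<in>{..<k}. {x. (\<Sum>s\<in>I. x s * cnj (u i s)) = 0}) \<inter> {x. (\<Sum>s\<in>I. x s * cnj (x s)) = 1}"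
    have "compactin (product_topology (\<lambda>_. euclidean) UNIV) ?K"
      unfolding compactin_PiE by auto
    hence K: "compact ?K" by (simp only: euclidean_product_topology compactin_euclidean_iff)
    have C: "closed ?C"
      by (intro closed_Int closed_INT ballI closed_Collect_eq continuous_intros continuous_on_product_coordinates)
    have "Sp \<subseteq> ?K"
    proof
      fix x assume "x \<in> Sp"
      hence x: "x \<in> ell2 I" "ell2_inner I x x = 1" by (auto simp: Sp_def V_def)
      have "(ell2_norm I x)\<^sup>2 = 1" using x by (simp add: ell2_inner_self flip: of_real_power)
      hence "ell2_norm I x = 1" using ell2_norm_nonneg[of I x] by (simp add: power2_eq_1_iff)
      thus "x \<in> ?K" using ell2_norm_point[OF x(1)] x(1) by (auto simp: ell2_finite_iff[OF fin])
    qed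
    hence "Sp \<subseteq> ?K \<inter> ?C" by (auto simp: Sp_sum)
    moreover have "x \<in> Sp" if x: "x \<in> ?K \<inter> ?C" for x
    proof -
      have "x s = 0" if "s \<notin> I" for s
        using PiE_mem[OF IntD1[OF x] UNIV_I, of s] that by simp
      thus ?thesis using IntD2[OF x] by (simp add: Sp_sum)
    qed
    ultimately have "Sp = ?K \<inter> ?C" by blast
    thus ?thesis using compact_Int_closed[OF K C] by simp
  qed
  define ind where "ind t = (indicator {t} :: 'a \<Rightarrow> complex)" for t
  have Bx: "ell2_inner I (B x) x = (\<Sum>s\<in>I. (\<Sum>t\<in>I. x t * B (ind t) s) * cnj (x s))" if x: "x \<in> ell2 I" for x
  proof -
    have xs: "x = (\<lambda>s. \<Sum>t\<in>I. x t * ind t s)"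
    proof
      fix s
      have "(\<Sum>t\<in>I. x t * ind t s) = (\<Sum>t\<in>I. if t = s then x s else 0)"
        by (intro sum.cong) (auto simp: ind_def)
      also have "\<dots> = x s" using fin x by (simp add: ell2_finite_iff)
      finally show "x s = (\<Sum>t\<in>I. x t * ind t s)" ..
    qed
    have "B (\<lambda>s. \<Sum>t\<in>J. x t * ind t s) = (\<lambda>s. \<Sum>t\<in>J. x t * B (ind t) s)"
      if "J \<subseteq> I" for J
      using finite_subset[OF that fin] that
    proof (induction J rule: finite_induct)
      case empty
      show ?case using scale[OF ell2_zero, of 0] by simp
    next
      case (insert t J)
      have i: "ind t \<in> ell2 I" if "t \<in> I" for t using that unfolding ind_def by (rule ell2_indicator)
      have "B (\<lambda>s. x t * ind t s + (\<Sum>t\<in>J. x t * ind t s)) =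
          (\<lambda>s. B (\<lambda>s. x t * ind t s) s + B (\<lambda>s. \<Sum>t\<in>J. x t * ind t s) s)"
        using insert.prems i by (intro add ell2_scale ell2_sum) auto
      also have "B (\<lambda>s. x t * ind t s) = (\<lambda>s. x t * B (ind t) s)" using insert.prems i by (intro scale) auto
      also have "B (\<lambda>s. \<Sum>t\<in>J. x t * ind t s) = (\<lambda>s. \<Sum>t\<in>J. x t * B (ind t) s)"
        using insert.prems by (intro insert.IH) auto
      finally show ?case using insert.hyps by simp
    qed
    from this[OF subset_refl] have "B x = (\<lambda>s. \<Sum>t\<in>I. x t * B (ind t) s)" using xs by simp
    thus ?thesis by (simp only: ell2_inner_finite[OF fin])
  qed
  have "continuous_on Sp (\<lambda>x. Re (ell2_inner I (B x) x))"
  proof (rule continuous_on_cong[THEN iffD2, OF refl])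
    show "Re (ell2_inner I (B x) x) = Re (\<Sum>s\<in>I. (\<Sum>t\<in>I. x t * B (ind t) s) * cnj (x s))" if "x \<in> Sp" for x
      using that Bx by (simp add: Sp_def V_def)
    show "continuous_on Sp (\<lambda>x. Re (\<Sum>s\<in>I. (\<Sum>t\<in>I. x t * B (ind t) s) * cnj (x s)))"
      by (rule continuous_on_subset[OF _ subset_UNIV])
        (intro continuous_intros continuous_on_product_coordinates)
  qed
  then obtain x where x: "x \<in> Sp" and max: "\<And>y. y \<in> Sp \<Longrightarrow> Re (ell2_inner I (B y) y) \<le> Re (ell2_inner I (B x) x)"
    using continuous_attains_sup[OF \<open>compact Sp\<close> ne] by blast
  have xV: "x \<in> V" "x \<in> ell2 I" "ell2_inner I x x = 1" using x by (auto simp: Sp_def V_def)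
  define l where "l = Re (ell2_inner I (B x) x)"
  \<comment> \<open>Nonnegative on \<open>V\<close> by homogeneity and maximality of
    \<open>l\<close>, and 0 at \<open>x\<close>.\<close>
  define Q where "Q y = l * Re (ell2_inner I y y) - Re (ell2_inner I (B y) y)" for y
  have Q_nonneg: "Q y \<ge> 0" if y: "y \<in> V" for y
  proof (cases "y = (\<lambda>s. 0)")
    case True
    thus ?thesis by (simp add: Q_def)
  next
    case False
    then obtain c :: real where c: "c > 0" "(\<lambda>s. of_real c * y s) \<in> Sp" "of_real (1 / c\<^sup>2) = ell2_inner I y y"
      using normalize[OF y] by blast
    have "Re (ell2_inner I (B (\<lambda>s. of_real c * y s)) (\<lambda>s. of_real c * y s)) = c\<^sup>2 * Re (ell2_inner I (B y) y)"
      unfolding scale[OF V_ell2[OF y]] ell2_inner_scale_left ell2_inner_scale_right by (simp add: power2_eq_square)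
    hence le: "c\<^sup>2 * Re (ell2_inner I (B y) y) \<le> l" using max[OF c(2)] by (simp add: l_def)
    have "Re (ell2_inner I y y) = 1 / c\<^sup>2" by (simp flip: c(3))
    moreover have "Re (ell2_inner I (B y) y) \<le> l / c\<^sup>2"
      using le c(1) by (simp add: le_divide_eq mult.commute)
    ultimately show ?thesis by (simp add: Q_def)
  qed
  define w where "w = (\<lambda>s. of_real l * x s - B x s)"
  have wV: "w \<in> V" unfolding w_def
    using V_add[OF V_scale[OF xV(1), of "of_real l"] V_B[OF xV(1)], of "-1"] by simp
  have wI: "w \<in> ell2 I" using wV by (rule V_ell2)
  have n_w: "Re (ell2_inner I w w) = (ell2_norm I w)\<^sup>2" by (simp add: ell2_inner_self[OF wI])
  have expand: "Q (\<lambda>s. x s + of_real t * w s) = 2 * t * (ell2_norm I w)\<^sup>2 + t\<^sup>2 * Q w" for t :: real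
  proof -
    let ?y = "\<lambda>s. x s + of_real t * w s"
    note [simp] = xV(2) wI ell2
    have tw: "(\<lambda>s. of_real t * w s) \<in> ell2 I" "(\<lambda>s. of_real t * B w s) \<in> ell2 I" by (simp_all add: ell2_scale)
    have y: "?y \<in> ell2 I" by (intro ell2_add tw) simp
    have By: "B ?y = (\<lambda>s. B x s + of_real t * B w s)" by (simp add: add tw scale)
    have c1: "ell2_inner I ?y ?y = ell2_inner I x x + of_real t * ell2_inner I x w + of_real t * (ell2_inner I w x + of_real t * ell2_inner I w w)"
      by (simp add: ell2_inner_add_left ell2_inner_add_right ell2_inner_scale_left ell2_inner_scale_right tw y)
    have c2: "ell2_inner I (B ?y) ?y = ell2_inner I (B x) x + of_real t * ell2_inner I (B x) w + of_real t * (ell2_inner I (B w) x + of_real t * ell2_inner I (B w) w)"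
      unfolding By
      by (simp add: ell2_inner_add_left ell2_inner_add_right ell2_inner_scale_left ell2_inner_scale_right tw y)
    have c3: "Re (ell2_inner I w x) = Re (ell2_inner I x w)" unfolding ell2_inner_commute[of I w x] by simp
    have c4: "Re (ell2_inner I (B w) x) = Re (ell2_inner I (B x) w)"
      unfolding sym[OF wI xV(2)] ell2_inner_commute[of I w "B x"] by simp
    have c5: "ell2_inner I w w = of_real l * ell2_inner I x w - ell2_inner I (B x) w"
      by (subst (1) w_def) (simp add: ell2_inner_diff_left ell2_scale ell2_inner_scale_left)
    have c6: "(ell2_norm I w)\<^sup>2 = l * Re (ell2_inner I x w) - Re (ell2_inner I (B x) w)"
      using n_w unfolding c5 by simp
    have "Q ?y = (l * Re (ell2_inner I x x) - Re (ell2_inner I (B x) x))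
        + 2 * t * (l * Re (ell2_inner I x w) - Re (ell2_inner I (B x) w)) + t\<^sup>2 * Q w"
      unfolding Q_def c1 c2 by (simp add: c3 c4 algebra_simps power2_eq_square)
    thus ?thesis by (simp add: c6 xV(3) l_def)
  qed
  have "ell2_norm I w = 0"
  proof (rule ccontr)
    assume "ell2_norm I w \<noteq> 0"
    hence n: "(ell2_norm I w)\<^sup>2 > 0" by simp
    define n where "n = (ell2_norm I w)\<^sup>2"
    define q where "q = Q w"
    have q: "q \<ge> 0" unfolding q_def by (rule Q_nonneg[OF wV])
    \<comment> \<open>Minimising \<open>2 * t * n + t\<^sup>2 * q\<close> would suggest
      \<open>- n / q\<close>; the 1 covers \<open>q = 0\<close> and still gives a negative
      value.\<close>
    define t where "t = - n / (q + 1)"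
    have "0 \<le> 2 * t * n + t\<^sup>2 * q"
      using Q_nonneg[OF V_add[OF xV(1) wV, of "of_real t"]] unfolding expand n_def q_def .
    also have "2 * t * n + t\<^sup>2 * q = - (n\<^sup>2 * (q + 2)) / (q + 1)\<^sup>2"
      using q by (simp add: t_def power2_eq_square divide_simps) (simp add: algebra_simps)
    also have "\<dots> < 0" using n q by (simp add: n_def divide_neg_pos)
    finally show False by simp
  qed
  hence "ell2_inner I w w = 0" by (simp add: ell2_inner_self[OF wI])
  hence "w = (\<lambda>s. 0)" by (rule norm0[OF wI])
  hence "B x = (\<lambda>s. of_real l * x s)" by (auto simp: w_def fun_eq_iff)
  thus ?thesis using that[of x l] xV by (auto simp: V_def)
qed

lemma orthonormal_eigenvectors:
  assumes fin: "finite I" and "k \<le> card I"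
  shows "\<exists>u (ev :: nat \<Rightarrow> real). (\<forall>i<k. u i \<in> ell2 I \<and> B (u i) = (\<lambda>s. of_real (ev i) * u i s)) \<and>
    (\<forall>i<k. \<forall>j<k. ell2_inner I (u i) (u j) = (if i = j then 1 else 0))"
  using assms(2)
proof (induction k)
  case (Suc k)
  then obtain u and ev :: "nat \<Rightarrow> real" where u: "\<forall>i<k. u i \<in> ell2 I \<and> B (u i) = (\<lambda>s. of_real (ev i) * u i s)"
    "\<forall>i<k. \<forall>j<k. ell2_inner I (u i) (u j) = (if i = j then 1 else 0)" by auto
  have "k < card I" using Suc.prems by simp
  then obtain x l where x: "x \<in> ell2 I" "ell2_inner I x x = 1" "\<And>i. i < k \<Longrightarrow> ell2_inner I x (u i) = 0"
    "B x = (\<lambda>s. of_real (l :: real) * x s)"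
    using eigenvector_in_orthogonal_complement[OF fin, of k u ev] u(1) by blast
  have x': "ell2_inner I (u i) x = 0" if "i < k" for i
    using x(3)[OF that] ell2_inner_commute[of I "u i" x] by simp
  show ?case
    by (rule exI[of _ "u(k := x)"], rule exI[of _ "ev(k := l)"])
      (use u x x' in \<open>auto simp: less_Suc_eq\<close>)
qed simp

end

section \<open>The Fuglede--Kadison determinant\<close>

text \<open>The left-hand side is a difference of integrals, the second possibly infinite. Comparing
  \<open>a + gm\<close> with \<open>b + gp\<close> keeps all terms nonnegative, and \<open>a\<close>
  is finite because the support is bounded.\<close>

lemma log_integral_le:
  assumes fin: "finite_measure \<mu>" and sets: "sets \<mu> = sets borel"
    and supp: "AE t in \<mu>. 0 \<le> t \<and> t \<le> r"
    and g: "integrable \<mu> g" "\<And>t. t \<ge> 0 \<Longrightarrow> ereal_log t \<le> ereal (g t)"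
  shows "enn2ereal (\<integral>\<^sup>+t\<in>{0..}. e2ennreal (ereal_log t) \<partial>\<mu>)
    - enn2ereal (\<integral>\<^sup>+t\<in>{0..}. e2ennreal (- ereal_log t) \<partial>\<mu>) \<le> ereal (\<integral>t. g t \<partial>\<mu>)"
proof -
  interpret finite_measure \<mu> by (rule fin)
  note [measurable_cong] = sets
  have [measurable]: "ereal_log \<in> borel_measurable borel"
    unfolding ereal_log_def by measurable
  have [measurable]: "g \<in> borel_measurable \<mu>" using g(1) by auto
  define a where "a = (\<integral>\<^sup>+t. e2ennreal (ereal_log t) * indicator {0..} t \<partial>\<mu>)"
  define b where "b = (\<integral>\<^sup>+t. e2ennreal (- ereal_log t) * indicator {0..} t \<partial>\<mu>)"
  define gp where "gp = (\<integral>\<^sup>+t. ennreal (g t) \<partial>\<mu>)"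
  define gm where "gm = (\<integral>\<^sup>+t. ennreal (- g t) \<partial>\<mu>)"
  have G: "gp < \<infinity>" "gm < \<infinity>"
    using g(1) unfolding gp_def gm_def real_integrable_def by (auto simp: less_top)
  have int: "(\<integral>t. g t \<partial>\<mu>) = enn2real gp - enn2real gm"
    unfolding gp_def gm_def by (rule real_lebesgue_integral_def[OF g(1)])
  have a_fin: "a < \<infinity>"
  proof -
    have "a \<le> (\<integral>\<^sup>+t. ennreal (max 0 r) \<partial>\<mu>)"
      unfolding a_def
    proof (rule nn_integral_mono_AE, use supp in eventually_elim)
      fix t assume t: "0 \<le> t \<and> t \<le> r"
      have "ereal_log t \<le> ereal (max 0 r)"
        using t ln_le_minus_one[of t] by (auto simp: ereal_log_def)
      hence "e2ennreal (ereal_log t) \<le> e2ennreal (ereal (max 0 r))" by (rule e2ennreal_mono)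
      thus "e2ennreal (ereal_log t) * indicator {0..} t \<le> ennreal (max 0 r)"
        using t by (simp add: e2ennreal_ereal)
    qed
    also have "\<dots> < \<infinity>" 
      using emeasure_finite[of "space \<mu>"] by (simp add: ennreal_mult_eq_top_iff less_top[symmetric])
    finally show ?thesis .
  qed
  have "a + gm = (\<integral>\<^sup>+t. e2ennreal (ereal_log t) * indicator {0..} t + ennreal (- g t) \<partial>\<mu>)"
    unfolding a_def gm_def by (rule nn_integral_add[symmetric]) measurable
  also have "\<dots> \<le> (\<integral>\<^sup>+t. e2ennreal (- ereal_log t) * indicator {0..} t + ennreal (g t) \<partial>\<mu>)"
  proof (rule nn_integral_mono_AE, use supp in eventually_elim)
    fix t assume t: "0 \<le> t \<and> t \<le> r"
    have "e2ennreal (ereal_log t) + ennreal (- g t) \<le> e2ennreal (- ereal_log t) + ennreal (g t)"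
    proof (cases "t = 0")
      \<comment> \<open>At 0 the right-hand side is infinite.\<close>
      case True
      thus ?thesis by (simp add: ereal_log_def e2ennreal_infty e2ennreal_neg)
    next
      case False
      hence l: "ereal_log t = ereal (ln t)" "ln t \<le> g t" using t g(2)[of t] by (auto simp: ereal_log_def)
      have "ennreal (ln t) + ennreal (- g t) \<le> ennreal (- ln t) + ennreal (g t)"
        using l(2) by (cases "ln t \<ge> 0"; cases "g t \<ge> 0")
          (auto simp: ennreal_neg ennreal_le_iff2 intro: ennreal_leI)
      thus ?thesis by (simp add: l e2ennreal_ereal)
    qed
    thus "e2ennreal (ereal_log t) * indicator {0..} t + ennreal (- g t)
        \<le> e2ennreal (- ereal_log t) * indicator {0..} t + ennreal (g t)" using t by simp
  qed
  also have "\<dots> = b + gp"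
    unfolding b_def gp_def by (rule nn_integral_add) measurable
  finally have le: "a + gm \<le> b + gp" .
  obtain a' where a': "a = ennreal a'" "a' \<ge> 0" using a_fin by (cases a) auto
  obtain p where p: "gp = ennreal p" "p \<ge> 0" using G by (cases gp) auto
  obtain m where m: "gm = ennreal m" "m \<ge> 0" using G by (cases gm) auto
  have "enn2ereal a - enn2ereal b \<le> ereal (p - m)"
  proof (cases b)
    case (real b')
    have "ennreal (a' + m) \<le> ennreal (b' + p)" using le a' p m real by (simp add: ennreal_plus)
    hence "a' + m \<le> b' + p" using real p by (subst (asm) ennreal_le_iff) auto
    thus ?thesis using a' real by (simp add: enn2ereal_ennreal)
  next
    case top
    thus ?thesis using a' by (simp add: enn2ereal_ennreal)
  qed
  thus ?thesis unfolding int using p m by (simp add: a_def b_def)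
qed

context group_ring_element
begin

lemma positive_operator_norm_bound:
  assumes "positive_operator I Q"
  obtains c where "c > 0" "\<And>x. x \<in> ell2 I \<Longrightarrow> Re (ell2_inner I (Q x) x) \<le> c * (ell2_norm I x)\<^sup>2"
proof -
  obtain K where K: "\<forall>x\<in>ell2 I. ell2_norm I (Q x) \<le> K * ell2_norm I x"
    using assms unfolding positive_operator_def bounded_operator_def by blast
  show ?thesis
  proof (rule that[of "\<bar>K\<bar> + 1"])
    fix x assume x: "x \<in> ell2 I"
    have Qx: "Q x \<in> ell2 I" using assms x by (auto simp: positive_operator_def bounded_operator_def)
    have "Re (ell2_inner I (Q x) x) \<le> ell2_norm I (Q x) * ell2_norm I x"
      using complex_Re_le_cmod ell2_Cauchy_Schwarz[OF Qx x] by (rule order_trans)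
    also have "\<dots> \<le> (K * ell2_norm I x) * ell2_norm I x"
      using K x by (intro mult_right_mono) (auto simp: ell2_norm_nonneg)
    also have "\<dots> = K * (ell2_norm I x)\<^sup>2" by (simp add: power2_eq_square)
    also have "\<dots> \<le> (\<bar>K\<bar> + 1) * (ell2_norm I x)\<^sup>2" by (intro mult_right_mono) auto
    finally show "Re (ell2_inner I (Q x) x) \<le> (\<bar>K\<bar> + 1) * (ell2_norm I x)\<^sup>2" .
  qed simp
qed

abbreviation \<delta> :: "'a \<Rightarrow> 'a \<Rightarrow> complex" where "\<delta> t \<equiv> indicator {t}"

lemma \<delta>_ell2: "t \<in> carrier G \<Longrightarrow> \<delta> t \<in> ell2 I"
  by (rule ell2_indicator)

lemma \<delta>_norm: "t \<in> carrier G \<Longrightarrow> ell2_norm I (\<delta> t) = 1"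
proof -
  assume t: "t \<in> carrier G"
  have "(ell2_norm I (\<delta> t))\<^sup>2 = Re (ell2_inner I (\<delta> t) (\<delta> t))" by (simp add: ell2_inner_self \<delta>_ell2 t)
  also have "\<dots> = 1" unfolding ell2_inner_indicator[OF t] by simp
  finally show ?thesis using ell2_norm_nonneg[of I "\<delta> t"] by (simp add: power2_eq_1_iff)
qed

lemma R_pow: "(R ^^ (2 * n)) (\<delta> \<one>) = (P ^^ n) (\<delta> \<one>)"
proof (induction n)
  case (Suc n)
  have "(R ^^ (2 * Suc n)) (\<delta> \<one>) = R (R ((P ^^ n) (\<delta> \<one>)))" by (simp add: Suc)
  also have "\<dots> = P ((P ^^ n) (\<delta> \<one>))" by (intro R(2) P.pow_ell2 \<delta>_ell2) simp
  finally show ?case by simp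
qed simp

text \<open>The specification behind \<open>SOME\<close> bounds the support only in absolute value.
  That negative numbers carry no mass follows by comparison with the measure \<open>M\<close> from
  the moment problem, which has the same moments. Even moments are those of
  \<open>P\<close>.\<close>

lemma FK_measure:
  obtains r where "finite_measure (FK_measure G f)" "sets (FK_measure G f) = sets borel"
    "AE t in FK_measure G f. 0 \<le> t \<and> t \<le> r"
    "\<And>n. of_real (\<integral>t. (t\<^sup>2) ^ n \<partial>FK_measure G f) = ell2_inner I ((P ^^ n) (\<delta> \<one>)) (\<delta> \<one>)"
proof -
  interpret R: ell2_symmetric I R by (rule positive_operator_symmetric[OF R(1)])
  obtain c where c: "c > 0" "\<And>x. x \<in> ell2 I \<Longrightarrow> Re (ell2_inner I (R x) x) \<le> c * (ell2_norm I x)\<^sup>2"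
    using positive_operator_norm_bound[OF R(1)] by blast
  have pos: "0 \<le> Re (ell2_inner I (R x) x)" if "x \<in> ell2 I" for x
    using R(1) that by (auto simp: positive_operator_def complex_nonneg_Reals_iff)
  obtain M where M: "real_distribution M" "AE t in M. 0 \<le> t \<and> t \<le> c"
    "\<And>n. ell2_inner I ((R ^^ n) (\<delta> \<one>)) (\<delta> \<one>) = of_real (\<integral>t. t ^ n \<partial>M)"
    using R.positive_spectral_measure[OF c(1) pos c(2) \<delta>_ell2 \<delta>_norm, of \<one>] by blast
  interpret M: real_distribution M by (rule M(1))
  let ?\<mu> = "FK_measure G f"
  have eq: "?\<mu> = (SOME \<mu>. is_spectral_measure I R (\<delta> \<one>) \<mu>)"
    by (simp add: FK_measure_def R_def spectral_measure_def Let_def)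
  have "AE t in M. \<bar>t\<bar> \<le> c" using M(2) by eventually_elim auto
  hence "is_spectral_measure I R (\<delta> \<one>) M"
    unfolding is_spectral_measure_def using M(3) M.finite_measure_axioms by auto
  hence "is_spectral_measure I R (\<delta> \<one>) ?\<mu>" 
    unfolding eq by (rule someI[of "is_spectral_measure I R (\<delta> \<one>)"])
  then obtain r where \<mu>: "sets ?\<mu> = sets borel" "finite_measure ?\<mu>" "AE t in ?\<mu>. \<bar>t\<bar> \<le> r"
    "\<And>n. ell2_inner I ((R ^^ n) (\<delta> \<one>)) (\<delta> \<one>) = of_real (\<integral>t. t ^ n \<partial>?\<mu>)"
    unfolding is_spectral_measure_def by blast
  have mom: "(\<integral>t. t ^ n \<partial>?\<mu>) = (\<integral>t. t ^ n \<partial>M)" for n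
    using \<mu>(4)[of n] M(3)[of n] by simp
  \<comment> \<open>Bounded, continuous, and positive exactly on the negative numbers.\<close>
  define g where "g t = min 1 (max 0 (- t))" for t :: real
  have g: "continuous_on UNIV g" unfolding g_def by (intro continuous_intros)
  have g_meas [measurable]: "g \<in> borel_measurable borel" using g by (rule borel_measurable_continuous_onI)
  define MM where "MM b = (if b then ?\<mu> else M)" for b
  define aa where "aa b = (if b then 1 else -1 :: real)" for b
  have "(\<Sum>b\<in>UNIV. aa b * (\<integral>t. g t \<partial>MM b)) = 0"
  proof (rule moment_relation_continuous[where r = "max r c"])
    show "AE t in MM b. \<bar>t\<bar> \<le> max r c" for b
    proof (cases b)
      case True
      show ?thesis using \<mu>(3) unfolding MM_def if_P[OF True] by eventually_elim auto
    next
      case False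
      show ?thesis using M(2) unfolding MM_def if_not_P[OF False] by eventually_elim auto
    qed
    show "finite_measure (MM b)" for b using \<mu>(2) M.finite_measure_axioms by (simp add: MM_def)
    show "sets (MM b) = sets borel" for b using \<mu>(1) by (simp add: MM_def)
  qed (simp_all add: g UNIV_bool aa_def MM_def mom)
  hence "(\<integral>t. g t \<partial>?\<mu>) = (\<integral>t. g t \<partial>M)" by (simp add: UNIV_bool aa_def MM_def)
  also have "\<dots> = (\<integral>t. 0 \<partial>M)"
    by (rule integral_cong_AE) (use M(2) in \<open>auto simp: g_def elim!: eventually_mono\<close>)
  finally have "(\<integral>t. g t \<partial>?\<mu>) = 0" by simp
  moreover have "integrable ?\<mu> g"
    by (rule finite_measure.integrable_const_bound[OF \<mu>(2), where B = 1])
      (auto simp: g_def measurable_cong_sets[OF \<mu>(1) refl] intro!: g_meas[unfolded g_def])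
  ultimately have "AE t in ?\<mu>. g t = 0"
    by (subst (asm) integral_nonneg_eq_0_iff_AE) (auto simp: g_def)
  hence "AE t in ?\<mu>. 0 \<le> t \<and> t \<le> r"
    using \<mu>(3) by eventually_elim (auto simp: g_def min_def max_def split: if_splits)
  moreover have "of_real (\<integral>t. (t\<^sup>2) ^ n \<partial>?\<mu>) = ell2_inner I ((P ^^ n) (\<delta> \<one>)) (\<delta> \<one>)" for n
    using \<mu>(4)[of "2 * n"] by (simp add: R_pow power_mult)
  ultimately show ?thesis using that \<mu> by blast
qed

text \<open>The \<open>u i\<close> diagonalise the compression of \<open>P\<close> to
  \<open>F\<close>, so the product of the \<open>ev i\<close> is the Gram determinant of the vectors
  \<open>T (\<delta> s)\<close>. The moments are those of \<open>P\<close> itself and not of its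
  compression: only the first one is \<open>ev i\<close>, but their sum over \<open>i\<close> is a
  trace.\<close>

lemma compression_eigenbasis:
  assumes F: "finite F" "F \<subseteq> carrier G"
  obtains u :: "nat \<Rightarrow> 'a \<Rightarrow> complex" and ev :: "nat \<Rightarrow> real" and B
  where "\<And>i. i < card F \<Longrightarrow> u i \<in> ell2 I" "\<And>i. i < card F \<Longrightarrow> ell2_norm I (u i) = 1"
    "\<And>i. i < card F \<Longrightarrow> ell2_inner I (P (u i)) (u i) = of_real (ev i)"
    "\<And>n. (\<Sum>i<card F. ell2_inner I ((P ^^ n) (u i)) (u i)) = of_nat (card F) * ell2_inner I ((P ^^ n) (\<delta> \<one>)) (\<delta> \<one>)"
    "finite B" "B \<subseteq> carrier G"
    "(\<Prod>i<card F. ev i) \<le> (inj_sum (\<lambda>u t. cmod (f (t \<otimes> inv u))) F B)\<^sup>2"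
proof -
  define N where "N = card F"
  define BF where "BF x = (\<lambda>t. if t \<in> F then P x t else 0)" for x
  have sub: "x \<in> ell2 I" if "x \<in> ell2 F" for x
    using that F by (auto simp: ell2_def intro!: finite_nonzero_values_imp_summable_on finite_subset[OF _ F(1)])
  have inner: "ell2_inner I x y = (\<Sum>t\<in>F. x t * cnj (y t))" if "y \<in> ell2 F" for x y
  proof -
    have "ell2_inner I x y = (\<Sum>\<^sub>\<infinity>t\<in>F. x t * cnj (y t))"
      unfolding ell2_inner_def using that F by (intro infsum_cong_neutral) (auto simp: ell2_def)
    thus ?thesis using F by simp
  qed
  have innerF: "ell2_inner F x y = ell2_inner I x y" if "y \<in> ell2 F" for x y
    unfolding inner[OF that] ell2_inner_finite[OF F(1)] ..
  have BFP: "ell2_inner I (BF x) y = ell2_inner I (P x) y" if "y \<in> ell2 F" for x y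
    unfolding inner[OF that] by (intro sum.cong) (auto simp: BF_def)
  interpret BF: ell2_symmetric F BF
  proof
    fix x assume x: "x \<in> ell2 F"
    show "BF x \<in> ell2 F" by (simp add: ell2_finite_iff[OF F(1)] BF_def)
    show "BF (\<lambda>s. c * x s) = (\<lambda>s. c * BF x s)" for c
      unfolding BF_def P.scale[OF sub[OF x]] by auto
    fix y assume y: "y \<in> ell2 F"
    show "BF (\<lambda>s. x s + y s) = (\<lambda>s. BF x s + BF y s)"
      unfolding BF_def P.add[OF sub[OF x] sub[OF y]] by auto
    show "ell2_inner F (BF x) y = ell2_inner F x (BF y)"
      unfolding innerF[OF y] BFP[OF y] P.sym[OF sub[OF x] sub[OF y]]
      unfolding ell2_inner_commute[of F x "BF y"] innerF[OF x] BFP[OF x]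
      by (rule ell2_inner_commute)
  qed
  obtain u and ev :: "nat \<Rightarrow> real" where
    u: "\<And>i. i < N \<Longrightarrow> u i \<in> ell2 F" "\<And>i. i < N \<Longrightarrow> BF (u i) = (\<lambda>s. of_real (ev i) * u i s)"
    and orth: "\<And>i j. i < N \<Longrightarrow> j < N \<Longrightarrow> ell2_inner F (u i) (u j) = (if i = j then 1 else 0)"
    using BF.orthonormal_eigenvectors[OF F(1), of N] unfolding N_def by blast
  obtain e where e: "bij_betw e {0..<N} F"
    using ex_bij_betw_nat_finite[OF F(1)] unfolding N_def by blast
  have eF: "e a \<in> F" "e a \<in> carrier G" if "a < N" for a using that e F by (auto simp: bij_betw_def)
  have e_eq: "e a = e b \<longleftrightarrow> a = b" if "a < N" "b < N" for a b
    using that e by (auto simp: bij_betw_def dest: inj_onD)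
  have sumF: "(\<Sum>s\<in>F. h s) = (\<Sum>a=0..<N. h (e a))" for h :: "'a \<Rightarrow> complex"
    by (rule sum.reindex_bij_betw[OF e, symmetric])
  \<comment> \<open>The eigenvectors are the columns of \<open>U\<close>. A left inverse of a square
    matrix is a right inverse, which turns orthonormality into the completeness relation
    \<open>compl\<close>.\<close>
  define U where "U = Matrix.mat N N (\<lambda>(a, i). u i (e a))"
  define V where "V = Matrix.mat N N (\<lambda>(i, a). cnj (u i (e a)))"
  have UV: "U \<in> carrier_mat N N" "V \<in> carrier_mat N N" by (simp_all add: U_def V_def)
  have VU: "V * U = 1\<^sub>m N"
  proof (rule eq_matI)
    fix i j assume "i < dim_row (1\<^sub>m N :: complex Matrix.mat)" "j < dim_col (1\<^sub>m N :: complex Matrix.mat)"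
    hence ij: "i < N" "j < N" by auto
    have "(V * U) $$ (i, j) = (\<Sum>a=0..<N. cnj (u i (e a)) * u j (e a))"
      using ij by (simp add: U_def V_def scalar_prod_def)
    also have "\<dots> = ell2_inner F (u j) (u i)"
      unfolding ell2_inner_finite[OF F(1)] sumF by (simp add: mult.commute)
    finally show "(V * U) $$ (i, j) = 1\<^sub>m N $$ (i, j)" using ij orth by simp
  qed (simp_all add: U_def V_def)
  have "U * V = 1\<^sub>m N" by (rule mat_mult_left_right_inverse[OF UV(2,1) VU])
  hence compl': "(\<Sum>i<N. u i (e a) * cnj (u i (e b))) = (if a = b then 1 else 0)" if ab: "a < N" "b < N" for a b
  proof -
    assume "U * V = 1\<^sub>m N"
    hence "(U * V) $$ (a, b) = 1\<^sub>m N $$ (a, b)" by simp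
    moreover have "(U * V) $$ (a, b) = (\<Sum>i=0..<N. u i (e a) * cnj (u i (e b)))"
      using ab by (simp add: U_def V_def scalar_prod_def)
    ultimately show ?thesis using ab by (simp add: atLeast0LessThan)
  qed
  have compl: "(\<Sum>i<N. u i s * cnj (u i t)) = (if s = t then 1 else 0)" if "s \<in> F" "t \<in> F" for s t
  proof -
    have Fe: "F = e ` {0..<N}" using e by (simp add: bij_betw_def)
    obtain a where a: "a < N" "s = e a" using \<open>s \<in> F\<close> unfolding Fe by auto
    obtain b where b: "b < N" "t = e b" using \<open>t \<in> F\<close> unfolding Fe by auto
    show ?thesis using compl'[OF a(1) b(1)] e_eq[OF a(1) b(1)] a b by simp
  qed
  \<comment> \<open>By symmetry the power of \<open>P\<close> is moved onto a unit vector, as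
    \<open>u i\<close> vanishes off \<open>F\<close> while its images under \<open>P\<close> need
    not.\<close>
  have point: "(P ^^ n) (u i) s = (\<Sum>t\<in>F. u i t * cnj ((P ^^ n) (\<delta> s) t))" if "i < N" "s \<in> F" for i n s
  proof -
    have s: "s \<in> carrier G" using that F by auto
    have "(P ^^ n) (u i) s = ell2_inner I ((P ^^ n) (u i)) (\<delta> s)" by (rule ell2_inner_indicator[OF s, symmetric])
    also have "\<dots> = ell2_inner I (u i) ((P ^^ n) (\<delta> s))" by (rule P.pow_sym[OF sub[OF u(1)[OF that(1)]] \<delta>_ell2[OF s]])
    also have "\<dots> = cnj (ell2_inner I ((P ^^ n) (\<delta> s)) (u i))" by (rule ell2_inner_commute)
    also have "\<dots> = (\<Sum>t\<in>F. u i t * cnj ((P ^^ n) (\<delta> s) t))"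
      unfolding inner[OF u(1)[OF that(1)]] by (simp add: mult.commute)
    finally show ?thesis .
  qed
  have trace: "(\<Sum>i<N. ell2_inner I ((P ^^ n) (u i)) (u i)) = of_nat N * ell2_inner I ((P ^^ n) (\<delta> \<one>)) (\<delta> \<one>)" for n
  proof -
    have "(\<Sum>i<N. ell2_inner I ((P ^^ n) (u i)) (u i)) =
        (\<Sum>i<N. \<Sum>s\<in>F. \<Sum>t\<in>F. cnj ((P ^^ n) (\<delta> s) t) * (u i t * cnj (u i s)))"
    proof (rule sum.cong[OF refl])
      fix i assume "i \<in> {..<N}"
      hence i: "i < N" by simp
      have "(P ^^ n) (u i) s * cnj (u i s) = (\<Sum>t\<in>F. cnj ((P ^^ n) (\<delta> s) t) * (u i t * cnj (u i s)))"
        if "s \<in> F" for s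
        unfolding point[OF i that] sum_distrib_right by (intro sum.cong refl) (simp add: mult_ac)
      thus "ell2_inner I ((P ^^ n) (u i)) (u i) =
          (\<Sum>s\<in>F. \<Sum>t\<in>F. cnj ((P ^^ n) (\<delta> s) t) * (u i t * cnj (u i s)))"
        unfolding inner[OF u(1)[OF i]] by (rule sum.cong[OF refl])
    qed
    also have "\<dots> = (\<Sum>s\<in>F. \<Sum>t\<in>F. cnj ((P ^^ n) (\<delta> s) t) * (\<Sum>i<N. u i t * cnj (u i s)))"
      unfolding sum_distrib_left sum.swap[of _ F "{..<N}"] ..
    also have "\<dots> = (\<Sum>s\<in>F. \<Sum>t\<in>F. if t = s then cnj ((P ^^ n) (\<delta> s) s) else 0)"
      by (rule sum.cong[OF refl], rule sum.cong[OF refl]) (auto simp: compl)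
    also have "\<dots> = (\<Sum>s\<in>F. cnj ((P ^^ n) (\<delta> s) s))" using F by simp
    also have "\<dots> = (\<Sum>s\<in>F. ell2_inner I ((P ^^ n) (\<delta> \<one>)) (\<delta> \<one>))"
    proof (rule sum.cong[OF refl])
      fix s assume "s \<in> F"
      hence s: "s \<in> carrier G" using F by auto
      have "cnj ((P ^^ n) (\<delta> s) s) = cnj (ell2_inner I ((P ^^ n) (\<delta> s)) (\<delta> s))"
        by (simp only: ell2_inner_indicator[OF s])
      also have "\<dots> = ell2_inner I (\<delta> s) ((P ^^ n) (\<delta> s))" by (rule ell2_inner_commute[symmetric])
      also have "\<dots> = ell2_inner I ((P ^^ n) (\<delta> s)) (\<delta> s)" using s by (intro P.pow_sym[symmetric] \<delta>_ell2)
      finally show "cnj ((P ^^ n) (\<delta> s) s) = ell2_inner I ((P ^^ n) (\<delta> \<one>)) (\<delta> \<one>)"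
        unfolding P_pow_indicator[OF s] .
    qed
    finally show ?thesis by (simp add: N_def)
  qed
  \<comment> \<open>This finite set contains the supports of all \<open>T (\<delta> s)\<close> with
    \<open>s\<close> in \<open>F\<close>, so the Gram sums are finite.\<close>
  define B where "B = {s. f s \<noteq> 0} <#> F"
  have B: "finite B" "B \<subseteq> carrier G"
    unfolding B_def using supp F by (auto intro!: finite_set_mult simp: set_mult_closed[THEN subsetD])
  have T0: "T (\<delta> s) t = 0" if "s \<in> F" "t \<in> carrier G - B" for s t
  proof -
    have s: "s \<in> carrier G" using that F by auto
    have "t = (t \<otimes> inv s) \<otimes> s" using that s by (simp add: m_assoc)
    hence "f (t \<otimes> inv s) = 0" using that by (auto simp: B_def set_mult_def)
    thus ?thesis using that s by (simp add: T_indicator)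
  qed
  define M where "M = Matrix.mat N N (\<lambda>(a, b). \<Sum>t\<in>B. T (\<delta> (e b)) t * cnj (T (\<delta> (e a)) t))"
  have M: "M \<in> carrier_mat N N" by (simp add: M_def)
  have Mab: "(\<Sum>t\<in>B. T (\<delta> (e b)) t * cnj (T (\<delta> (e a)) t)) = cnj (P (\<delta> (e a)) (e b))" if "a < N" "b < N" for a b
  proof -
    have "ell2_inner I (T (\<delta> (e b))) (T (\<delta> (e a))) = (\<Sum>\<^sub>\<infinity>t\<in>B. T (\<delta> (e b)) t * cnj (T (\<delta> (e a)) t))"
      unfolding ell2_inner_def using that B T0 eF by (intro infsum_cong_neutral) auto
    hence "(\<Sum>t\<in>B. T (\<delta> (e b)) t * cnj (T (\<delta> (e a)) t)) = ell2_inner I (T (\<delta> (e b))) (T (\<delta> (e a)))"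
      using B by simp
    also have "\<dots> = ell2_inner I (P (\<delta> (e b))) (\<delta> (e a))" using eF that by (intro P_inner[symmetric] \<delta>_ell2) auto
    also have "\<dots> = ell2_inner I (\<delta> (e b)) (P (\<delta> (e a)))" using eF that by (intro P.sym \<delta>_ell2) auto
    also have "\<dots> = cnj (ell2_inner I (P (\<delta> (e a))) (\<delta> (e b)))" by (rule ell2_inner_commute)
    finally show ?thesis using eF that by (simp only: ell2_inner_indicator)
  qed
  define D where "D = Matrix.mat N N (\<lambda>(i, j). if i = j then complex_of_real (ev i) else 0)"
  have D: "D \<in> carrier_mat N N" by (simp add: D_def)
  \<comment> \<open>The Gram matrix represents the compression in the basis of unit vectors, so the
    columns of \<open>U\<close> are its eigenvectors.\<close>
  have "M * U = U * D"
  proof (rule eq_matI)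
    fix a i assume "a < dim_row (U * D)" "i < dim_col (U * D)"
    hence ai: "a < N" "i < N" by (auto simp: U_def D_def)
    have "(M * U) $$ (a, i) = (\<Sum>b=0..<N. cnj (P (\<delta> (e a)) (e b)) * u i (e b))"
      using ai by (simp add: M_def U_def scalar_prod_def Mab)
    also have "\<dots> = (\<Sum>t\<in>F. u i t * cnj ((P ^^ 1) (\<delta> (e a)) t))"
      unfolding sumF by (simp add: mult.commute)
    also have "\<dots> = P (u i) (e a)" using point[OF ai(2) eF(1)[OF ai(1)], of 1] by simp
    also have "\<dots> = BF (u i) (e a)" using eF ai by (simp add: BF_def)
    also have "\<dots> = of_real (ev i) * u i (e a)" using u(2)[OF ai(2)] by simp
    also have "\<dots> = (\<Sum>j=0..<N. if j = i then u i (e a) * of_real (ev i) else 0)" using ai by simp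
    also have "\<dots> = (\<Sum>j=0..<N. u j (e a) * (if j = i then complex_of_real (ev j) else 0))"
      by (rule sum.cong[OF refl]) simp
    also have "\<dots> = (U * D) $$ (a, i)"
      using ai by (simp add: U_def D_def scalar_prod_def)
    finally show "(M * U) $$ (a, i) = (U * D) $$ (a, i)" .
  qed (simp_all add: M_def U_def D_def)
  hence "mdet M * mdet U = mdet U * mdet D"
    unfolding det_mult[OF M UV(1), symmetric] det_mult[OF UV(1) D, symmetric] by simp
  moreover have "mdet U \<noteq> 0" using det_mult[OF UV(2,1)] VU by auto
  ultimately have "mdet M = mdet D" by simp
  also have "mdet D = prod_list (diag_mat D)"
    by (rule det_upper_triangular[OF _ D]) (auto simp: D_def)
  also have "diag_mat D = map (\<lambda>i. complex_of_real (ev i)) [0..<N]"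
    by (auto simp: diag_mat_def D_def)
  also have "prod_list \<dots> = (\<Prod>i<N. complex_of_real (ev i))"
    by (subst prod.distinct_set_conv_list[symmetric]) (auto simp: atLeast0LessThan)
  finally have detM: "mdet M = of_real (\<Prod>i<N. ev i)" by simp
  have "(\<Prod>i<N. ev i) \<le> cmod (mdet M)" unfolding detM norm_of_real by simp
  also have "\<dots> \<le> (inj_sum (\<lambda>a t. cmod (T (\<delta> (e a)) t)) {0..<N} B)\<^sup>2"
    unfolding M_def by (rule gram_det_le[OF B(1)])
  also have "inj_sum (\<lambda>a t. cmod (T (\<delta> (e a)) t)) {0..<N} B = inj_sum (\<lambda>a t. cmod (f (t \<otimes> inv (e a)))) {0..<N} B"
    using B eF by (intro inj_sum_cong) (auto simp: T_indicator subset_iff)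
  also have "\<dots> = inj_sum (\<lambda>u t. cmod (f (t \<otimes> inv u))) F B"
    using inj_sum_reindex[of e "{0..<N}" "\<lambda>t. t" B "\<lambda>u t. cmod (f (t \<otimes> inv u))"] e B
    by (simp add: bij_betw_def)
  finally have det: "(\<Prod>i<N. ev i) \<le> (inj_sum (\<lambda>u t. cmod (f (t \<otimes> inv u))) F B)\<^sup>2" .
  have norm: "ell2_norm I (u i) = 1" if "i < N" for i
  proof -
    have "(ell2_norm I (u i))\<^sup>2 = Re (ell2_inner I (u i) (u i))"
      using sub[OF u(1)[OF that]] by (simp add: ell2_inner_self)
    also have "\<dots> = 1" unfolding innerF[OF u(1)[OF that], symmetric] using orth that by simp
    finally show ?thesis using ell2_norm_nonneg[of I "u i"] by (simp add: power2_eq_1_iff)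
  qed
  have eval: "ell2_inner I (P (u i)) (u i) = of_real (ev i)" if "i < N" for i
    unfolding BFP[OF u(1)[OF that], symmetric] u(2)[OF that] ell2_inner_scale_left
    unfolding innerF[OF u(1)[OF that], symmetric] using orth that by simp
  show ?thesis
    by (rule that[of u ev B]) (use sub u norm eval trace B det in \<open>auto simp: N_def\<close>)
qed

text \<open>
  The eigenvalues of the compression of \<open>P = T\<^sup>* T\<close> to \<open>F\<close> dominate the spectral measure of
  \<open>P\<close> after taking logarithms: this is Jensen's inequality for the spectral measures of \<open>P\<close> at the
  eigenvectors, whose sum is \<open>card F\<close> times the spectral measure at the unit.
\<close>

lemma log_det_compression:
  assumes F: "finite F" "F \<noteq> {}" "F \<subseteq> carrier G"
  obtains B and ev :: "nat \<Rightarrow> real" where "finite B" "B \<subseteq> carrier G"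
    "\<And>i. i < card F \<Longrightarrow> ev i \<ge> 0"
    "(\<Prod>i<card F. ev i) \<le> (inj_sum (\<lambda>u t. cmod (f (t \<otimes> inv u))) F B)\<^sup>2"
    "\<And>\<epsilon>. \<epsilon> > 0 \<Longrightarrow> FK_det G f \<le> ereal (ln (\<Prod>i<card F. ev i + \<epsilon>) / (2 * card F))"
proof -
  let ?N = "card F"
  have N: "?N > 0" using F by (simp add: card_gt_0_iff)
  obtain u :: "nat \<Rightarrow> 'a \<Rightarrow> complex" and ev :: "nat \<Rightarrow> real" and B
    where u: "\<And>i. i < ?N \<Longrightarrow> u i \<in> ell2 I" "\<And>i. i < ?N \<Longrightarrow> ell2_norm I (u i) = 1"
    "\<And>i. i < ?N \<Longrightarrow> ell2_inner I (P (u i)) (u i) = of_real (ev i)"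
    "\<And>n. (\<Sum>i<?N. ell2_inner I ((P ^^ n) (u i)) (u i)) = of_nat ?N * ell2_inner I ((P ^^ n) (\<delta> \<one>)) (\<delta> \<one>)"
    and B: "finite B" "B \<subseteq> carrier G"
    and det: "(\<Prod>i<?N. ev i) \<le> (inj_sum (\<lambda>u t. cmod (f (t \<otimes> inv u))) F B)\<^sup>2"
    by (rule compression_eigenbasis[OF F(1,3)]) (rule that)
  have ev: "ev i \<ge> 0" if "i < ?N" for i
    using P_pos[OF u(1)[OF that]] unfolding u(3)[OF that] by simp
  define \<mu> where "\<mu> = FK_measure G f"
  obtain r where "finite_measure (FK_measure G f)" "sets (FK_measure G f) = sets borel"
    "AE t in FK_measure G f. 0 \<le> t \<and> t \<le> r"
    "\<And>n. of_real (\<integral>t. (t\<^sup>2) ^ n \<partial>FK_measure G f) = ell2_inner I ((P ^^ n) (\<delta> \<one>)) (\<delta> \<one>)"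
    by (rule FK_measure) (rule that)
  note \<mu> = this[folded \<mu>_def]
  have "\<forall>i\<in>{..<?N}. \<exists>M. real_distribution M \<and> (AE t in M. 0 \<le> t \<and> t \<le> P_bound) \<and>
      (\<forall>n. ell2_inner I ((P ^^ n) (u i)) (u i) = of_real (\<integral>t. t ^ n \<partial>M))"
  proof
    fix i assume "i \<in> {..<?N}"
    hence i: "i < ?N" by simp
    obtain M where "real_distribution M" "AE t in M. 0 \<le> t \<and> t \<le> P_bound"
      "\<And>n. ell2_inner I ((P ^^ n) (u i)) (u i) = of_real (\<integral>t. t ^ n \<partial>M)"
      by (rule P.positive_spectral_measure[OF P_bound_pos P_pos P_le u(1)[OF i] u(2)[OF i]]) (assumption | rule that)+
    thus "\<exists>M. real_distribution M \<and> (AE t in M. 0 \<le> t \<and> t \<le> P_bound) \<and>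
      (\<forall>n. ell2_inner I ((P ^^ n) (u i)) (u i) = of_real (\<integral>t. t ^ n \<partial>M))" by blast
  qed
  from bchoice[OF this] obtain \<nu> where \<nu>_all: "\<forall>i\<in>{..<?N}. real_distribution (\<nu> i) \<and>
      (AE t in \<nu> i. 0 \<le> t \<and> t \<le> P_bound) \<and>
      (\<forall>n. ell2_inner I ((P ^^ n) (u i)) (u i) = of_real (\<integral>t. t ^ n \<partial>\<nu> i))" by blast
  have \<nu>: "\<And>i. i < ?N \<Longrightarrow> real_distribution (\<nu> i)"
    "\<And>i. i < ?N \<Longrightarrow> AE t in \<nu> i. 0 \<le> t \<and> t \<le> P_bound"
    "\<And>i n. i < ?N \<Longrightarrow> ell2_inner I ((P ^^ n) (u i)) (u i) = of_real (\<integral>t. t ^ n \<partial>\<nu> i)"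
    using \<nu>_all by simp_all
  \<comment> \<open>Squaring passes from the measure of \<open>R\<close> to that of \<open>P\<close>
    at the unit.\<close>
  define \<mu>' where "\<mu>' = distr \<mu> borel (\<lambda>t. t\<^sup>2)"
  have sq: "(\<lambda>t::real. t\<^sup>2) \<in> borel_measurable \<mu>" unfolding measurable_cong_sets[OF \<mu>(2) refl] by measurable
  have \<mu>'_int: "(\<integral>t. g t \<partial>\<mu>') = (\<integral>t. g (t\<^sup>2) \<partial>\<mu>)" if "g \<in> borel_measurable borel" for g :: "real \<Rightarrow> real"
    unfolding \<mu>'_def by (rule integral_distr[OF sq that])
  \<comment> \<open>The last index stands for the measure at the unit with coefficient
    \<open>- card F\<close>, the others for the eigenvectors.\<close>
  define MM where "MM j = (if j < ?N then \<nu> j else \<mu>')" for j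
  define aa where "aa j = (if j < ?N then 1 else - real ?N)" for j
  have split: "(\<Sum>j\<in>{..?N}. h j) = (\<Sum>j<?N. h j) + h ?N" for h :: "nat \<Rightarrow> real"
    by (simp add: lessThan_Suc_atMost[symmetric])
  have relation: "(\<Sum>i<?N. \<integral>t. g t \<partial>\<nu> i) = real ?N * (\<integral>t. g (t\<^sup>2) \<partial>\<mu>)" if g: "continuous_on UNIV g" for g
  proof -
    have "(\<Sum>j\<in>{..?N}. aa j * (\<integral>t. g t \<partial>MM j)) = 0"
    proof (rule moment_relation_continuous[OF finite_atMost, where r = "max P_bound (r\<^sup>2)"])
      show "sets (MM j) = sets borel" for j
        using real_distribution.events_eq_borel[OF \<nu>(1)] by (simp add: MM_def \<mu>'_def)
      show "finite_measure (MM j)" for j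
      proof (cases "j < ?N")
        case True
        interpret real_distribution "\<nu> j" by (rule \<nu>(1)[OF True])
        show ?thesis using True finite_measure_axioms by (simp add: MM_def)
      next
        case False
        thus ?thesis using finite_measure.finite_measure_distr[OF \<mu>(1) sq] by (simp add: MM_def \<mu>'_def)
      qed
      show "AE t in MM j. \<bar>t\<bar> \<le> max P_bound (r\<^sup>2)" for j
      proof (cases "j < ?N")
        case True
        show ?thesis unfolding MM_def if_P[OF True] using \<nu>(2)[OF True] by eventually_elim auto
      next
        case False
        have "AE t in \<mu>. \<bar>t\<^sup>2\<bar> \<le> max P_bound (r\<^sup>2)"
          using \<mu>(3) by eventually_elim (auto simp: le_max_iff_disj power_mono)
        thus ?thesis unfolding MM_def if_not_P[OF False] \<mu>'_def by (subst AE_distr_iff[OF sq]) auto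
      qed
      fix n
      have "complex_of_real (\<Sum>i<?N. \<integral>t. t ^ n \<partial>\<nu> i) = (\<Sum>i<?N. ell2_inner I ((P ^^ n) (u i)) (u i))"
        by (simp add: \<nu>(3))
      also have "\<dots> = complex_of_real (real ?N * (\<integral>t. (t\<^sup>2) ^ n \<partial>\<mu>))" unfolding u(4) \<mu>(4)[symmetric] by simp
      finally have "(\<Sum>i<?N. \<integral>t. t ^ n \<partial>\<nu> i) = real ?N * (\<integral>t. (t\<^sup>2) ^ n \<partial>\<mu>)" by (simp only: of_real_eq_iff)
      thus "(\<Sum>j\<in>{..?N}. aa j * (\<integral>t. t ^ n \<partial>MM j)) = 0"
        unfolding split by (simp add: aa_def MM_def \<mu>'_int)
    qed (rule g)
    thus ?thesis unfolding split using \<mu>'_int[OF borel_measurable_continuous_onI[OF g]]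
      by (simp add: aa_def MM_def)
  qed
  have FK: "FK_det G f \<le> ereal (ln (\<Prod>i<?N. ev i + \<epsilon>) / (2 * ?N))" if \<epsilon>: "\<epsilon> > 0" for \<epsilon> :: real
  proof -
    \<comment> \<open>The shift keeps the logarithm finite where an eigenvalue or the support
      reaches 0; the \<open>max\<close> makes \<open>g\<close> continuous on the whole line.\<close>
    define g where "g t = ln (max 0 t + \<epsilon>)" for t
    have g: "continuous_on UNIV g" unfolding g_def using \<epsilon>
      by (intro continuous_intros) (auto simp: max_def split: if_splits)
    note g_meas = borel_measurable_continuous_onI[OF g]
    have jensen: "(\<integral>t. g t \<partial>\<nu> i) \<le> ln (ev i + \<epsilon>)" if i: "i < ?N" for i
    proof -
      interpret real_distribution "\<nu> i" by (rule \<nu>(1)[OF i])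
      have pos: "ev i + \<epsilon> > 0" using ev[OF i] \<epsilon> by simp
      have mean: "(\<integral>t. t \<partial>\<nu> i) = ev i"
        using \<nu>(3)[OF i, of 1] u(3)[OF i] by simp
      have bdd: "AE t in \<nu> i. norm t \<le> P_bound" using \<nu>(2)[OF i] by eventually_elim auto
      have int: "integrable (\<nu> i) (\<lambda>t. t)" by (rule integrable_const_bound[OF bdd]) simp
      \<comment> \<open>Jensen's inequality through the tangent of the logarithm at the mean
        \<open>ev i\<close>.\<close>
      have tangent: "g t \<le> ln (ev i + \<epsilon>) + (t - ev i) / (ev i + \<epsilon>)" if "t \<ge> 0" for t
      proof -
        have "ln ((t + \<epsilon>) / (ev i + \<epsilon>)) \<le> (t + \<epsilon>) / (ev i + \<epsilon>) - 1"
          using that \<epsilon> pos by (intro ln_le_minus_one) simp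
        moreover have "ln ((t + \<epsilon>) / (ev i + \<epsilon>)) = ln (t + \<epsilon>) - ln (ev i + \<epsilon>)"
          using that \<epsilon> pos by (subst ln_divide_pos) auto
        moreover have "(t + \<epsilon>) / (ev i + \<epsilon>) - 1 = (t - ev i) / (ev i + \<epsilon>)"
          using pos by (simp add: field_simps)
        ultimately show ?thesis using that by (simp add: g_def)
      qed
      have "AE t in \<nu> i. norm (g t) \<le> max \<bar>ln \<epsilon>\<bar> \<bar>ln (P_bound + \<epsilon>)\<bar>"
        using \<nu>(2)[OF i]
      proof eventually_elim
        case (elim t)
        hence "ln \<epsilon> \<le> ln (t + \<epsilon>)" "ln (t + \<epsilon>) \<le> ln (P_bound + \<epsilon>)" using \<epsilon> by auto
        thus ?case using elim by (auto simp: g_def)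
      qed
      hence intg: "integrable (\<nu> i) g" by (rule integrable_const_bound) (simp add: g_meas)
      have "(\<integral>t. g t \<partial>\<nu> i) \<le> (\<integral>t. ln (ev i + \<epsilon>) + (t - ev i) / (ev i + \<epsilon>) \<partial>\<nu> i)"
      proof (rule integral_mono_AE[OF intg])
        show "AE t in \<nu> i. g t \<le> ln (ev i + \<epsilon>) + (t - ev i) / (ev i + \<epsilon>)"
          using \<nu>(2)[OF i] by eventually_elim (simp add: tangent)
      qed (intro Bochner_Integration.integrable_add Bochner_Integration.integrable_diff integrable_divide int integrable_const)
      also have "\<dots> = ln (ev i + \<epsilon>)"
        using int prob_space by (simp add: mean)
      finally show ?thesis .
    qed
    have N_le: "real ?N * (\<integral>t. g (t\<^sup>2) \<partial>\<mu>) \<le> ln (\<Prod>i<?N. ev i + \<epsilon>)"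
    proof -
      have "real ?N * (\<integral>t. g (t\<^sup>2) \<partial>\<mu>) \<le> (\<Sum>i<?N. ln (ev i + \<epsilon>))"
        unfolding relation[OF g, symmetric] by (intro sum_mono jensen) auto
      also have "\<dots> = ln (\<Prod>i<?N. ev i + \<epsilon>)"
        using add_nonneg_pos[OF ev \<epsilon>] by (intro ln_prod[symmetric] finite_lessThan) (metis lessThan_iff less_irrefl)
      finally show ?thesis .
    qed
    interpret \<mu>: finite_measure \<mu> by (rule \<mu>(1))
    \<comment> \<open>For positive \<open>t\<close> the number \<open>ln t\<close> is half of
      \<open>ln (t\<^sup>2)\<close>, which the shift only increases.\<close>
    have "FK_det G f \<le> ereal (\<integral>t. g (t\<^sup>2) / 2 \<partial>\<mu>)"
      unfolding FK_det_def \<mu>_def[symmetric]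
    proof (rule log_integral_le[OF \<mu>(1-3)])
      have "AE t in \<mu>. norm (g (t\<^sup>2) / 2) \<le> max \<bar>ln \<epsilon>\<bar> \<bar>ln (r\<^sup>2 + \<epsilon>)\<bar>"
        using \<mu>(3)
      proof eventually_elim
        case (elim t)
        have "t\<^sup>2 \<le> r\<^sup>2" using elim by (intro power_mono) auto
        hence "ln \<epsilon> \<le> ln (t\<^sup>2 + \<epsilon>)" "ln (t\<^sup>2 + \<epsilon>) \<le> ln (r\<^sup>2 + \<epsilon>)" using \<epsilon> by (auto simp: add_nonneg_pos)
        thus ?case by (auto simp: g_def)
      qed
      moreover have "(\<lambda>t. g (t\<^sup>2) / 2) \<in> borel_measurable \<mu>"
        using measurable_compose[OF sq g_meas] by measurable
      ultimately show "integrable \<mu> (\<lambda>t. g (t\<^sup>2) / 2)" by (rule \<mu>.integrable_const_bound)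
      fix t :: real assume t: "t \<ge> 0"
      show "ereal_log t \<le> ereal (g (t\<^sup>2) / 2)"
      proof (cases "t = 0")
        case False
        hence "2 * ln t = ln (t\<^sup>2)" using t by (simp add: ln_realpow)
        also have "\<dots> \<le> ln (t\<^sup>2 + \<epsilon>)" using False \<epsilon> by (simp add: add_pos_pos)
        finally show ?thesis using t False by (simp add: ereal_log_def g_def)
      qed (simp add: ereal_log_def)
    qed
    also have "(\<integral>t. g (t\<^sup>2) / 2 \<partial>\<mu>) = (\<integral>t. g (t\<^sup>2) \<partial>\<mu>) / 2" by simp
    also have "ereal \<dots> \<le> ereal (ln (\<Prod>i<?N. ev i + \<epsilon>) / (2 * ?N))"
      using N_le N by (simp add: field_simps)
    finally show ?thesis .
  qed
  show ?thesis using that[OF B ev det FK] by blast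
qed

text \<open>The shift tends to 0. A real \<open>c\<close> strictly between the two sides of the
  negated claim also covers a vanishing sum, whose logarithm is
  \<open>- \<infinity>\<close>.\<close>

lemma FK_det_le_log_inj_sum:
  assumes "F \<in> fin_subsets G"
  shows "\<exists>B. finite B \<and> B \<subseteq> carrier G \<and>
    FK_det G f \<le> ereal_log (inj_sum (\<lambda>u t. cmod (f (t \<otimes> inv u))) F B) / ereal (real (card F))"
proof -
  have F: "finite F" "F \<noteq> {}" "F \<subseteq> carrier G" using assms by (auto simp: fin_subsets_def)
  have N: "card F > 0" using F by (simp add: card_gt_0_iff)
  obtain B and ev :: "nat \<Rightarrow> real" where B: "finite B" "B \<subseteq> carrier G"
    and ev: "\<And>i. i < card F \<Longrightarrow> ev i \<ge> 0"
    and det: "(\<Prod>i<card F. ev i) \<le> (inj_sum (\<lambda>u t. cmod (f (t \<otimes> inv u))) F B)\<^sup>2"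
    and FK: "\<And>\<epsilon>. \<epsilon> > 0 \<Longrightarrow> FK_det G f \<le> ereal (ln (\<Prod>i<card F. ev i + \<epsilon>) / (2 * card F))"
    by (rule log_det_compression[OF F]) (rule that)
  define J where "J = inj_sum (\<lambda>u t. cmod (f (t \<otimes> inv u))) F B"
  have J: "J \<ge> 0" unfolding J_def by (intro inj_sum_nonneg) simp
  have "FK_det G f \<le> ereal_log J / ereal (real (card F))"
  proof (rule ccontr)
    assume "\<not> ?thesis"
    hence "ereal_log J / ereal (real (card F)) < FK_det G f" by (simp only: not_le)
    then obtain c where c: "ereal_log J / ereal (real (card F)) < ereal c" "ereal c < FK_det G f"
      using ereal_dense2 by blast
    have "J < exp (c * card F)" using c(1) N by (simp add: ereal_log_divide_less_iff)
    hence "J\<^sup>2 < (exp (c * card F))\<^sup>2" using J by (intro power_strict_mono) auto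
    hence lt: "(\<Prod>i<card F. ev i + 0) < exp (2 * c * card F)"
      using det by (simp add: J_def exp_double[symmetric] mult.assoc)
    have "((\<lambda>\<epsilon>. \<Prod>i<card F. ev i + \<epsilon>) \<longlongrightarrow> (\<Prod>i<card F. ev i + 0)) (at_right 0)"
      by (intro tendsto_intros)
    hence "\<forall>\<^sub>F \<epsilon> in at_right 0. (\<Prod>i<card F. ev i + \<epsilon>) < exp (2 * c * card F)"
      using lt by (rule order_tendstoD(2))
    moreover have "\<forall>\<^sub>F \<epsilon> :: real in at_right 0. \<epsilon> > 0" by (rule eventually_at_right_less)
    ultimately have ev_eps: "\<forall>\<^sub>F \<epsilon> in at_right (0::real). \<epsilon> > 0 \<and> (\<Prod>i<card F. ev i + \<epsilon>) < exp (2 * c * card F)"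
      by eventually_elim simp
    have "\<exists>\<epsilon>::real. \<epsilon> > 0 \<and> (\<Prod>i<card F. ev i + \<epsilon>) < exp (2 * c * card F)"
      by (rule eventually_happens'[OF _ ev_eps]) simp
    then obtain \<epsilon> :: real where \<epsilon>: "\<epsilon> > 0" "(\<Prod>i<card F. ev i + \<epsilon>) < exp (2 * c * card F)"
      by blast
    have pos: "(\<Prod>i<card F. ev i + \<epsilon>) > 0" using add_nonneg_pos[OF ev \<epsilon>(1)] by (intro prod_pos) auto
    have "ln (\<Prod>i<card F. ev i + \<epsilon>) < ln (exp (2 * c * card F))"
      using pos \<epsilon>(2) by (subst ln_less_cancel_iff) auto
    hence "ln (\<Prod>i<card F. ev i + \<epsilon>) / (2 * card F) < c" using N by (simp add: field_simps)
    hence "ereal (ln (\<Prod>i<card F. ev i + \<epsilon>) / (2 * card F)) < ereal c" by simp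
    from le_less_trans[OF FK[OF \<epsilon>(1)] less_trans[OF this c(2)]] show False by simp
  qed
  thus ?thesis using B by (auto simp: J_def)
qed

end

theorem proposition5p2:
  fixes G :: "('a, 'm) monoid_scheme" (structure)
    and f :: "'a \<Rightarrow> complex"
  assumes "group G"
    and "countable (carrier G)"
    and "infinite (carrier G)"
    and "amenable G"
    and "f \<in> group_ring G"
  shows "permanent G (\<lambda>s. cmod (f s)) \<ge> FK_det G f"
proof (rule permanent_ge[OF assms(1,4)])
  interpret group_ring_element G f
    using assms by (simp add: group_ring_element_def group_ring_element_axioms_def)
  show "finite {s. cmod (f s) \<noteq> 0}" "{s. cmod (f s) \<noteq> 0} \<subseteq> carrier G" using supp by auto
  show "\<exists>B. finite B \<and> B \<subseteq> carrier G \<and>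
      FK_det G f \<le> ereal_log (inj_sum (\<lambda>u t. cmod (f (t \<otimes> inv u))) F B) / ereal (real (card F))"
    if "F \<in> fin_subsets G" for F
    using that by (rule FK_det_le_log_inj_sum)
qed simp

end
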